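(* Let $M$ be a Noetherian $R_d$-module, $\alpha_M$ the corresponding algebraic $\mathbb{Z}^d$-action, and $V$ a linear subspace of $\mathbb{R}^d$. Then the following are equivalent. (1) $\alpha_M$ is expansive along $V$. (2) $\alpha_{R_d/\mathfrak{p}}$ is expansive along $V$ for every $\mathfrak{p}\in\operatorname{asc}(M)$. (3) For every $\mathfrak{p}\in\operatorname{asc}(M)$, $R_d/\mathfrak{p}$ is Noetherian along $V$ and $V^\perp\cap\log|\mathsf{V}(\mathfrak{p})|=\emptyset$.
   Context: $R_d=\mathbb{Z}[u_1^{\pm1},\dots,u_d^{\pm1}]$ is the ring of Laurent polynomials in $d\ge1$ commuting variables, and $u^{\mathbf{n}}=u_1^{n_1}\cdots u_d^{n_d}$ for $\mathbf{n}\in\mathbb{Z}^d$. For an $R_d$-module $M$ (regarded as a discrete abelian group), $X_M=\widehat{M}$ is its compact Pontryagin dual, and $\alpha_M$ is the $\mathbb{Z}^d$-action by continuous automorphisms of $X_M$ for which $\alpha_M^{\mathbf{n}}$ is dual to multiplication by $u^{\mathbf{n}}$ on $M$. If $M$ is Noetherian then $M$ is countable, so $X_M$ is metrizable. A prime ideal $\mathfrak{p}\subset R_d$ is associated to $M$ if $\mathfrak{p}=\{f\in R_d: f\cdot m=0\}$ for some $m\in M$; $\operatorname{asc}(M)$ is the set of such primes. Expansiveness: for a $\mathbb{Z}^d$-action $\beta$ by homeomorphisms of a compact metric space $(X,\rho)$ and $F\subset\mathbb{R}^d$, put $\rho_\beta^F(x,y)=\sup\{\rho(\beta^{\mathbf{n}}x,\beta^{\mathbf{n}}y):\mathbf{n}\in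 F\cap\mathbb{Z}^d\}$ (and $0$ if $F\cap\mathbb{Z}^d=\emptyset$), and $F^t=\{\mathbf{x}\in\mathbb{R}^d:\operatorname{dist}(\mathbf{x},F)\le t\}$ (Euclidean distance). $\beta$ is expansive along $F$ if there are $\varepsilon>0$, $t>0$ such that $\rho_\beta^{F^t}(x,y)\le\varepsilon$ implies $x=y$. $\mathsf{H}_d$ is the set of half-spaces $H_{\mathbf{v}}=\{\mathbf{x}\in\mathbb{R}^d:\mathbf{x}\cdot\mathbf{v}\le0\}$ with $\|\mathbf{v}\|=1$. For $H\in\mathsf{H}_d$, $R_H=\mathbb{Z}[u^{\mathbf{n}}:\mathbf{n}\in H\cap\mathbb{Z}^d]\subset R_d$, and an $R_d$-module is $R_H$-Noetherian if it is Noetherian as an $R_H$-module. A Noetherian $R_d$-module $M$ is Noetherian along a subspace $V$ if $M$ is $R_H$-Noetherian for every half-space $H\in\mathsf{H}_d$ containing $V$. For an ideal $\mathfrak{a}\subset R_d$, $\mathsf{V}(\mathfrak{a})=\{\mathbf{z}\in(\mathbb{C}\setminus\{0\})^d: f(\mathbf{z})=0\text{ for all }f\in\mathfrak{a}\}$ and $\log|\mathsf{V}(\mathfrak{a})|=\{(\log|z_1|,\dots,\log|z_d|):\mathbf{z}\in\mathsf{V}(\mathfrak{a})\}\subset\mathbb{R}^d$. $V^\perp$ is the orthogonal complement of $V$ in $\mathbb{R}^d$. *)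

theory Defs
  imports "HOL-Analysis.Analysis" "HOL-Algebra.Algebra" "HOL-Algebra.Algebraic_Closure_Type"
   "HOL-Library.Poly_Mapping"
begin

section \<open>The ring of Laurent polynomials and its modules\<close>

text \<open>
  The number of variables is \<open>d = CARD('d)\<close>, which is at least 1.  A Laurent polynomial is the
  finitely supported family of its coefficients, indexed by exponents in \<open>\<int>\<^sup>d\<close>; the product that
  the library defines on this type is convolution.
\<close>

type_synonym 'd laurent = "(int ^ 'd) \<Rightarrow>\<^sub>0 int"

definition laurent_ring :: "('d::finite) laurent ring" where
  "laurent_ring = ring_of_type_algebra"

lemma cring_laurent_ring: "cring (laurent_ring :: ('d::finite) laurent ring)"
  unfolding laurent_ring_def by (rule cring_from_type_algebra)

definition u_pow :: "int ^ 'd \<Rightarrow> ('d::finite) laurent" where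
  "u_pow n = Poly_Mapping.single n 1"

definition noetherian_module :: "('r, 's) ring_scheme \<Rightarrow> ('r, 'm, 't) module_scheme \<Rightarrow> bool" where
  "noetherian_module R M \<longleftrightarrow>
     Module.module R M \<and>
     (\<forall>N. submodule N R M \<longrightarrow>
        (\<exists>A. finite A \<and> A \<subseteq> N \<and> N = \<Inter>{N'. submodule N' R M \<and> A \<subseteq> N'}))"

text \<open>The cyclic module \<open>R / I\<close>; as a set it is the set of cosets of the ideal \<open>I\<close>.\<close>

definition quotient_module :: "('r, 's) ring_scheme \<Rightarrow> 'r set \<Rightarrow> ('r, 'r set) module" where
  "quotient_module R I =
     ring.extend (R Quot I) \<lparr> smult = (\<lambda>r c. (I +>\<^bsub>R\<^esub> r) \<otimes>\<^bsub>R Quot I\<^esub> c) \<rparr>"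

lemma module_quotient_module:
  fixes R (structure)
  assumes "cring R" "ideal I R"
  shows "Module.module R (quotient_module R I)"
proof -
  interpret cring R by fact
  interpret ideal I R by fact
  interpret Q: cring "R Quot I"
    by (rule quotient_is_cring) fact
  interpret h: ring_hom_ring R "R Quot I" "(+>) I"
    by (rule rcos_ring_hom_ring)
  have [simp]: "carrier (quotient_module R I) = carrier (R Quot I)"
    "add (quotient_module R I) = add (R Quot I)" "ring.zero (quotient_module R I) = ring.zero (R Quot I)"
    "smult (quotient_module R I) = (\<lambda>r c. (I +> r) \<otimes>\<^bsub>R Quot I\<^esub> c)"
    by (simp_all add: quotient_module_def ring.extend_def)
  show ?thesis
  proof (rule moduleI)
    show "abelian_group (quotient_module R I)"
      by (rule abelian_groupI)
        (auto simp: Q.a_ac intro: Q.l_neg bexI[of _ "\<ominus>\<^bsub>R Quot I\<^esub> _"])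
  qed (auto simp: Q.l_distr Q.r_distr Q.m_assoc cring_axioms)
qed

definition associated_primes :: "('r, 's) ring_scheme \<Rightarrow> ('r, 'm, 't) module_scheme \<Rightarrow> 'r set set" where
  "associated_primes R M =
     {P. primeideal P R \<and>
         (\<exists>m\<in>carrier M. P = {f \<in> carrier R. f \<odot>\<^bsub>M\<^esub> m = \<zero>\<^bsub>M\<^esub>})}"


section \<open>The dual action\<close>

definition circle_group :: "complex monoid" where
  "circle_group = \<lparr> carrier = sphere 0 1, monoid.mult = (*), one = 1 \<rparr>"

text \<open>
  The Pontryagin dual of the discrete additive group of \<open>M\<close>: since the group is discrete, the
  compact-open topology on the characters is the topology of pointwise convergence.  Characters are
  extensional, i.e. they take a fixed dummy value outside of \<open>carrier M\<close>.
\<close>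

definition dual_carrier :: "('r, 'm, 't) module_scheme \<Rightarrow> ('m \<Rightarrow> complex) set" where
  "dual_carrier M = hom (add_monoid M) circle_group \<inter> extensional (carrier M)"

definition dual_space :: "('r, 'm, 't) module_scheme \<Rightarrow> ('m \<Rightarrow> complex) topology" where
  "dual_space M = subtopology (product_topology (\<lambda>_. euclidean) (carrier M)) (dual_carrier M)"

definition dual_action ::
  "(('d::finite) laurent, 'm, 't) module_scheme \<Rightarrow> int ^ 'd \<Rightarrow> ('m \<Rightarrow> complex) \<Rightarrow> ('m \<Rightarrow> complex)" where
  "dual_action M n x = (\<lambda>m\<in>carrier M. x (u_pow n \<odot>\<^bsub>M\<^esub> m))"


lemma topspace_dual_space [simp]: "topspace (dual_space M) = dual_carrier M"
  by (auto simp: dual_space_def dual_carrier_def PiE_def)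

lemma compact_space_dual_space:
  fixes M :: "('r, 'm, 't) module_scheme"
  assumes "abelian_group M"
  shows "compact_space (dual_space M)"
proof -
  interpret abelian_group M by fact
  let ?P = "product_topology (\<lambda>_. euclidean) (carrier M) :: ('m \<Rightarrow> complex) topology"
  let ?K = "PiE (carrier M) (\<lambda>_. sphere 0 1) :: ('m \<Rightarrow> complex) set"
  let ?E = "\<lambda>a b. {x \<in> topspace ?P. x (a \<oplus>\<^bsub>M\<^esub> b) - x a * x b \<in> {0}}"
  have K: "compactin ?P ?K"
    by (simp add: compactin_PiE)
  have mult: "continuous_map ?P euclidean (\<lambda>x. x a * x b)"
    if "continuous_map ?P euclidean (\<lambda>x. x a)" "continuous_map ?P euclidean (\<lambda>x. x b)" for a b
    using that by (simp add: continuous_map_atin tendsto_mult)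
  have E: "closedin ?P (?E a b)" if "a \<in> carrier M" "b \<in> carrier M" for a b
    by (rule closedin_continuous_map_preimage[where Y = euclidean])
      (use that in \<open>auto intro!: mult continuous_intros continuous_map_product_projection\<close>)
  have "closedin ?P (\<Inter>(a, b)\<in>carrier M \<times> carrier M. ?E a b)"
    using E by (intro closedin_INT) auto
  then have "compactin ?P (?K \<inter> (\<Inter>(a, b)\<in>carrier M \<times> carrier M. ?E a b))"
    by (rule compact_Int_closedin[OF K])
  also have "?K \<inter> (\<Inter>(a, b)\<in>carrier M \<times> carrier M. ?E a b) = dual_carrier M"
    by (auto simp: dual_carrier_def hom_def circle_group_def PiE_def Pi_iff)
  finally show ?thesis
    by (simp add: dual_space_def compactin_subspace)
qed

lemma dual_action_closed:
  assumes "Module.module laurent_ring M" "x \<in> dual_carrier M"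
  shows "dual_action M n x \<in> dual_carrier M"
proof -
  interpret Module.module laurent_ring M by fact
  have [simp]: "u_pow n \<in> carrier laurent_ring"
    by (simp add: laurent_ring_def ring_of_type_algebra_def)
  show ?thesis
    using assms(2) by (auto simp: dual_carrier_def dual_action_def hom_def smult_r_distr)
qed


section \<open>Expansiveness along a subset of Euclidean space\<close>

definition real_of_int_vec :: "int ^ 'd \<Rightarrow> real ^ 'd" where
  "real_of_int_vec n = (\<chi> i. real_of_int (n $ i))"

text \<open>The case distinction is needed since \<open>infdist x {} = 0\<close> in the library.\<close>

definition thickening :: "(real ^ 'd) set \<Rightarrow> real \<Rightarrow> (real ^ ('d::finite)) set" where
  "thickening F t = (if F = {} then {} else {x. infdist x F \<le> t})"

definition dist_along ::
  "('x \<Rightarrow> 'x \<Rightarrow> real) \<Rightarrow> (int ^ 'd \<Rightarrow> 'x \<Rightarrow> 'x) \<Rightarrow> (real ^ 'd) set \<Rightarrow> 'x \<Rightarrow> 'x \<Rightarrow> real" where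
  "dist_along \<rho> \<beta> F x y =
     (if {n. real_of_int_vec n \<in> F} = {} then 0
      else SUP n\<in>{n. real_of_int_vec n \<in> F}. \<rho> (\<beta> n x) (\<beta> n y))"

definition metric_expansive_along ::
  "'x set \<Rightarrow> ('x \<Rightarrow> 'x \<Rightarrow> real) \<Rightarrow> (int ^ 'd \<Rightarrow> 'x \<Rightarrow> 'x) \<Rightarrow> (real ^ ('d::finite)) set \<Rightarrow> bool" where
  "metric_expansive_along S \<rho> \<beta> F \<longleftrightarrow>
     (\<exists>\<epsilon>>0. \<exists>t>0. \<forall>x\<in>S. \<forall>y\<in>S. dist_along \<rho> \<beta> (thickening F t) x y \<le> \<epsilon> \<longrightarrow> x = y)"

text \<open>
  For a compact metrizable space, which comes without a preferred metric, we use some metric that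
  induces the topology.  By \<open>metric_expansive_along_cong\<close> below (applicable by
  \<open>compact_space_dual_space\<close> and \<open>dual_action_closed\<close>) it does not matter which one.
\<close>

definition expansive_along ::
  "'x topology \<Rightarrow> (int ^ 'd \<Rightarrow> 'x \<Rightarrow> 'x) \<Rightarrow> (real ^ ('d::finite)) set \<Rightarrow> bool" where
  "expansive_along T \<beta> F \<longleftrightarrow>
     (\<exists>\<rho>. Metric_space (topspace T) \<rho> \<and> Metric_space.mtopology (topspace T) \<rho> = T \<and>
          metric_expansive_along (topspace T) \<rho> \<beta> F)"

lemma metric_expansive_along_transfer:
  fixes T :: "'x topology" and \<beta> :: "int ^ 'd \<Rightarrow> 'x \<Rightarrow> 'x" and F :: "(real ^ 'd) set"
  assumes T: "compact_space T" and \<beta>: "\<And>n x. x \<in> topspace T \<Longrightarrow> \<beta> n x \<in> topspace T"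
    and 1: "Metric_space (topspace T) \<rho>" "Metric_space.mtopology (topspace T) \<rho> = T"
    and 2: "Metric_space (topspace T) \<rho>'" "Metric_space.mtopology (topspace T) \<rho>' = T"
    and exp: "metric_expansive_along (topspace T) \<rho> \<beta> F"
  shows "metric_expansive_along (topspace T) \<rho>' \<beta> F"
proof -
  obtain \<epsilon> t where "\<epsilon> > 0" "t > 0"
    and E: "\<And>x y. x \<in> topspace T \<Longrightarrow> y \<in> topspace T \<Longrightarrow>
              dist_along \<rho> \<beta> (thickening F t) x y \<le> \<epsilon> \<Longrightarrow> x = y"
    using exp unfolding metric_expansive_along_def by blast
  interpret m1: Metric_space "topspace T" \<rho> by (rule 1)
  interpret m2: Metric_space "topspace T" \<rho>' by (rule 2)
  have "uniformly_continuous_map (metric (topspace T, \<rho>')) (metric (topspace T, \<rho>)) (\<lambda>x. x)"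
    using T 1 2 by (intro continuous_imp_uniformly_continuous_map) auto
  then obtain \<delta> where "\<delta> > 0"
    and D: "\<And>x y. x \<in> topspace T \<Longrightarrow> y \<in> topspace T \<Longrightarrow> \<rho>' y x < \<delta> \<Longrightarrow> \<rho> y x < \<epsilon>"
    using \<open>\<epsilon> > 0\<close> unfolding uniformly_continuous_map_def by auto
  have "compactin m2.mtopology (topspace T)"
    using T 2 by (simp add: compact_space_def)
  then have "m2.mbounded (topspace T)"
    by (rule m2.compactin_imp_mbounded)
  then obtain B where B: "\<And>x y. x \<in> topspace T \<Longrightarrow> y \<in> topspace T \<Longrightarrow> \<rho>' x y \<le> B"
    unfolding m2.mbounded_alt by blast
  have "x = y" if xy: "x \<in> topspace T" "y \<in> topspace T"
    and le: "dist_along \<rho>' \<beta> (thickening F t) x y \<le> \<delta> / 2" for x y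
  proof (rule E[OF xy])
    let ?N = "{n. real_of_int_vec n \<in> thickening F t}"
    show "dist_along \<rho> \<beta> (thickening F t) x y \<le> \<epsilon>"
    proof (cases "?N = {}")
      case True
      then show ?thesis using \<open>\<epsilon> > 0\<close> by (simp add: dist_along_def)
    next
      case False
      have "\<rho> (\<beta> n x) (\<beta> n y) \<le> \<epsilon>" if "n \<in> ?N" for n
      proof -
        have "\<rho>' (\<beta> n x) (\<beta> n y) \<le> (SUP n\<in>?N. \<rho>' (\<beta> n x) (\<beta> n y))"
          using that B \<beta> xy by (intro cSUP_upper bdd_aboveI2[where M = B]) auto
        also have "\<dots> < \<delta>"
          using le False \<open>\<delta> > 0\<close> by (simp add: dist_along_def split: if_splits)
        finally show ?thesis
          using D \<beta> xy by (meson less_imp_le)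
      qed
      then show ?thesis
        using False by (auto simp: dist_along_def intro!: cSUP_least)
    qed
  qed
  then show ?thesis
    using \<open>\<delta> > 0\<close> \<open>t > 0\<close> unfolding metric_expansive_along_def
    by (intro exI[of _ "\<delta> / 2"] conjI exI[of _ t]) auto
qed

lemma metric_expansive_along_cong:
  fixes T :: "'x topology" and \<beta> :: "int ^ 'd \<Rightarrow> 'x \<Rightarrow> 'x" and F :: "(real ^ 'd) set"
  assumes "compact_space T" "\<And>n x. x \<in> topspace T \<Longrightarrow> \<beta> n x \<in> topspace T"
    and "Metric_space (topspace T) \<rho>" "Metric_space.mtopology (topspace T) \<rho> = T"
    and "Metric_space (topspace T) \<rho>'" "Metric_space.mtopology (topspace T) \<rho>' = T"
  shows "metric_expansive_along (topspace T) \<rho> \<beta> F \<longleftrightarrow> metric_expansive_along (topspace T) \<rho>' \<beta> F"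
  using metric_expansive_along_transfer assms by metis

abbreviation algebraic_action_expansive_along ::
  "(('d::finite) laurent, 'm, 't) module_scheme \<Rightarrow> (real ^ 'd) set \<Rightarrow> bool" where
  "algebraic_action_expansive_along M F \<equiv> expansive_along (dual_space M) (dual_action M) F"


section \<open>Half-spaces and the Noetherian condition along a subspace\<close>

definition half_spaces :: "(real ^ ('d::finite)) set set" where
  "half_spaces = {{x. x \<bullet> v \<le> 0} | v. norm v = 1}"

definition half_space_ring :: "(real ^ 'd) set \<Rightarrow> ('d::finite) laurent ring" where
  "half_space_ring H =
     laurent_ring\<lparr>carrier := generate_ring laurent_ring {u_pow n | n. real_of_int_vec n \<in> H}\<rparr>"

definition noetherian_along ::
  "(('d::finite) laurent, 'm, 't) module_scheme \<Rightarrow> (real ^ 'd) set \<Rightarrow> bool" where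
  "noetherian_along M V \<longleftrightarrow>
     noetherian_module laurent_ring M \<and>
     (\<forall>H\<in>half_spaces. V \<subseteq> H \<longrightarrow> noetherian_module (half_space_ring H) M)"


section \<open>Complex varieties and their logarithmic images\<close>

definition laurent_eval :: "('d::finite) laurent \<Rightarrow> complex ^ 'd \<Rightarrow> complex" where
  "laurent_eval f z =
     (\<Sum>n\<in>Poly_Mapping.keys f. of_int (Poly_Mapping.lookup f n) * (\<Prod>i\<in>UNIV. (z $ i) powi (n $ i)))"

definition variety :: "('d::finite) laurent set \<Rightarrow> (complex ^ 'd) set" where
  "variety \<aa> = {z. (\<forall>i. z $ i \<noteq> 0) \<and> (\<forall>f\<in>\<aa>. laurent_eval f z = 0)}"

definition log_variety :: "('d::finite) laurent set \<Rightarrow> (real ^ 'd) set" where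
  "log_variety \<aa> = (\<lambda>z. \<chi> i. ln (cmod (z $ i))) ` variety \<aa>"

end

theory Submission
  imports Defs
begin

text \<open>
  Call a prime \<open>P\<close> good if it satisfies \<open>V\<^sup>\<bottom> \<inter> log |V(P)| = \<emptyset>\<close> and contains
  for every unit vector \<open>v \<in> V\<^sup>\<bottom>\<close> an element \<open>1 - g\<close> all of whose exponents \<open>k\<close> in \<open>g\<close> satisfy
  \<open>k \<bullet> v < 0\<close>; the latter says that \<open>R / P\<close> is Noetherian over the half-space ring of \<open>v\<close>, because it
  makes this ring surject onto \<open>R / P\<close>.  An action is expansive along \<open>V\<close> iff all associated primes
  are good; applied to \<open>M\<close> and to each \<open>R / P\<close>, whose only associated prime is \<open>P\<close>, this gives both
  equivalences.

  If \<open>P\<close> is good, finitely many relations \<open>1 - g\<close> suffice, by compactness, to move exponents towards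
  \<open>V\<close>, so the monomials in a slab around \<open>V\<close> span \<open>R / P\<close>, and the \<open>\<ell>\<^sup>1\<close>-norm on this slab induces a
  submultiplicative seminorm on the complexification.  If it were nonzero, Gelfand theory would
  give a bounded character, that is, a point of \<open>V(P)\<close> whose logarithm is orthogonal to \<open>V\<close>.  Hence
  \<open>1\<close> is congruent to combinations of slab monomials with arbitrarily small coefficients.  A
  character of \<open>R / P\<close> that is close to 1 on a slab lifts to a small real function satisfying the
  same relations exactly, and the contraction forces it to vanish.  Extension along a filtration of
  \<open>M\<close> by cyclic modules transfers this to \<open>M\<close>.

  Conversely, if \<open>M\<close> is expansive, then since characters separate subgroups, \<open>M\<close> is generated by the
  monomial multiples, from a slab, of a finite set.  Passing to a quotient of \<open>M\<close> that is cyclic up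
  to a multiplicative set disjoint from \<open>P\<close> yields the elements \<open>1 - g\<close>.  In the same way a point
  \<open>z \<in> V(P)\<close> yields a nonzero additive map \<open>\<psi>\<close> from \<open>M\<close> to the complex numbers on which \<open>u\<^sup>n\<close> acts
  by \<open>z\<^sup>n\<close>; if \<open>log |z|\<close> is orthogonal to \<open>V\<close>, the characters \<open>exp (i s Re \<psi>)\<close> with small \<open>s\<close>
  contradict expansiveness.
\<close>

section \<open>Characters bounded by a submultiplicative seminorm\<close>

text \<open>The primes met along a filtration of \<open>M\<close> need not be associated to
  \<open>M\<close>. Goodness, however, passes from an ideal to every larger one, and each prime met
  contains an associated prime; hence \<open>rigid_add_cyclic\<close> accepts any good ideal inside
  the colon ideal.

  Two constants shape the direction from good primes to expansiveness. A product of slab polynomials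
  leaves the slab, but by subadditivity of the distance it reaches at most twice the height, and
  bringing it back costs a fixed factor. Multiplying the quotient norm by this factor makes it
  submultiplicative. The same factor \<open>C ^ J\<close> dictates how small a representative of 1
  is wanted: below \<open>1 / (2 * C ^ J)\<close>, so that the contraction survives the return to
  the slab.

  Characters determine their angles only modulo 1, so relations between angles hold only up to
  integers. Only finitely many relations are applied, and a wide enough slab makes all of them exact
  at once.\<close>

lemma power_2_Suc: "x ^ (2 ^ Suc k) = x ^ (2 ^ k) * (x ^ (2 ^ k) :: 'a::monoid_mult)"
  by (simp add: power_add[symmetric] mult_2)

text \<open>A commutative complex algebra, presented by its structure map. It carries no norm and no
  completeness; analysis enters only through seminorms.\<close>

locale complex_scalars =
  fixes \<iota> :: "complex \<Rightarrow> 'a::comm_ring_1"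
  assumes scalar_add: "\<iota> (c + d) = \<iota> c + \<iota> d"
    and scalar_mult: "\<iota> (c * d) = \<iota> c * \<iota> d"
    and scalar_one: "\<iota> 1 = 1"
begin

lemma scalar_zero: "\<iota> 0 = 0"
  using scalar_add[of 0 0] by simp

lemma scalar_minus: "\<iota> (- c) = - \<iota> c"
  using scalar_add[of c "- c"] by (simp add: scalar_zero eq_neg_iff_add_eq_0 add.commute)

lemma scalar_diff: "\<iota> (c - d) = \<iota> c - \<iota> d"
  using scalar_add[of c "- d"] by (simp add: scalar_minus)

lemma scalar_power: "\<iota> (c ^ n) = \<iota> c ^ n"
  by (induction n) (simp_all add: scalar_mult scalar_one)

text \<open>Submultiplicativity leaves only \<open>q 1 = 0\<close> or \<open>1 \<le> q 1\<close>;
  the last clause excludes the zero seminorm.\<close>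

definition alg_seminorm :: "('a \<Rightarrow> real) \<Rightarrow> bool" where
  "alg_seminorm q \<longleftrightarrow> (\<forall>a. 0 \<le> q a) \<and> (\<forall>a b. q (a + b) \<le> q a + q b) \<and>
     (\<forall>a b. q (a * b) \<le> q a * q b) \<and> (\<forall>c a. q (\<iota> c * a) \<le> cmod c * q a) \<and> 1 \<le> q 1"

lemma alg_seminormD:
  assumes "alg_seminorm q"
  shows "0 \<le> q a" "q (a + b) \<le> q a + q b" "q (a * b) \<le> q a * q b" "q (\<iota> c * a) \<le> cmod c * q a"
    "1 \<le> q 1"
  using assms unfolding alg_seminorm_def by auto

lemma alg_seminorm_zero: "alg_seminorm q \<Longrightarrow> q 0 = 0"
  using alg_seminormD(4)[of q 0 0] alg_seminormD(1)[of q 0] by (simp add: scalar_zero)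

lemma alg_seminorm_minus:
  assumes "alg_seminorm q" shows "q (- a) = q a"
proof -
  have *: "q (- b) \<le> q b" for b
    using alg_seminormD(4)[OF assms, of "-1" b] by (simp add: scalar_minus scalar_one)
  show ?thesis using *[of a] *[of "- a"] by simp
qed

lemma alg_seminorm_diff: "alg_seminorm q \<Longrightarrow> q (a - b) \<le> q a + q b"
  using alg_seminormD(2)[of q a "- b"] by (simp add: alg_seminorm_minus)

lemma alg_seminorm_power:
  assumes "alg_seminorm q" "n > 0" shows "q (a ^ n) \<le> q a ^ n"
  using assms(2)
proof (induction n rule: nat_induct_non_zero)
  case 1 then show ?case by simp
next
  case (Suc n)
  have "q (a ^ Suc n) \<le> q a * q (a ^ n)" using alg_seminormD(3)[OF assms(1)] by simp
  also have "\<dots> \<le> q a * q a ^ n"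
    by (intro mult_left_mono Suc.IH alg_seminormD(1)[OF assms(1)])
  finally show ?case by simp
qed

text \<open>The common source of the seminorms below: \<open>S a\<close> collects admissible bounds
  for \<open>a\<close>, and each inequality passes to infima one variable at a time. It serves the
  spectral radius, lower bounds of chains, the limit in \<open>multiplicative_seminorm\<close>, and
  the quotient norm of a slab.\<close>

lemma alg_seminorm_Inf:
  fixes S :: "'a \<Rightarrow> real set"
  assumes ne: "\<And>a. S a \<noteq> {}" and nonneg: "\<And>a x. x \<in> S a \<Longrightarrow> 0 \<le> x"
    and add: "\<And>a b x y. x \<in> S a \<Longrightarrow> y \<in> S b \<Longrightarrow> \<exists>z\<in>S (a + b). z \<le> x + y"
    and mult: "\<And>a b x y. x \<in> S a \<Longrightarrow> y \<in> S b \<Longrightarrow> \<exists>z\<in>S (a * b). z \<le> x * y"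
    and scal: "\<And>a c x. c \<noteq> 0 \<Longrightarrow> x \<in> S a \<Longrightarrow> \<exists>z\<in>S (\<iota> c * a). z \<le> cmod c * x"
    and one: "0 < \<delta>" "\<And>x. x \<in> S 1 \<Longrightarrow> \<delta> \<le> x"
  shows "alg_seminorm (\<lambda>a. Inf (S a))"
proof -
  have bdd: "bdd_below (S a)" for a using nonneg by (meson bdd_belowI)
  have lower: "Inf (S a) \<le> x" if "\<exists>z\<in>S a. z \<le> x" for a x
    using that bdd by (meson cInf_lower order_trans)
  have pos: "0 \<le> Inf (S a)" for a using ne nonneg by (meson cInf_greatest)
  have scale: "x \<le> k * Inf (S a)" if "0 \<le> k" "\<And>y. y \<in> S a \<Longrightarrow> x \<le> k * y" for x k a
  proof (cases "k = 0")
    case True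
    then show ?thesis using that(2) ne[of a] by auto
  next
    case False
    then have "x / k \<le> Inf (S a)"
      using that by (intro cInf_greatest ne) (auto simp: field_simps)
    then show ?thesis using False that(1) by (simp add: field_simps)
  qed
  have 1: "Inf (S (a + b)) \<le> Inf (S a) + Inf (S b)" for a b
  proof -
    have "Inf (S (a + b)) - Inf (S a) \<le> y" if "y \<in> S b" for y
    proof -
      have "Inf (S (a + b)) - y \<le> Inf (S a)"
        using lower[OF add[OF _ that]] by (intro cInf_greatest ne) (auto simp: algebra_simps)
      then show ?thesis by simp
    qed
    then have "Inf (S (a + b)) - Inf (S a) \<le> Inf (S b)" by (intro cInf_greatest ne)
    then show ?thesis by simp
  qed
  have 2: "Inf (S (a * b)) \<le> Inf (S a) * Inf (S b)" for a b
  proof (intro scale pos)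
    fix y assume y: "y \<in> S b"
    have "Inf (S (a * b)) \<le> y * Inf (S a)"
      using lower[OF mult[OF _ y]] nonneg[OF y] by (intro scale) (auto simp: mult.commute)
    then show "Inf (S (a * b)) \<le> Inf (S a) * y" by (simp add: mult.commute)
  qed
  have 3: "Inf (S (\<iota> c * a)) \<le> cmod c * Inf (S a)" for c a
  proof (cases "c = 0")
    case True
    \<comment> \<open>Scaling by 0 is not assumed of \<open>S\<close>; but
      \<open>\<iota> (1 / 2) * 0\<close> is 0, so \<open>Inf (S 0)\<close> is at most half of
      itself.\<close>
    have "Inf (S (\<iota> (1 / 2) * 0)) \<le> cmod (1 / 2) * Inf (S 0)"
      using lower[OF scal, of "1 / 2" _ 0] by (intro scale) auto
    then show ?thesis using pos[of 0] True by (simp add: scalar_zero)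
  next
    case False
    then show ?thesis using lower[OF scal] by (intro scale) auto
  qed
  \<comment> \<open>A positive lower bound improves to 1 because the infimum at 1 is at most its own
    square.\<close>
  have "\<delta> \<le> Inf (S 1)" using one by (intro cInf_greatest ne)
  then have 4: "1 \<le> Inf (S 1)"
    using 2[of 1 1] one(1) by (auto simp: mult_le_cancel_right1)
  show ?thesis unfolding alg_seminorm_def using pos 1 2 3 4 by auto
qed

text \<open>This is the spectral radius of \<open>q\<close>, written as the infimum of all growth
  rates \<open>\<alpha>\<close> of the powers of \<open>a\<close>, so that no limit of roots has to
  be taken. Commutativity gives subadditivity through the binomial theorem.\<close>

lemma spectral_seminorm:
  assumes q: "alg_seminorm q"
  obtains r where "alg_seminorm r" "\<And>a. r a \<le> q a" "\<And>a n. r a ^ n \<le> r (a ^ n)"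
proof
  let ?S = "\<lambda>a. {\<alpha>. 0 < \<alpha> \<and> (\<exists>K>0. \<forall>n. q (a ^ n) \<le> K * \<alpha> ^ n)}"
  let ?r = "\<lambda>a. Inf (?S a)"
  have q0: "0 \<le> q a" for a using alg_seminormD(1)[OF q] .
  have big: "\<alpha> \<in> ?S a" if "q a < \<alpha>" for a \<alpha>
  proof -
    have "q (a ^ n) \<le> (q 1) * \<alpha> ^ n" for n
    proof (cases "n = 0")
      case False
      then have "q (a ^ n) \<le> q a ^ n" using alg_seminorm_power[OF q] by simp
      also have "\<dots> \<le> \<alpha> ^ n" using that q0 by (intro power_mono) auto
      also have "\<dots> \<le> q 1 * \<alpha> ^ n"
        using alg_seminormD(5)[OF q] that q0[of a] by (simp add: mult_le_cancel_right1)
      finally show ?thesis .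
    qed simp
    then show ?thesis using that q0[of a] alg_seminormD(5)[OF q] by (auto intro!: exI[of _ "q 1"])
  qed
  have ne: "?S a \<noteq> {}" for a using big[of a "q a + 1"] by auto
  have bdd: "bdd_below (?S a)" for a by (rule bdd_belowI[of _ 0]) auto
  show "alg_seminorm ?r"
  proof (rule alg_seminorm_Inf)
    show "?S a \<noteq> {}" for a by (rule ne)
    show "0 \<le> x" if "x \<in> ?S a" for a x using that by auto
    show "\<exists>z\<in>?S (a + b). z \<le> x + y" if x: "x \<in> ?S a" and y: "y \<in> ?S b" for a b x y
    proof -
      obtain K L where K: "K > 0" "\<And>n. q (a ^ n) \<le> K * x ^ n"
        and L: "L > 0" "\<And>n. q (b ^ n) \<le> L * y ^ n" using x y by auto
      have sum: "q (sum f I) \<le> (\<Sum>i\<in>I. q (f i))" if "finite I" for f and I :: "nat set"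
        using that
      proof (induction I rule: finite_induct)
        case (insert i I)
        then show ?case using alg_seminormD(2)[OF q, of "f i" "sum f I"] by simp
      qed (simp add: alg_seminorm_zero[OF q])
      have "q ((a + b) ^ n) \<le> K * L * (x + y) ^ n" for n
      proof -
        have "q ((a + b) ^ n) = q (\<Sum>k\<le>n. of_nat (n choose k) * a ^ k * b ^ (n - k))"
          by (simp add: binomial_ring)
        also have "\<dots> \<le> (\<Sum>k\<le>n. q (of_nat (n choose k) * a ^ k * b ^ (n - k)))"
          by (rule sum) simp
        also have "\<dots> \<le> (\<Sum>k\<le>n. of_nat (n choose k) * ((K * x ^ k) * (L * y ^ (n - k))))"
        proof (rule sum_mono)
          fix k
          have "of_nat m = \<iota> (of_nat m)" for m
            by (induction m) (simp_all add: scalar_zero scalar_add scalar_one)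
          then have "q (of_nat (n choose k) * a ^ k * b ^ (n - k))
            = q (\<iota> (of_nat (n choose k)) * (a ^ k * b ^ (n - k)))" by (simp add: mult.assoc)
          also have "\<dots> \<le> of_nat (n choose k) * q (a ^ k * b ^ (n - k))"
            using alg_seminormD(4)[OF q, of "of_nat (n choose k)"] by simp
          also have "\<dots> \<le> of_nat (n choose k) * (q (a ^ k) * q (b ^ (n - k)))"
            by (intro mult_left_mono alg_seminormD(3)[OF q]) simp
          also have "\<dots> \<le> of_nat (n choose k) * ((K * x ^ k) * (L * y ^ (n - k)))"
            using K L x by (intro mult_left_mono mult_mono q0) auto
          finally show "q (of_nat (n choose k) * a ^ k * b ^ (n - k))
            \<le> of_nat (n choose k) * ((K * x ^ k) * (L * y ^ (n - k)))" .
        qed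
        also have "\<dots> = K * L * (x + y) ^ n"
          by (simp add: binomial_ring sum_distrib_left mult_ac)
        finally show ?thesis .
      qed
      then have "x + y \<in> ?S (a + b)" using x y K L by (auto intro!: exI[of _ "K * L"])
      then show ?thesis by blast
    qed
    show "\<exists>z\<in>?S (a * b). z \<le> x * y" if x: "x \<in> ?S a" and y: "y \<in> ?S b" for a b x y
    proof -
      obtain K L where K: "K > 0" "\<And>n. q (a ^ n) \<le> K * x ^ n"
        and L: "L > 0" "\<And>n. q (b ^ n) \<le> L * y ^ n" using x y by auto
      have "q ((a * b) ^ n) \<le> K * L * (x * y) ^ n" for n
      proof -
        have "q ((a * b) ^ n) \<le> q (a ^ n) * q (b ^ n)"
          using alg_seminormD(3)[OF q] by (simp add: power_mult_distrib)
        also have "\<dots> \<le> (K * x ^ n) * (L * y ^ n)" using K L x by (intro mult_mono q0) auto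
        finally show ?thesis by (simp add: power_mult_distrib mult_ac)
      qed
      then have "x * y \<in> ?S (a * b)" using x y K L by (auto intro!: exI[of _ "K * L"])
      then show ?thesis by blast
    qed
    show "\<exists>z\<in>?S (\<iota> c * a). z \<le> cmod c * x" if c: "c \<noteq> 0" and x: "x \<in> ?S a" for a c x
    proof -
      obtain K where K: "K > 0" "\<And>n. q (a ^ n) \<le> K * x ^ n" using x by auto
      have "q ((\<iota> c * a) ^ n) \<le> K * (cmod c * x) ^ n" for n
      proof -
        have "q ((\<iota> c * a) ^ n) \<le> cmod c ^ n * q (a ^ n)"
          using alg_seminormD(4)[OF q, of "c ^ n" "a ^ n"]
          by (simp add: power_mult_distrib scalar_power norm_power)
        also have "\<dots> \<le> cmod c ^ n * (K * x ^ n)" using K by (intro mult_left_mono) auto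
        finally show ?thesis by (simp add: power_mult_distrib mult_ac)
      qed
      then have "cmod c * x \<in> ?S (\<iota> c * a)" using x K c by (auto intro!: exI[of _ K])
      then show ?thesis by blast
    qed
    show "1 \<le> x" if x: "x \<in> ?S 1" for x
    proof (rule ccontr)
      assume "\<not> 1 \<le> x"
      obtain K where K: "K > 0" "\<And>n. q (1 ^ n) \<le> K * x ^ n" using x by auto
      obtain n where "x ^ n < 1 / K"
        using real_arch_pow_inv[of "1 / K" x] \<open>\<not> 1 \<le> x\<close> K by auto
      then have "K * x ^ n < 1" using K by (simp add: field_simps)
      then show False using K(2)[of n] alg_seminormD(5)[OF q] by simp
    qed
  qed simp
  show "?r a \<le> q a" for a
  proof (rule field_le_epsilon)
    fix e :: real assume "0 < e"
    then show "?r a \<le> q a + e" by (intro cInf_lower bdd big) simp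
  qed
  show "?r a ^ n \<le> ?r (a ^ n)" for a n
  proof (cases "n = 0")
    case True
    have "1 \<le> ?r 1" using alg_seminormD(5)[OF \<open>alg_seminorm ?r\<close>] .
    then show ?thesis using True by simp
  next
    case False
    have "?r a ^ n \<le> \<alpha>" if \<alpha>: "\<alpha> \<in> ?S (a ^ n)" for \<alpha>
    proof -
      obtain K where K: "K > 0" "\<And>k. q ((a ^ n) ^ k) \<le> K * \<alpha> ^ k" using \<alpha> by auto
      \<comment> \<open>A growth rate of \<open>a ^ n\<close> yields its \<open>n\<close>-th root as
        a growth rate of \<open>a\<close>: divide the exponent by \<open>n\<close>; the constant
        \<open>L\<close> absorbs the finitely many remainders.\<close>
      define \<beta> where "\<beta> = root n \<alpha>"
      have \<beta>: "\<beta> > 0" "\<beta> ^ n = \<alpha>" using False \<alpha> by (auto simp: \<beta>_def)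
      define L where "L = (MAX i\<in>{..<n}. q (a ^ i) / \<beta> ^ i)"
      have L: "q (a ^ i) \<le> L * \<beta> ^ i" if "i < n" for i
      proof -
        have "q (a ^ i) / \<beta> ^ i \<le> L" unfolding L_def using that by (intro Max_ge) auto
        then show ?thesis using \<beta> by (simp add: field_simps)
      qed
      have Lpos: "L > 0" using L[of 0] False alg_seminormD(5)[OF q] by simp
      have "q (a ^ m) \<le> (K * L) * \<beta> ^ m" for m
      proof -
        have "a ^ m = (a ^ n) ^ (m div n) * a ^ (m mod n)"
          by (metis power_mult power_add mult_div_mod_eq)
        then have "q (a ^ m) \<le> q ((a ^ n) ^ (m div n)) * q (a ^ (m mod n))"
          using alg_seminormD(3)[OF q] by simp
        also have "\<dots> \<le> (K * \<alpha> ^ (m div n)) * (L * \<beta> ^ (m mod n))"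
          using K L False \<alpha> by (intro mult_mono q0) auto
        also have "\<dots> = (K * L) * (\<beta> ^ n) ^ (m div n) * \<beta> ^ (m mod n)" using \<beta> by simp
        also have "\<dots> = (K * L) * \<beta> ^ m"
          by (metis power_mult power_add mult_div_mod_eq mult.assoc)
        finally show ?thesis .
      qed
      then have "\<beta> \<in> ?S a" using \<beta> K Lpos by (auto intro!: exI[of _ "K * L"])
      then have "?r a \<le> \<beta>" by (intro cInf_lower bdd)
      then have "?r a ^ n \<le> \<beta> ^ n"
        using alg_seminormD(1)[OF \<open>alg_seminorm ?r\<close>] by (intro power_mono) auto
      then show ?thesis using \<beta> by simp
    qed
    then show ?thesis by (intro cInf_greatest ne)
  qed
qed

text \<open>Zorn's lemma with the pointwise order reversed. The infimum of a chain is a seminorm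
  because a chain is directed downwards, and \<open>1 \<le> q 1\<close> survives the infimum, so the
  minimal seminorm is not zero.\<close>

lemma minimal_seminorm:
  assumes q: "alg_seminorm q"
  obtains r where "alg_seminorm r" "\<And>a. r a \<le> q a"
    "\<And>r'. alg_seminorm r' \<Longrightarrow> (\<And>a. r' a \<le> r a) \<Longrightarrow> r' = r"
proof -
  let ?A = "{r. alg_seminorm r \<and> r \<le> q}" and ?P = "\<lambda>x y :: 'a \<Rightarrow> real. y \<le> x"
  have "\<exists>m\<in>?A. \<forall>a\<in>?A. ?P m a \<longrightarrow> a = m"
  proof (rule predicate_Zorn)
    show "partial_order_on ?A (relation_of ?P ?A)"
      by (rule partial_order_on_relation_ofI) auto
    fix C assume "C \<in> Chains (relation_of ?P ?A)"
    then have CA: "C \<subseteq> ?A" and C: "\<And>x y. x \<in> C \<Longrightarrow> y \<in> C \<Longrightarrow> x \<le> y \<or> y \<le> x"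
      by (auto simp: Chains_def relation_of_def)
    show "\<exists>u\<in>?A. \<forall>a\<in>C. u \<le> a"
    proof (cases "C = {}")
      case True then show ?thesis using q by auto
    next
      case False
      let ?S = "\<lambda>a. (\<lambda>r. r a) ` C"
      have D: "alg_seminorm r" if "r \<in> C" for r using that CA by auto
      have dir: "\<exists>s\<in>C. s \<le> r \<and> s \<le> r'" if "r \<in> C" "r' \<in> C" for r r' using C that by blast
      have S: "alg_seminorm (\<lambda>a. Inf (?S a))"
      proof (rule alg_seminorm_Inf[where \<delta> = 1])
        show "\<exists>z\<in>?S (a + b). z \<le> x + y" if xy: "x \<in> ?S a" "y \<in> ?S b" for a b x y
        proof -
          obtain r r' where r: "r \<in> C" "x = r a" "r' \<in> C" "y = r' b" using xy by auto
          obtain s where s: "s \<in> C" "s a \<le> r a" "s b \<le> r' b"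
            using dir[OF r(1,3)] by (auto simp: le_fun_def)
          have "s (a + b) \<le> s a + s b" using alg_seminormD(2)[OF D] s(1) .
          also have "\<dots> \<le> x + y" using s r by auto
          finally show ?thesis using s(1) by blast
        qed
        show "\<exists>z\<in>?S (a * b). z \<le> x * y" if xy: "x \<in> ?S a" "y \<in> ?S b" for a b x y
        proof -
          obtain r r' where r: "r \<in> C" "x = r a" "r' \<in> C" "y = r' b" using xy by auto
          obtain s where s: "s \<in> C" "s a \<le> r a" "s b \<le> r' b"
            using dir[OF r(1,3)] by (auto simp: le_fun_def)
          have "s (a * b) \<le> s a * s b" using alg_seminormD(3)[OF D] s(1) .
          also have "\<dots> \<le> x * y"
            using s r alg_seminormD(1)[OF D[OF s(1)]] alg_seminormD(1)[OF D[OF r(1)]]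
            by (auto intro!: mult_mono)
          finally show ?thesis using s(1) by blast
        qed
        show "\<exists>z\<in>?S (\<iota> c * a). z \<le> cmod c * x" if x: "x \<in> ?S a" for a c x
          using x alg_seminormD(4)[OF D] by blast
      qed (use False D alg_seminormD(1,5) in auto)
      have le: "(\<lambda>a. Inf (?S a)) \<le> r" if "r \<in> C" for r
      proof (rule le_funI)
        fix a
        have "bdd_below (?S a)" by (rule bdd_belowI[of _ 0]) (use alg_seminormD(1)[OF D] in blast)
        then show "Inf (?S a) \<le> r a" using that by (intro cInf_lower) auto
      qed
      obtain r where "r \<in> C" using False by auto
      moreover from this have "r \<le> q" using CA by auto
      ultimately have "(\<lambda>a. Inf (?S a)) \<le> q" using order_trans[OF le] by simp
      then have "(\<lambda>a. Inf (?S a)) \<in> ?A" using S by simp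
      then show ?thesis using le by (rule_tac bexI) simp_all
    qed
  qed
  then show ?thesis using that by (auto simp: le_fun_def) (metis (mono_tags, lifting) order_trans)
qed

text \<open>A minimal seminorm equals its own spectral radius, so
  \<open>r a ^ n \<le> r (a ^ n)\<close>. For \<open>r a > 0\<close> the quotients
  \<open>r (a ^ n * x) / r a ^ n\<close> decrease in \<open>n\<close>; their infimum is a seminorm
  below \<open>r\<close>, hence equal to \<open>r\<close>, and the term \<open>n = 1\<close> gives
  \<open>r a * r b \<le> r (a * b)\<close>.\<close>

lemma multiplicative_seminorm:
  assumes q: "alg_seminorm q"
  obtains r where "alg_seminorm r" "\<And>a. r a \<le> q a" "\<And>a b. r (a * b) = r a * r b" "r 1 = 1"
proof -
  obtain r where r: "alg_seminorm r" "\<And>a. r a \<le> q a"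
    and min: "\<And>r'. alg_seminorm r' \<Longrightarrow> (\<And>a. r' a \<le> r a) \<Longrightarrow> r' = r"
    using minimal_seminorm[OF q] by blast
  obtain r' where r': "alg_seminorm r'" "\<And>a. r' a \<le> r a" "\<And>a n. r' a ^ n \<le> r' (a ^ n)"
    using spectral_seminorm[OF r(1)] by blast
  have pow: "r a ^ n \<le> r (a ^ n)" for a n using min[OF r'(1,2)] r'(3) by simp
  have r0: "0 \<le> r a" for a using alg_seminormD(1)[OF r(1)] .
  have mult: "r (a * b) = r a * r b" for a b
  proof (cases "r a = 0")
    case True
    then show ?thesis using alg_seminormD(1,3)[OF r(1)] by (metis mult_zero_left order_antisym)
  next
    case False
    then have a: "r a > 0" using r0[of a] by simp
    define f where "f n x = r (a ^ n * x) / r a ^ n" for n x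
    have f0: "0 \<le> f n x" for n x using r0 a by (simp add: f_def)
    have fSuc: "f (Suc n) x \<le> f n x" for n x
    proof -
      have "r (a ^ Suc n * x) \<le> r a * r (a ^ n * x)"
        using alg_seminormD(3)[OF r(1), of a "a ^ n * x"] by (simp add: mult.assoc)
      then show ?thesis using a by (simp add: f_def field_simps)
    qed
    have fmono: "f n x \<le> f m x" if "m \<le> n" for m n x
      using lift_Suc_antimono_le[of "\<lambda>n. f n x"] fSuc that by blast
    let ?S = "\<lambda>x. range (\<lambda>n. f n x)"
    have S: "alg_seminorm (\<lambda>x. Inf (?S x))"
    proof (rule alg_seminorm_Inf[where \<delta> = 1])
      show "\<exists>z\<in>?S (b + c). z \<le> x + y" if xy: "x \<in> ?S b" "y \<in> ?S c" for b c x y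
      proof -
        obtain n m where nm: "x = f n b" "y = f m c" using xy by auto
        have "f (max n m) (b + c) \<le> f (max n m) b + f (max n m) c"
          using a alg_seminormD(2)[OF r(1), of "a ^ max n m * b" "a ^ max n m * c"]
          by (simp add: f_def field_simps)
        also have "\<dots> \<le> x + y" unfolding nm by (intro add_mono fmono) auto
        finally show ?thesis by blast
      qed
      show "\<exists>z\<in>?S (b * c). z \<le> x * y" if xy: "x \<in> ?S b" "y \<in> ?S c" for b c x y
      proof -
        obtain n m where nm: "x = f n b" "y = f m c" using xy by auto
        have "f (n + m) (b * c) \<le> f n b * f m c"
          using a alg_seminormD(3)[OF r(1), of "a ^ n * b" "a ^ m * c"]
          by (simp add: f_def field_simps power_add)
        then show ?thesis unfolding nm by blast
      qed
      show "\<exists>z\<in>?S (\<iota> c * b). z \<le> cmod c * x" if xy: "x \<in> ?S b" for b c x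
      proof -
        obtain n where n: "x = f n b" using xy by auto
        have "f n (\<iota> c * b) \<le> cmod c * f n b"
          using a alg_seminormD(4)[OF r(1), of c "a ^ n * b"]
          by (simp add: f_def field_simps)
        then show ?thesis unfolding n by blast
      qed
      \<comment> \<open>Here the power inequality enters: it keeps the value at 1 from dropping
        below 1.\<close>
      show "1 \<le> x" if "x \<in> ?S 1" for x using that pow a by (auto simp: f_def)
    qed (use f0 in auto)
    have bdd: "bdd_below (?S x)" for x using f0 by (intro bdd_belowI[of _ 0]) auto
    have le: "Inf (?S x) \<le> f n x" for n x using bdd by (intro cInf_lower) auto
    have "(\<lambda>x. Inf (?S x)) = r"
      using min[OF S] le[of _ 0] by (simp add: f_def)
    then have "r b \<le> f 1 b" using le[of b 1] by metis
    then have "r a * r b \<le> r (a * b)" using a by (simp add: f_def field_simps)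
    then show ?thesis using alg_seminormD(3)[OF r(1), of a b] by simp
  qed
  have "r 1 = 1" using mult[of 1 1] alg_seminormD(5)[OF r(1)] by auto
  then show ?thesis using that r mult by blast
qed

text \<open>A Gelfand-Mazur theorem without complex analysis. The distance \<open>f c\<close> from
  \<open>a\<close> to the scalar \<open>c\<close> is continuous and large far out, so it attains a
  minimum. If the minimum were positive, the set of minimizers would contain with each point an open
  disc of radius \<open>f m\<close>, hence points arbitrarily far out, where \<open>f\<close> is too
  large.\<close>

lemma multiplicative_seminorm_scalar:
  assumes r: "alg_seminorm r" "\<And>a b. r (a * b) = r a * r b" "r 1 = 1"
  shows "\<exists>c. r (a - \<iota> c) = 0"
proof -
  have scal: "r (\<iota> c) = cmod c" for c
  proof (cases "c = 0")
    case False
    have "r (\<iota> c) \<le> cmod c" for c using alg_seminormD(4)[OF r(1), of c 1] r(3) by simp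
    note this[of c] this[of "1 / c"]
    moreover have "r (\<iota> c) * r (\<iota> (1 / c)) = 1"
      using False r(2,3) by (metis scalar_mult scalar_one nonzero_mult_div_cancel_left times_divide_eq_right mult.right_neutral)
    moreover have "0 \<le> r (\<iota> c)" using alg_seminormD(1)[OF r(1)] .
    ultimately have "1 \<le> r (\<iota> c) * (1 / cmod c)"
      by (metis mult_left_mono norm_divide norm_one)
    then have "cmod c \<le> r (\<iota> c)" using False by (simp add: field_simps)
    with \<open>r (\<iota> c) \<le> cmod c\<close> show ?thesis by simp
  qed (simp add: scalar_zero alg_seminorm_zero[OF r(1)])
  define f where "f c = r (a - \<iota> c)" for c
  have tri: "f c \<le> f d + cmod (c - d)" for c d
  proof -
    have "a - \<iota> c = (a - \<iota> d) - \<iota> (c - d)" by (simp add: scalar_diff)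
    then show ?thesis using alg_seminorm_diff[OF r(1)] scal unfolding f_def by metis
  qed
  have cont: "continuous_on UNIV f"
  proof (rule continuous_onI)
    fix x :: complex and e :: real assume "e > 0"
    have "dist (f y) (f x) \<le> dist y x" for y
      using tri[of x y] tri[of y x] by (simp add: dist_real_def dist_norm norm_minus_commute abs_le_iff)
    then show "\<exists>d>0. \<forall>x'\<in>UNIV. dist x' x < d \<longrightarrow> dist (f x') (f x) \<le> e"
      using \<open>e > 0\<close> by (meson less_imp_le order_trans)
  qed
  have far: "cmod c - r a \<le> f c" for c
    using alg_seminorm_diff[OF r(1), of "a" "a - \<iota> c"] scal[of c] by (simp add: f_def)
  have f0: "0 \<le> f c" for c using alg_seminormD(1)[OF r(1)] by (simp add: f_def)
  \<comment> \<open>Outside the ball of radius \<open>2 * r a\<close> the bound \<open>far\<close>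
    exceeds \<open>r a = f 0\<close>, so the minimum over the ball is global.\<close>
  obtain m where m: "m \<in> cball 0 (2 * r a)" "\<And>c. c \<in> cball 0 (2 * r a) \<Longrightarrow> f m \<le> f c"
  proof -
    have "\<exists>x\<in>cball 0 (2 * r a). \<forall>y\<in>cball 0 (2 * r a). f x \<le> f y"
      using alg_seminormD(1)[OF r(1), of a]
      by (intro continuous_attains_inf compact_cball continuous_on_subset[OF cont]) auto
    then show ?thesis using that by blast
  qed
  have min: "f m \<le> f c" for c
  proof (cases "c \<in> cball 0 (2 * r a)")
    case False
    have "f m \<le> f 0" using m(2)[of 0] alg_seminormD(1)[OF r(1), of a] by simp
    also have "\<dots> = r a" by (simp add: f_def scalar_zero)
    also have "\<dots> \<le> f c" using far[of c] False by simp
    finally show ?thesis .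
  qed (rule m)
  have "f m = 0"
  proof (rule ccontr)
    assume "f m \<noteq> 0"
    then have pos: "f m > 0" using f0[of m] by simp
    txt \<open>For \<open>n\<close> a power of two, \<open>b\<^sup>n - \<mu>\<close> splits into linear factors by means of square roots alone.\<close>
    have low: "f m ^ (2 ^ k) \<le> r ((a - \<iota> c) ^ (2 ^ k) - \<iota> \<mu>)" for k c \<mu>
    proof (induction k arbitrary: \<mu>)
      case 0
      then show ?case using min[of "c + \<mu>"] by (simp add: f_def scalar_add algebra_simps)
    next
      case (Suc k)
      let ?b = "(a - \<iota> c) ^ (2 ^ k)"
      have "(a - \<iota> c) ^ (2 ^ Suc k) - \<iota> \<mu> = (?b - \<iota> (csqrt \<mu>)) * (?b - \<iota> (- csqrt \<mu>))"
        using scalar_mult[of "csqrt \<mu>" "csqrt \<mu>", symmetric]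
        by (simp add: scalar_minus power_2_Suc algebra_simps power2_eq_square[symmetric] del: power_Suc)
      then have "r ((a - \<iota> c) ^ (2 ^ Suc k) - \<iota> \<mu>) = r (?b - \<iota> (csqrt \<mu>)) * r (?b - \<iota> (- csqrt \<mu>))"
        by (simp add: r(2))
      moreover have "\<dots> \<ge> f m ^ (2 ^ k) * f m ^ (2 ^ k)"
        using pos alg_seminormD(1)[OF r(1)] by (intro mult_mono Suc.IH) auto
      ultimately show ?case by (simp only: power_2_Suc)
    qed
    \<comment> \<open>Here one linear factor, that of the root \<open>d\<close>, is kept, and the
      remaining \<open>2 ^ k - 1\<close> factors are bounded below by the minimum.\<close>
    have up: "f (c + d) * f m ^ (2 ^ k - 1) \<le> r ((a - \<iota> c) ^ (2 ^ k) - \<iota> (d ^ (2 ^ k)))" for k c d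
    proof (induction k)
      case 0
      then show ?case by (simp add: f_def scalar_add algebra_simps)
    next
      case (Suc k)
      let ?b = "(a - \<iota> c) ^ (2 ^ k)"
      have "(a - \<iota> c) ^ (2 ^ Suc k) - \<iota> (d ^ (2 ^ Suc k)) = (?b - \<iota> (d ^ 2 ^ k)) * (?b - \<iota> (- (d ^ 2 ^ k)))"
        unfolding power_2_Suc scalar_mult scalar_minus by (simp add: algebra_simps)
      then have "r ((a - \<iota> c) ^ (2 ^ Suc k) - \<iota> (d ^ (2 ^ Suc k))) = r (?b - \<iota> (d ^ 2 ^ k)) * r (?b - \<iota> (- (d ^ 2 ^ k)))"
        by (simp add: r(2))
      moreover have "\<dots> \<ge> (f (c + d) * f m ^ (2 ^ k - 1)) * f m ^ (2 ^ k)"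
        using pos alg_seminormD(1)[OF r(1)] by (intro mult_mono Suc.IH low) auto
      moreover have "(2::nat) ^ Suc k - 1 = (2 ^ k - 1) + 2 ^ k" by simp
      ultimately show ?case by (simp only: power_add mult.assoc)
    qed
    \<comment> \<open>The lower bound \<open>up\<close> is compared with the triangle inequality for
      the same difference of powers; dividing by \<open>f m ^ (2 ^ k)\<close> leaves an error
      governed by \<open>(cmod d / f m) ^ (2 ^ k)\<close>, which tends to 0.\<close>
    have step: "f (c + d) = f m" if c: "f c = f m" and d: "cmod d < f m" for c d
    proof -
      have "f (c + d) \<le> f m * (1 + (cmod d / f m) ^ (2 ^ k))" for k
      proof -
        have "r ((a - \<iota> c) ^ (2 ^ k) - \<iota> (d ^ (2 ^ k))) \<le> r ((a - \<iota> c) ^ (2 ^ k)) + r (\<iota> (d ^ (2 ^ k)))"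
          by (rule alg_seminorm_diff[OF r(1)])
        also have "\<dots> \<le> f m ^ (2 ^ k) + cmod d ^ (2 ^ k)"
          using alg_seminorm_power[OF r(1), of "2 ^ k" "a - \<iota> c"] c scal by (simp add: f_def norm_power)
        finally have "f (c + d) * f m ^ (2 ^ k - 1) \<le> f m ^ (2 ^ k) + cmod d ^ (2 ^ k)"
          using up[of c d k] by linarith
        then have "f (c + d) * f m ^ (2 ^ k - 1) * f m \<le> (f m ^ (2 ^ k) + cmod d ^ (2 ^ k)) * f m"
          using pos by (intro mult_right_mono) auto
        moreover have "f m ^ (2 ^ k - 1) * f m = f m ^ (2 ^ k)"
          by (metis power_minus_mult zero_less_numeral zero_less_power)
        ultimately have "f (c + d) * f m ^ (2 ^ k) \<le> (f m ^ (2 ^ k) + cmod d ^ (2 ^ k)) * f m"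
          by (simp only: mult.assoc)
        then have "f (c + d) \<le> (f m ^ (2 ^ k) + cmod d ^ (2 ^ k)) * f m / f m ^ (2 ^ k)"
          using pos by (simp only: pos_le_divide_eq zero_less_power)
        also have "\<dots> = f m * (1 + (cmod d / f m) ^ (2 ^ k))"
          using pos by (simp add: power_divide add_divide_distrib distrib_left distrib_right)
        finally show ?thesis .
      qed
      moreover have "(\<lambda>k. f m * (1 + (cmod d / f m) ^ (2 ^ k))) \<longlonglongrightarrow> f m * (1 + 0)"
      proof (intro tendsto_intros)
        have "(\<lambda>n. (cmod d / f m) ^ n) \<longlonglongrightarrow> 0" using d pos by (intro LIMSEQ_realpow_zero) auto
        moreover have "strict_mono (\<lambda>k. 2 ^ k :: nat)" by (simp add: strict_mono_def)
        ultimately show "(\<lambda>k. (cmod d / f m) ^ (2 ^ k)) \<longlonglongrightarrow> 0"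
          using LIMSEQ_subseq_LIMSEQ[of _ 0 "\<lambda>k. 2 ^ k"] by (simp add: o_def)
      qed
      ultimately have "f (c + d) \<le> f m * (1 + 0)"
        by (intro LIMSEQ_le_const) auto
      then show ?thesis using min[of "c + d"] by simp
    qed
    \<comment> \<open>Steps of half the radius lead along a ray from \<open>m\<close> to
      infinity.\<close>
    have all: "f (m + of_nat k * of_real (f m / 2)) = f m" for k
    proof (induction k)
      case (Suc k)
      show ?case using step[OF Suc, of "of_real (f m / 2)"] pos
        by (simp add: algebra_simps add_divide_distrib)
    qed simp
    obtain k where k: "real k * (f m / 2) > f m + r a + cmod m"
      using pos ex_less_of_nat_mult[of "f m / 2" "f m + r a + cmod m"] by auto
    have "cmod (of_nat k * of_real (f m / 2)) = real k * (f m / 2)"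
      using pos by (simp add: norm_mult)
    moreover have "cmod (of_nat k * of_real (f m / 2)) \<le> cmod (m + of_nat k * of_real (f m / 2)) + cmod m"
      using norm_diff_ineq[of "of_nat k * of_real (f m / 2)" m] by (simp add: add.commute)
    ultimately show False using far[of "m + of_nat k * of_real (f m / 2)"] all[of k] k by simp
  qed
  then show ?thesis by (auto simp: f_def)
qed

text \<open>The kernel of a multiplicative seminorm below \<open>q\<close> has residue field the
  complex numbers: each \<open>a\<close> differs from exactly one scalar by an element of the
  kernel. That scalar is the value of the character, and uniqueness makes it a homomorphism.\<close>

theorem exists_bounded_character:
  assumes q: "alg_seminorm q"
  obtains \<phi> :: "'a \<Rightarrow> complex"
  where "\<And>a b. \<phi> (a + b) = \<phi> a + \<phi> b" "\<And>a b. \<phi> (a * b) = \<phi> a * \<phi> b" "\<And>c. \<phi> (\<iota> c) = c"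
    "\<And>a. cmod (\<phi> a) \<le> q a"
proof -
  obtain r where r: "alg_seminorm r" "\<And>a b. r (a * b) = r a * r b" "r 1 = 1" and le: "\<And>a. r a \<le> q a"
    using multiplicative_seminorm[OF q] by metis
  have scal: "r (\<iota> c) = 0 \<Longrightarrow> c = 0" for c
  proof (rule ccontr)
    assume "r (\<iota> c) = 0" "c \<noteq> 0"
    then have "r (\<iota> c * \<iota> (1 / c)) = 0" by (simp add: r(2))
    then show False using \<open>c \<noteq> 0\<close> r(3) by (simp add: scalar_mult[symmetric] scalar_one)
  qed
  define \<phi> where "\<phi> a = (SOME c. r (a - \<iota> c) = 0)" for a
  have \<phi>: "r (a - \<iota> (\<phi> a)) = 0" for a
    unfolding \<phi>_def using multiplicative_seminorm_scalar[OF r] by (rule someI_ex)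
  have sub0: "r (a + b) = 0" if "r a = 0" "r b = 0" for a b
    using alg_seminormD(2)[OF r(1), of a b] alg_seminormD(1)[OF r(1), of "a + b"] that by simp
  have uniq: "\<phi> a = c" if "r (a - \<iota> c) = 0" for a c
  proof -
    have "r ((a - \<iota> c) + - (a - \<iota> (\<phi> a))) = 0"
      using that \<phi> alg_seminorm_minus[OF r(1), of "a - \<iota> (\<phi> a)"] by (intro sub0) simp_all
    then have "r (\<iota> (\<phi> a - c)) = 0" by (simp add: scalar_diff)
    then show ?thesis using scal by force
  qed
  show ?thesis
  proof
    show "\<phi> (a + b) = \<phi> a + \<phi> b" for a b
      using sub0[OF \<phi>[of a] \<phi>[of b]] by (intro uniq) (simp add: scalar_add algebra_simps)
    show "\<phi> (a * b) = \<phi> a * \<phi> b" for a b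
    proof (rule uniq)
      have "r ((a - \<iota> (\<phi> a)) * b + \<iota> (\<phi> a) * (b - \<iota> (\<phi> b))) = 0"
        by (rule sub0) (simp_all add: r(2) \<phi>)
      then show "r (a * b - \<iota> (\<phi> a * \<phi> b)) = 0" by (simp add: scalar_mult algebra_simps)
    qed
    show "\<phi> (\<iota> c) = c" for c by (rule uniq) (simp add: alg_seminorm_zero[OF r(1)])
    show "cmod (\<phi> a) \<le> q a" for a
    proof (cases "\<phi> a = 0")
      case True
      then show ?thesis using alg_seminormD(1)[OF q] by simp
    next
      case False
      have "1 = r (\<iota> (\<phi> a) * \<iota> (1 / \<phi> a))" using False by (simp add: scalar_mult[symmetric] scalar_one r(3))
      also have "\<dots> \<le> r (\<iota> (\<phi> a)) * (1 / cmod (\<phi> a))"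
        using alg_seminormD(4)[OF r(1), of "1 / \<phi> a" "1"] r(3) alg_seminormD(1)[OF r(1), of "\<iota> (\<phi> a)"]
        by (simp add: r(2) norm_divide mult_left_mono del: times_divide_eq_right)
      finally have "cmod (\<phi> a) \<le> r (\<iota> (\<phi> a))" using False by (simp add: field_simps)
      also have "\<dots> \<le> r a"
        using alg_seminorm_diff[OF r(1), of a "a - \<iota> (\<phi> a)"] \<phi>[of a] by simp
      also have "\<dots> \<le> q a" by (rule le)
      finally show ?thesis .
    qed
  qed
qed

end

section \<open>Laurent polynomials with complex coefficients\<close>

abbreviation keys :: "('a \<Rightarrow>\<^sub>0 'b::zero) \<Rightarrow> 'a set" where
  "keys \<equiv> Poly_Mapping.keys"

abbreviation lookup :: "('a \<Rightarrow>\<^sub>0 'b::zero) \<Rightarrow> 'a \<Rightarrow> 'b" where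
  "lookup \<equiv> Poly_Mapping.lookup"

abbreviation single :: "'a \<Rightarrow> 'b::zero \<Rightarrow> ('a \<Rightarrow>\<^sub>0 'b)" where
  "single \<equiv> Poly_Mapping.single"

section \<open>Uniform bounds over finite sets and induction on supports\<close>

lemma finite_positive_lower_bound:
  fixes d :: "'a \<Rightarrow> real"
  assumes "finite A" "\<And>a. a \<in> A \<Longrightarrow> 0 < d a"
  shows "\<exists>\<epsilon>>0. \<forall>a\<in>A. \<epsilon> < d a"
proof -
  have "0 < Min (insert 1 (d ` A))" using assms by auto
  moreover have "Min (insert 1 (d ` A)) \<le> d a" if "a \<in> A" for a
    using assms(1) that by (intro Min_le) auto
  ultimately show ?thesis by (intro exI[of _ "Min (insert 1 (d ` A)) / 2"]) force
qed

lemma finite_upper_bound: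
  fixes f :: "'a \<Rightarrow> real"
  assumes "finite A"
  obtains B where "B \<ge> 0" "\<And>a. a \<in> A \<Longrightarrow> f a \<le> B"
proof (rule that)
  show "0 \<le> (\<Sum>a\<in>A. \<bar>f a\<bar>)" by (simp add: sum_nonneg)
  show "f a \<le> (\<Sum>a\<in>A. \<bar>f a\<bar>)" if "a \<in> A" for a
    using member_le_sum[OF that _ assms, of "\<lambda>a. \<bar>f a\<bar>"] by simp
qed

lemma finite_upper_bound_keys:
  fixes f :: "'b \<Rightarrow> real" and g :: "'a \<Rightarrow> 'b \<Rightarrow>\<^sub>0 'c::zero"
  assumes "finite A"
  obtains B where "\<And>a k. a \<in> A \<Longrightarrow> k \<in> keys (g a) \<Longrightarrow> f k \<le> B"
proof -
  have "finite (\<Union>a\<in>A. keys (g a))" using assms by simp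
  then obtain B where "B \<ge> 0" "\<And>k. k \<in> (\<Union>a\<in>A. keys (g a)) \<Longrightarrow> f k \<le> B"
    by (rule finite_upper_bound[where f = f]) (rule that)
  then show ?thesis using that by blast
qed

lemma poly_mapping_sum_single:
  fixes f :: "'a \<Rightarrow>\<^sub>0 'b::comm_monoid_add"
  shows "(\<Sum>k\<in>keys f. single k (lookup f k)) = f"
proof (rule poly_mapping_eqI)
  fix n
  have "lookup (\<Sum>k\<in>keys f. single k (lookup f k)) n
    = (\<Sum>k\<in>keys f. if k = n then lookup f k else 0)"
    unfolding lookup_sum by (intro sum.cong) (auto simp: lookup_single when_def)
  also have "\<dots> = lookup f n"
    by (simp add: sum.delta in_keys_iff)
  finally show "lookup (\<Sum>k\<in>keys f. single k (lookup f k)) n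
    = lookup f n" .
qed

lemma poly_mapping_single_induct [case_names zero add]:
  fixes f :: "'a \<Rightarrow>\<^sub>0 'b::comm_monoid_add"
  assumes "P 0" and "\<And>k c f. P f \<Longrightarrow> P (single k c + f)"
  shows "P f"
proof -
  have "P (\<Sum>k\<in>A. single k (lookup f k))" if "finite A" for A
    using that by (induction A rule: finite_induct) (simp_all add: assms)
  from this[OF finite_keys[of f]] show ?thesis by (simp add: poly_mapping_sum_single)
qed

lemma keys_sum_subset:
  "keys (sum f A) \<subseteq> (\<Union>a\<in>A. keys (f a))"
proof (induction A rule: infinite_finite_induct)
  case (insert a A)
  then show ?case using keys_add[of "f a" "sum f A"] by auto
qed simp_all

lemma keys_single_times:
  "keys (single m c * f) \<subseteq> (+) m ` keys f"
  using keys_mult[of "single m c" f] by (auto split: if_splits)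

section \<open>Passage from integral to complex coefficients\<close>

type_synonym 'd complex_laurent = "(int ^ 'd) \<Rightarrow>\<^sub>0 complex"

definition to_complex :: "('d::finite) laurent \<Rightarrow> 'd complex_laurent" where
  "to_complex = Poly_Mapping.map of_int"

lemma lookup_to_complex [simp]:
  "lookup (to_complex f) n = of_int (lookup f n)"
  by (simp add: to_complex_def map.rep_eq when_def)

lemma keys_to_complex [simp]: "keys (to_complex f) = keys f"
  by (auto simp: in_keys_iff)

lemma to_complex_zero [simp]: "to_complex 0 = 0"
  by (rule poly_mapping_eqI) simp

lemma to_complex_add: "to_complex (f + g) = to_complex f + to_complex g"
  by (rule poly_mapping_eqI) (simp add: lookup_add)

lemma to_complex_diff: "to_complex (f - g) = to_complex f - to_complex g"
  by (rule poly_mapping_eqI) (simp add: lookup_minus)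

lemma to_complex_single [simp]:
  "to_complex (single n c) = single n (of_int c)"
  by (rule poly_mapping_eqI) (simp add: lookup_single when_def)

lemma to_complex_one [simp]: "to_complex 1 = 1"
  using to_complex_single[of 0 1] by simp

lemma to_complex_mult: "to_complex (f * g) = to_complex f * to_complex g"
proof (induction f rule: poly_mapping_single_induct)
  case (add k c f)
  have "to_complex (single k c * g) = single k (of_int c) * to_complex g"
    by (induction g rule: poly_mapping_single_induct)
      (simp_all add: to_complex_add distrib_left mult_single)
  then show ?case using add by (simp add: to_complex_add distrib_right)
qed simp

lemma u_pow_add: "u_pow (m + n) = u_pow m * u_pow n"
  by (simp add: u_pow_def mult_single)

lemma u_pow_zero [simp]: "u_pow 0 = 1"
  by (simp add: u_pow_def)

lemma u_pow_minus_cancel [simp]: "u_pow (- n) * u_pow n = 1" "u_pow n * u_pow (- n) = 1"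
  by (simp_all add: u_pow_add[symmetric])

lemma to_complex_u_pow [simp]: "to_complex (u_pow n) = single n 1"
  by (simp add: u_pow_def)

section \<open>The sum of the absolute values of the coefficients\<close>

definition l1_norm :: "('d::finite) complex_laurent \<Rightarrow> real" where
  "l1_norm f = (\<Sum>k\<in>keys f. cmod (lookup f k))"

lemma l1_norm_nonneg [simp]: "0 \<le> l1_norm f"
  by (simp add: l1_norm_def sum_nonneg)

lemma l1_norm_eq:
  assumes "finite A" "keys f \<subseteq> A"
  shows "l1_norm f = (\<Sum>k\<in>A. cmod (lookup f k))"
  unfolding l1_norm_def using assms by (intro sum.mono_neutral_left) (auto simp: in_keys_iff)

lemma l1_norm_zero [simp]: "l1_norm 0 = 0"
  by (simp add: l1_norm_def)

lemma l1_norm_single [simp]: "l1_norm (single k c) = cmod c"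
  using l1_norm_eq[of "{k}" "single k c"] by simp

lemma l1_norm_add: "l1_norm (f + g) \<le> l1_norm f + l1_norm g"
proof -
  let ?A = "keys f \<union> keys g"
  have "l1_norm (f + g) = (\<Sum>k\<in>?A. cmod (lookup (f + g) k))"
    by (rule l1_norm_eq) (use keys_add[of f g] in auto)
  also have "\<dots> \<le> (\<Sum>k\<in>?A. cmod (lookup f k) + cmod (lookup g k))"
    by (intro sum_mono) (simp add: lookup_add norm_triangle_ineq)
  also have "\<dots> = l1_norm f + l1_norm g"
    by (simp add: sum.distrib l1_norm_eq[of ?A f] l1_norm_eq[of ?A g])
  finally show ?thesis .
qed

lemma l1_norm_sum: "l1_norm (sum f A) \<le> (\<Sum>a\<in>A. l1_norm (f a))"
proof (induction A rule: infinite_finite_induct)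
  case (insert a A)
  then show ?case using l1_norm_add[of "f a" "sum f A"] by simp
qed simp_all

lemma l1_norm_mult: "l1_norm (f * g) \<le> l1_norm f * l1_norm g"
proof -
  let ?s = "\<lambda>f k. single k (lookup f k)"
  have single: "l1_norm (single k c * g) \<le> cmod c * l1_norm g" for k c
  proof -
    have "l1_norm (single k c * g)
      = l1_norm (\<Sum>j\<in>keys g. single k c * ?s g j)"
      by (simp add: sum_distrib_left[symmetric] poly_mapping_sum_single)
    also have "\<dots> \<le> (\<Sum>j\<in>keys g. l1_norm (single k c * ?s g j))"
      by (rule l1_norm_sum)
    also have "\<dots> = cmod c * l1_norm g"
      by (simp add: mult_single norm_mult sum_distrib_left l1_norm_def[of g])
    finally show ?thesis .
  qed
  have "l1_norm (f * g) = l1_norm (\<Sum>k\<in>keys f. ?s f k * g)"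
    by (simp add: sum_distrib_right[symmetric] poly_mapping_sum_single)
  also have "\<dots> \<le> (\<Sum>k\<in>keys f. l1_norm (?s f k * g))"
    by (rule l1_norm_sum)
  also have "\<dots> \<le> (\<Sum>k\<in>keys f. cmod (lookup f k) * l1_norm g)"
    by (intro sum_mono single)
  also have "\<dots> = l1_norm f * l1_norm g"
    by (simp add: l1_norm_def sum_distrib_right)
  finally show ?thesis .
qed

text \<open>The ideal generated by \<open>P\<close> in the complex Laurent polynomials, as a linear
  span; for an ideal \<open>P\<close> the span is already closed under multiplication. The form of
  the rule lets an induction treat one relation at a time.\<close>

inductive_set complex_span :: "('d::finite) laurent set \<Rightarrow> 'd complex_laurent set"
  for P where
  zero: "0 \<in> complex_span P"
| step: "f \<in> P \<Longrightarrow> g \<in> complex_span P \<Longrightarrow> single 0 c * to_complex f + g \<in> complex_span P"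

lemma complex_span_add:
  "f \<in> complex_span P \<Longrightarrow> g \<in> complex_span P \<Longrightarrow> f + g \<in> complex_span P"
  by (induction rule: complex_span.induct) (auto simp: add.assoc intro: complex_span.step)

lemma to_complex_in_complex_span: "f \<in> P \<Longrightarrow> to_complex f \<in> complex_span P"
  using complex_span.step[of f P 0 1] by (simp add: complex_span.zero)

lemma complex_span_single_mult:
  assumes "\<And>f n. f \<in> P \<Longrightarrow> u_pow n * f \<in> P" "g \<in> complex_span P"
  shows "single m d * g \<in> complex_span P"
  using assms(2)
proof (induction rule: complex_span.induct)
  case zero
  then show ?case by (simp add: complex_span.zero)
next
  case (step f g c)
  have "single m d * (single 0 c * to_complex f + g)
    = single 0 (d * c) * to_complex (u_pow m * f) + single m d * g"
    by (simp add: distrib_left to_complex_mult mult.assoc[symmetric] mult_single)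
  then show ?case using step assms(1) by (auto intro: complex_span.step)
qed

lemma complex_span_mult:
  assumes "\<And>f n. f \<in> P \<Longrightarrow> u_pow n * f \<in> P" "g \<in> complex_span P"
  shows "f * g \<in> complex_span P"
proof (induction f rule: poly_mapping_single_induct)
  case (add k c f)
  then show ?case
    using complex_span_single_mult[OF assms] by (simp add: distrib_right complex_span_add)
qed (simp add: complex_span.zero)

text \<open>The complex-linear functional with value \<open>y k\<close> at the monomial of exponent
  \<open>k\<close>. When \<open>y\<close> is an angle function of a character, its values on
  integral polynomials are the angles of that character modulo 1.\<close>

definition pairing :: "(int ^ 'd \<Rightarrow> real) \<Rightarrow> ('d::finite) complex_laurent \<Rightarrow> complex" where
  "pairing y f = (\<Sum>k\<in>keys f. lookup f k * of_real (y k))"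

lemma pairing_eq:
  assumes "finite A" "keys f \<subseteq> A"
  shows "pairing y f = (\<Sum>k\<in>A. lookup f k * of_real (y k))"
  unfolding pairing_def using assms by (intro sum.mono_neutral_left) (auto simp: in_keys_iff)

lemma pairing_zero [simp]: "pairing y 0 = 0"
  by (simp add: pairing_def)

lemma pairing_single [simp]: "pairing y (single k c) = c * of_real (y k)"
  using pairing_eq[of "{k}" "single k c" y] by simp

lemma pairing_add: "pairing y (f + g) = pairing y f + pairing y g"
proof -
  let ?A = "keys f \<union> keys g"
  have "pairing y (f + g) = (\<Sum>k\<in>?A. lookup (f + g) k * of_real (y k))"
    by (rule pairing_eq) (use keys_add[of f g] in auto)
  then show ?thesis
    by (simp add: lookup_add distrib_right sum.distrib pairing_eq[of ?A f] pairing_eq[of ?A g])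
qed

lemma pairing_uminus: "pairing y (- f) = - pairing y f"
  using pairing_add[of y f "- f"] by (simp add: eq_neg_iff_add_eq_0 add.commute)

lemma pairing_diff: "pairing y (f - g) = pairing y f - pairing y g"
  using pairing_add[of y f "- g"] by (simp add: pairing_uminus)

lemma pairing_scale: "pairing y (single 0 c * f) = c * pairing y f"
  by (induction f rule: poly_mapping_single_induct)
    (simp_all add: distrib_left pairing_add mult_single)

lemma norm_pairing_le:
  assumes "\<And>k. k \<in> keys f \<Longrightarrow> \<bar>y k\<bar> \<le> B"
  shows "cmod (pairing y f) \<le> l1_norm f * B"
proof -
  have "cmod (pairing y f) \<le> (\<Sum>k\<in>keys f. cmod (lookup f k) * B)"
    unfolding pairing_def using assms
    by (intro sum_norm_le) (auto simp: norm_mult intro!: mult_left_mono)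
  then show ?thesis by (simp add: l1_norm_def sum_distrib_right)
qed

lemma real_of_int_vec_add: "real_of_int_vec (m + n) = real_of_int_vec m + real_of_int_vec n"
  by (simp add: real_of_int_vec_def vec_eq_iff)

lemma real_of_int_vec_zero [simp]: "real_of_int_vec 0 = 0"
  by (simp add: real_of_int_vec_def vec_eq_iff)

lemma real_of_int_vec_minus: "real_of_int_vec (- n) = - real_of_int_vec n"
  by (simp add: real_of_int_vec_def vec_eq_iff)

text \<open>
  An integer-valued relation between small real numbers is an exact relation.  This is what allows
  one to pass from characters, which take values modulo 1, to real-valued functions.
\<close>

lemma integral_relation_exact:
  fixes P :: "('d::finite) laurent set"
  assumes P: "\<And>f n. f \<in> P \<Longrightarrow> u_pow n * f \<in> P" and g: "g \<in> complex_span P"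
  obtains \<rho> \<eta> where "\<rho> \<ge> 0" "\<eta> > 0"
    "\<And>y m. (\<And>f. f \<in> P \<Longrightarrow> pairing y (to_complex f) \<in> \<int>) \<Longrightarrow>
       (\<And>k. norm (real_of_int_vec k) \<le> \<rho> \<Longrightarrow> \<bar>y (m + k)\<bar> \<le> \<eta>) \<Longrightarrow>
       pairing y (single m 1 * g) = 0"
proof -
  let ?Q = "\<lambda>g \<rho> \<eta>. \<forall>y m. (\<forall>f\<in>P. pairing y (to_complex f) \<in> \<int>) \<longrightarrow>
       (\<forall>k. norm (real_of_int_vec k) \<le> \<rho> \<longrightarrow> \<bar>y (m + k)\<bar> \<le> \<eta>) \<longrightarrow>
       pairing y (single m 1 * g) = 0"
  have "\<exists>\<rho> \<eta>. \<rho> \<ge> 0 \<and> \<eta> > 0 \<and> ?Q g \<rho> \<eta>"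
    using g
  proof (induction rule: complex_span.induct)
    case zero
    then show ?case by (intro exI[of _ 1]) simp
  next
    case (step f g c)
    then obtain \<rho> \<eta> where IH: "\<rho> \<ge> 0" "\<eta> > 0" "?Q g \<rho> \<eta>" by blast
    obtain \<rho>' where "\<rho>' \<ge> 0" and \<rho>': "\<And>k. k \<in> keys f \<Longrightarrow> norm (real_of_int_vec k) \<le> \<rho>'"
      by (rule finite_upper_bound[OF finite_keys[of f], where f = "\<lambda>k. norm (real_of_int_vec k)"]) (rule that)
    \<comment> \<open>With this bound the pairing with a translate of \<open>f\<close> has modulus
      below 1, and an integer of modulus below 1 is 0. The summand 1 in the denominator covers
      \<open>f = 0\<close>.\<close>
    define \<eta>' where "\<eta>' = 1 / (l1_norm (to_complex f) + 1)"
    have \<eta>': "\<eta>' > 0" "l1_norm (to_complex f) * \<eta>' < 1"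
    proof -
      have "0 < l1_norm (to_complex f) + 1" by (rule add_nonneg_pos) simp_all
      then show "\<eta>' > 0" "l1_norm (to_complex f) * \<eta>' < 1" by (simp_all add: \<eta>'_def)
    qed
    have "?Q (single 0 c * to_complex f + g) (max \<rho> \<rho>') (min \<eta> \<eta>')"
    proof (intro allI impI)
      fix y m
      assume int: "\<forall>f\<in>P. pairing y (to_complex f) \<in> \<int>"
        and small: "\<forall>k. norm (real_of_int_vec k) \<le> max \<rho> \<rho>' \<longrightarrow> \<bar>y (m + k)\<bar> \<le> min \<eta> \<eta>'"
      let ?F = "to_complex (u_pow m * f)"
      have "cmod (pairing y ?F) \<le> l1_norm ?F * \<eta>'"
      proof (rule norm_pairing_le)
        fix k assume "k \<in> keys ?F"
        then obtain j where "j \<in> keys f" "k = m + j"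
          using keys_single_times[of m 1 f] by (auto simp: u_pow_def)
        then show "\<bar>y k\<bar> \<le> \<eta>'" using small \<rho>'[of j] by auto
      qed
      also have "\<dots> \<le> l1_norm (to_complex f) * \<eta>'"
        using l1_norm_mult[of "single m 1" "to_complex f"] \<eta>'
        by (intro mult_right_mono) (auto simp: to_complex_mult)
      finally have "cmod (pairing y ?F) < 1" using \<eta>' by simp
      moreover have "pairing y ?F \<in> \<int>" using int P step by blast
      ultimately have "pairing y ?F = 0" by (auto elim!: Ints_cases)
      moreover have "pairing y (single m 1 * g) = 0"
        using IH(3) int small by auto
      moreover have "single m 1 * (single 0 c * to_complex f + g)
        = single 0 c * ?F + single m 1 * g"
        by (simp add: distrib_left to_complex_mult mult.assoc[symmetric] mult_single)
      ultimately show "pairing y (single m 1 *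
          (single 0 c * to_complex f + g)) = 0"
        by (simp add: pairing_add pairing_scale)
    qed
    moreover have "max \<rho> \<rho>' \<ge> 0" "min \<eta> \<eta>' > 0" using IH(1,2) \<eta>'(1) by simp_all
    ultimately show ?case by blast
  qed
  then obtain \<rho> \<eta> where "\<rho> \<ge> 0" "\<eta> > 0" "?Q g \<rho> \<eta>" by blast
  then show ?thesis by (intro that[of \<rho> \<eta>]) simp_all
qed

section \<open>Descent along a height function\<close>

text \<open>Modulo \<open>P\<close> every monomial above height \<open>T\<close> is a combination of
  monomials that are lower by the fixed amount \<open>c\<close>. There are two instances: the height
  is the distance to \<open>V\<close>, or a linear functional.\<close>

locale laurent_descent =
  fixes P :: "('d::finite) laurent set" and ht :: "int ^ 'd \<Rightarrow> real" and T c :: real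
    and G :: "'d laurent set"
  assumes zero: "0 \<in> P" and add: "f \<in> P \<Longrightarrow> g \<in> P \<Longrightarrow> f + g \<in> P" and mult: "f \<in> P \<Longrightarrow> r * f \<in> P"
    and c_pos: "c > 0"
    and descent: "ht m > T \<Longrightarrow> \<exists>g\<in>G. 1 - g \<in> P \<and> (\<forall>k\<in>keys g. ht (m + k) \<le> ht m - c)"
begin

text \<open>Real heights are not well-founded; the fixed drop \<open>c\<close> permits induction on
  the number of drops needed to reach \<open>T\<close>.\<close>

lemma descent_induct [case_names base step]:
  assumes base: "\<And>m. ht m \<le> T \<Longrightarrow> Q m"
    and step: "\<And>m g. g \<in> G \<Longrightarrow> 1 - g \<in> P \<Longrightarrow> (\<And>k. k \<in> keys g \<Longrightarrow> Q (m + k)) \<Longrightarrow> Q m"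
  shows "Q m"
proof -
  have "Q m" if "ht m \<le> T + real j * c" for m j
    using that
  proof (induction j arbitrary: m)
    case 0
    then show ?case using base by simp
  next
    case (Suc j)
    show ?case
    proof (cases "ht m \<le> T")
      case False
      then obtain g where g: "g \<in> G" "1 - g \<in> P" "\<forall>k\<in>keys g. ht (m + k) \<le> ht m - c"
        using descent[of m] by auto
      have "ht (m + k) \<le> T + real j * c" if "k \<in> keys g" for k
        using g(3) that Suc.prems by (force simp: algebra_simps)
      then show ?thesis using step[OF g(1,2)] Suc.IH by blast
    qed (rule base)
  qed
  moreover obtain j where "ht m - T < real j * c"
    using c_pos ex_less_of_nat_mult by blast
  then have "ht m \<le> T + real j * c" by simp
  ultimately show ?thesis by blast
qed

text \<open>For \<open>S\<close> it is enough to be an additive subgroup, as the relations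
  \<open>u_pow m * (1 - g)\<close> already lie in \<open>P\<close>. Instances are the kernel of a
  character and the polynomials with a representative in a half-space ring.\<close>

lemma generated_by_low:
  assumes S: "P \<subseteq> S" "\<And>f g. f \<in> S \<Longrightarrow> g \<in> S \<Longrightarrow> f - g \<in> S"
    and low: "\<And>m. ht m \<le> T \<Longrightarrow> u_pow m \<in> S"
  shows "f \<in> S"
proof -
  have S0: "0 \<in> S" using S(1) zero by auto
  have Suminus: "- f \<in> S" if "f \<in> S" for f using S(2)[OF S0 that] by simp
  have Sadd: "f + g \<in> S" if "f \<in> S" "g \<in> S" for f g using S(2)[OF that(1) Suminus[OF that(2)]] by simp
  have Ssum: "sum f A \<in> S" if "\<And>a. a \<in> A \<Longrightarrow> f a \<in> S" for f :: "int ^ 'd \<Rightarrow> 'd laurent" and A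
    using that by (induction A rule: infinite_finite_induct) (auto simp: S0 Sadd)
  have Ssingle: "single k c \<in> S" if "u_pow k \<in> S" for k c
  proof (induction c rule: int_induct[where k = 0])
    case base
    then show ?case by (simp add: S0)
  next
    case (step1 i)
    then show ?case using Sadd that by (simp add: single_add u_pow_def)
  next
    case (step2 i)
    then show ?case using S(2) that by (simp add: single_diff u_pow_def)
  qed
  have "u_pow m \<in> S" for m
  proof (induction m rule: descent_induct)
    case (base m)
    then show ?case by (rule low)
  next
    case (step m g)
    have "u_pow m * (1 - g) \<in> S" using S(1) mult step by blast
    moreover have "u_pow m * g \<in> S"
    proof -
      have "u_pow m * g = (\<Sum>k\<in>keys g. single (m + k) (lookup g k))"
        by (subst poly_mapping_sum_single[of g, symmetric])
          (simp add: sum_distrib_left u_pow_def mult_single)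
      also have "\<dots> \<in> S" by (intro Ssum Ssingle step)
      finally show ?thesis .
    qed
    ultimately show ?case using Sadd by (force simp: algebra_simps)
  qed
  then have "(\<Sum>k\<in>keys f. single k (lookup f k)) \<in> S"
    by (intro Ssum Ssingle)
  then show ?thesis by (simp add: poly_mapping_sum_single)
qed

lemma P_u_pow: "f \<in> P \<Longrightarrow> u_pow n * f \<in> P"
  by (rule mult)

lemma reduce_complex:
  assumes "\<And>k. k \<in> keys f \<Longrightarrow>
      \<exists>h. keys h \<subseteq> L \<and> single k 1 - h \<in> complex_span P \<and> l1_norm h \<le> B"
  shows "\<exists>h. keys h \<subseteq> L \<and> f - h \<in> complex_span P \<and> l1_norm h \<le> l1_norm f * B"
proof -
  obtain h where h: "\<And>k. k \<in> keys f \<Longrightarrow>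
      keys (h k) \<subseteq> L \<and> single k 1 - h k \<in> complex_span P \<and> l1_norm (h k) \<le> B"
    using assms by metis
  define H where "H = (\<Sum>k\<in>keys f. single 0 (lookup f k) * h k)"
  have "keys H \<subseteq> (\<Union>k\<in>keys f. keys (single 0 (lookup f k) * h k))"
    unfolding H_def by (rule keys_sum_subset)
  also have "\<dots> \<subseteq> L"
  proof (rule UN_least)
    fix k assume "k \<in> keys f"
    then show "keys (single 0 (lookup f k) * h k) \<subseteq> L"
      using h keys_single_times[of 0 "lookup f k" "h k"] by auto
  qed
  finally have "keys H \<subseteq> L" .
  moreover have "f - H \<in> complex_span P"
  proof -
    have sum: "sum a A \<in> complex_span P" if "\<And>i. i \<in> A \<Longrightarrow> a i \<in> complex_span P"
      for a and A :: "(int ^ 'd) set"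
      using that by (induction A rule: infinite_finite_induct)
        (auto simp: complex_span.zero complex_span_add)
    have "f - H = (\<Sum>k\<in>keys f. single 0 (lookup f k) * (single k 1 - h k))"
      by (subst (1) poly_mapping_sum_single[of f, symmetric])
        (simp add: H_def right_diff_distrib sum_subtractf mult_single)
    also have "\<dots> \<in> complex_span P"
      using h complex_span_mult[OF P_u_pow] by (intro sum) blast
    finally show ?thesis .
  qed
  moreover have "l1_norm H \<le> l1_norm f * B"
  proof -
    have "l1_norm H \<le> (\<Sum>k\<in>keys f. l1_norm (single 0 (lookup f k) * h k))"
      unfolding H_def by (rule l1_norm_sum)
    also have "\<dots> \<le> (\<Sum>k\<in>keys f. cmod (lookup f k) * B)"
    proof (rule sum_mono)
      fix k assume "k \<in> keys f"
      then have "cmod (lookup f k) * l1_norm (h k) \<le> cmod (lookup f k) * B"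
        using h by (intro mult_left_mono) auto
      then show "l1_norm (single 0 (lookup f k) * h k) \<le> cmod (lookup f k) * B"
        using l1_norm_mult[of "single 0 (lookup f k)" "h k"] by simp
    qed
    also have "\<dots> = l1_norm f * B" by (simp add: l1_norm_def sum_distrib_right)
    finally show ?thesis .
  qed
  ultimately show ?thesis by blast
qed

end

text \<open>The bound \<open>C\<close> controls the cost of one descent step, and subadditivity of
  the height controls products.\<close>

locale bounded_descent = laurent_descent P ht T c G
  for P :: "('d::finite) laurent set" and ht T c G +
  fixes C :: real
  assumes C: "C \<ge> 1" "g \<in> G \<Longrightarrow> l1_norm (to_complex g) \<le> C"
    and ht_add: "ht (m + n) \<le> ht m + ht n" and ht_zero: "ht 0 = 0" and T_nonneg: "T \<ge> 0"
begin

definition step_count :: "real \<Rightarrow> nat" where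
  "step_count s = nat \<lceil>(s - T) / c\<rceil>"

lemma step_count: "s \<le> T + real (step_count s) * c"
proof -
  have "(s - T) / c \<le> real (step_count s)" by (simp add: step_count_def real_nat_ceiling_ge)
  then show ?thesis using c_pos by (simp add: field_simps)
qed

text \<open>Each of the \<open>j\<close> drops multiplies the norm by at most \<open>C\<close>;
  \<open>C \<ge> 1\<close> accommodates monomials that arrive early.\<close>

lemma bounded_reduction:
  assumes "ht m \<le> T + real j * c"
  shows "\<exists>h. keys h \<subseteq> {n. ht n \<le> T} \<and>
    single m 1 - h \<in> complex_span P \<and> l1_norm h \<le> C ^ j"
  using assms
proof (induction j arbitrary: m)
  case 0
  then show ?case
    by (intro exI[of _ "single m 1"]) (auto simp: complex_span.zero)
next
  case (Suc j)
  show ?case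
  proof (cases "ht m \<le> T")
    case True
    then show ?thesis
      using C(1) by (intro exI[of _ "single m 1"]) (auto simp: complex_span.zero one_le_power simp del: power_Suc)
  next
    case False
    then obtain g where g: "g \<in> G" "1 - g \<in> P" "\<forall>k\<in>keys g. ht (m + k) \<le> ht m - c"
      using descent[of m] by auto
    let ?f = "single m 1 * to_complex g"
    have "\<exists>h. keys h \<subseteq> {n. ht n \<le> T} \<and> ?f - h \<in> complex_span P \<and> l1_norm h \<le> l1_norm ?f * C ^ j"
    proof (rule reduce_complex, rule Suc.IH)
      fix k assume "k \<in> keys ?f"
      then obtain i where "i \<in> keys g" "k = m + i"
        using keys_single_times[of m 1 "to_complex g"] by auto
      then show "ht k \<le> T + real j * c" using g(3) Suc.prems by (force simp: algebra_simps)
    qed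
    then obtain h where h: "keys h \<subseteq> {n. ht n \<le> T}" "?f - h \<in> complex_span P"
      "l1_norm h \<le> l1_norm ?f * C ^ j" by blast
    have "l1_norm ?f \<le> C"
      using l1_norm_mult[of "single m 1" "to_complex g"] C(2)[OF g(1)] by simp
    then have "l1_norm ?f * C ^ j \<le> C ^ Suc j" using C(1) by (simp add: mult_right_mono)
    moreover have "single m 1 - h \<in> complex_span P"
    proof -
      have "single m 1 * to_complex (1 - g) \<in> complex_span P"
        using complex_span_mult[OF P_u_pow to_complex_in_complex_span] g by blast
      from complex_span_add[OF this h(2)] show ?thesis
        by (simp add: to_complex_diff right_diff_distrib)
    qed
    ultimately show ?thesis using h by (meson order_trans)
  qed
qed

text \<open>The quotient norm of slab representatives decides. If it vanishes at 1, the first case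
  holds. Otherwise a rescaling of it is a submultiplicative seminorm and has a bounded character; a
  monomial of height at most \<open>s\<close> has seminorm bounded in terms of \<open>s\<close>,
  whence the last estimate.\<close>

lemma small_or_character:
  obtains (small) "\<And>\<epsilon>. \<epsilon> > 0 \<Longrightarrow> \<exists>h. keys h \<subseteq> {n. ht n \<le> T} \<and>
      1 - h \<in> complex_span P \<and> l1_norm h < \<epsilon>"
  | (character) \<phi> :: "'d complex_laurent \<Rightarrow> complex" and K where
      "\<And>a b. \<phi> (a + b) = \<phi> a + \<phi> b" "\<And>a b. \<phi> (a * b) = \<phi> a * \<phi> b"
      "\<And>c. \<phi> (single 0 c) = c" "\<And>f. f \<in> P \<Longrightarrow> \<phi> (to_complex f) = 0"
      "\<And>n s. ht n \<le> s \<Longrightarrow> cmod (\<phi> (single n 1)) \<le> K s"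
proof -
  let ?L = "{n. ht n \<le> T}"
  define K where "K s = C ^ step_count s" for s
  have K1: "1 \<le> K s" for s using C(1) by (simp add: K_def)
  have red: "\<exists>h. keys h \<subseteq> ?L \<and> f - h \<in> complex_span P \<and> l1_norm h \<le> l1_norm f * K s"
    if "keys f \<subseteq> {n. ht n \<le> s}" for f s
  proof (rule reduce_complex)
    fix k assume "k \<in> keys f"
    then have "ht k \<le> s" using that by auto
    then show "\<exists>h. keys h \<subseteq> ?L \<and> single k 1 - h \<in> complex_span P \<and> l1_norm h \<le> K s"
      unfolding K_def using step_count[of s] by (intro bounded_reduction) simp
  qed
  show ?thesis
  proof (cases "\<forall>\<epsilon>>0. \<exists>h. keys h \<subseteq> ?L \<and> 1 - h \<in> complex_span P \<and> l1_norm h < \<epsilon>")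
    case True
    then show ?thesis using small by blast
  next
    case False
    then obtain \<epsilon> where \<epsilon>: "\<epsilon> > 0"
      "\<And>h. keys h \<subseteq> ?L \<Longrightarrow> 1 - h \<in> complex_span P \<Longrightarrow> \<epsilon> \<le> l1_norm h"
      by (meson not_less)
    interpret complex_scalars "single 0 :: complex \<Rightarrow> 'd complex_laurent"
      by standard (simp_all add: single_add mult_single)
    \<comment> \<open>A product of two slab polynomials has height at most \<open>2 * T\<close>, and
      its reduction costs this factor. With the factor built into \<open>S\<close>, the two copies
      in a product of bounds pay for one reduction and for the bound of the result.\<close>
    let ?K = "K (2 * T)"
    define S where "S f = {?K * l1_norm h | h. keys h \<subseteq> ?L \<and> f - h \<in> complex_span P}" for f
    have S_nonneg: "0 \<le> x" if "x \<in> S f" for x f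
      using that K1[of "2 * T"] by (auto simp: S_def)
    have semi: "alg_seminorm (\<lambda>f. Inf (S f))"
    proof (rule alg_seminorm_Inf)
      show "S f \<noteq> {}" for f
      proof -
        obtain s where "s \<ge> 0" "\<And>k. k \<in> keys f \<Longrightarrow> ht k \<le> s"
          by (rule finite_upper_bound[OF finite_keys[of f], where f = ht]) (rule that)
        then have "keys f \<subseteq> {n. ht n \<le> s}" by blast
        from red[OF this] show ?thesis by (auto simp: S_def)
      qed
      show "\<exists>z\<in>S (f + g). z \<le> x + y" if xy: "x \<in> S f" "y \<in> S g" for f g x y
      proof -
        obtain h k where h: "x = ?K * l1_norm h" "keys h \<subseteq> ?L" "f - h \<in> complex_span P"
          and k: "y = ?K * l1_norm k" "keys k \<subseteq> ?L" "g - k \<in> complex_span P"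
          using xy by (auto simp: S_def)
        have "?K * l1_norm (h + k) \<in> S (f + g)"
          using h k keys_add[of h k] complex_span_add[OF h(3) k(3)] by (auto simp: S_def algebra_simps)
        moreover have "?K * l1_norm (h + k) \<le> x + y"
          unfolding h k distrib_left[symmetric] using K1[of "2 * T"] by (intro mult_left_mono l1_norm_add) auto
        ultimately show ?thesis by blast
      qed
      show "\<exists>z\<in>S (f * g). z \<le> x * y" if xy: "x \<in> S f" "y \<in> S g" for f g x y
      proof -
        obtain h k where h: "x = ?K * l1_norm h" "keys h \<subseteq> ?L" "f - h \<in> complex_span P"
          and k: "y = ?K * l1_norm k" "keys k \<subseteq> ?L" "g - k \<in> complex_span P"
          using xy by (auto simp: S_def)
        have "keys (h * k) \<subseteq> {n. ht n \<le> 2 * T}"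
        proof
          fix n assume "n \<in> keys (h * k)"
          then obtain a b where "a \<in> keys h" "b \<in> keys k" "n = a + b"
            using keys_mult[of h k] by blast
          then show "n \<in> {n. ht n \<le> 2 * T}" using h(2) k(2) ht_add[of a b] by force
        qed
        from red[OF this] obtain l where l: "keys l \<subseteq> ?L" "h * k - l \<in> complex_span P"
          "l1_norm l \<le> l1_norm (h * k) * ?K" by blast
        have "f * (g - k) + (f - h) * k + (h * k - l) \<in> complex_span P"
          using complex_span_mult[OF P_u_pow h(3), of k] complex_span_mult[OF P_u_pow k(3), of f] l(2)
          by (auto simp: mult.commute intro!: complex_span_add)
        then have "f * g - l \<in> complex_span P" by (simp add: algebra_simps)
        then have "?K * l1_norm l \<in> S (f * g)" using l by (auto simp: S_def)
        moreover have "?K * l1_norm l \<le> x * y"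
        proof -
          have "l1_norm l \<le> l1_norm h * l1_norm k * ?K"
            using l(3) l1_norm_mult[of h k] K1[of "2 * T"]
            by (meson order_trans mult_right_mono zero_le_one)
          then have "?K * l1_norm l \<le> ?K * (l1_norm h * l1_norm k * ?K)"
            using K1[of "2 * T"] by (intro mult_left_mono) auto
          then show ?thesis by (simp add: h k mult_ac)
        qed
        ultimately show ?thesis by blast
      qed
      show "\<exists>z\<in>S (single 0 c * f). z \<le> cmod c * x" if x: "x \<in> S f" for f c x
      proof -
        obtain h where h: "x = ?K * l1_norm h" "keys h \<subseteq> ?L" "f - h \<in> complex_span P"
          using x by (auto simp: S_def)
        have "single 0 c * f - single 0 c * h \<in> complex_span P"
          using complex_span_mult[OF P_u_pow h(3)] by (simp add: right_diff_distrib[symmetric])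
        then have "?K * l1_norm (single 0 c * h) \<in> S (single 0 c * f)"
          using h keys_single_times[of 0 c h] by (auto simp: S_def)
        moreover have "?K * l1_norm (single 0 c * h) \<le> ?K * (cmod c * l1_norm h)"
          using l1_norm_mult[of "single 0 c" h] K1[of "2 * T"] by (intro mult_left_mono) auto
        ultimately show ?thesis by (auto simp: h mult_ac)
      qed
      show "\<epsilon> \<le> x" if x: "x \<in> S 1" for x
      proof -
        obtain h where h: "x = ?K * l1_norm h" "keys h \<subseteq> ?L" "1 - h \<in> complex_span P"
          using x unfolding S_def by blast
        have "l1_norm h \<le> x" using mult_right_mono[OF K1[of "2 * T"] l1_norm_nonneg[of h]] by (simp add: h)
        then show ?thesis using \<epsilon>(2)[OF h(2,3)] by simp
      qed
    qed (use S_nonneg \<epsilon>(1) in auto)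
    obtain \<phi> :: "'d complex_laurent \<Rightarrow> complex"
      where \<phi>: "\<And>a b. \<phi> (a + b) = \<phi> a + \<phi> b" "\<And>a b. \<phi> (a * b) = \<phi> a * \<phi> b"
        "\<And>c. \<phi> (single 0 c) = c" "\<And>a. cmod (\<phi> a) \<le> Inf (S a)"
      using exists_bounded_character[OF semi] by blast
    have le: "cmod (\<phi> f) \<le> x" if "x \<in> S f" for f x
    proof -
      have "Inf (S f) \<le> x" using that S_nonneg by (intro cInf_lower bdd_belowI) auto
      then show ?thesis using \<phi>(4)[of f] by simp
    qed
    show ?thesis
    proof (rule character)
      show "\<phi> (to_complex f) = 0" if "f \<in> P" for f
      proof -
        have "0 \<in> S (to_complex f)"
          using to_complex_in_complex_span[OF that] by (auto simp: S_def intro!: exI[of _ 0])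
        from le[OF this] show ?thesis by simp
      qed
      show "cmod (\<phi> (single n 1)) \<le> ?K * K s" if "ht n \<le> s" for n s
      proof -
        have "keys (single n (1::complex)) \<subseteq> {n. ht n \<le> s}" using that by simp
        from red[OF this] obtain h where h: "keys h \<subseteq> ?L"
          "single n 1 - h \<in> complex_span P" "l1_norm h \<le> K s" by auto
        then have "?K * l1_norm h \<in> S (single n 1)" by (auto simp: S_def)
        from le[OF this] have "cmod (\<phi> (single n 1)) \<le> ?K * l1_norm h" .
        also have "\<dots> \<le> ?K * K s" using h K1[of "2 * T"] by (intro mult_left_mono) auto
        finally show ?thesis .
      qed
    qed (rule \<phi>)+
  qed
qed

end

section \<open>Distance to a subspace\<close>

text \<open>Pythagoras: subtracting vectors of \<open>V\<close> from \<open>x\<close> does not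
  change the component orthogonal to \<open>V\<close>.\<close>

lemma infdist_subspace_eq_norm:
  fixes V :: "('a::euclidean_space) set"
  assumes "subspace V" "z \<in> V\<^sup>\<bottom>" "x - z \<in> V"
  shows "infdist x V = norm z"
proof (rule antisym)
  show "infdist x V \<le> norm z"
    using infdist_le[OF assms(3), of x] by (simp add: dist_norm)
  have "norm z \<le> dist x v" if v: "v \<in> V" for v
  proof -
    have "x - z - v \<in> V" using assms v by (simp add: subspace_diff)
    then have "orthogonal (x - z - v) z" using assms(2) by (auto simp: orthogonal_comp_def)
    then have "(norm (x - v))\<^sup>2 = (norm (x - z - v))\<^sup>2 + (norm z)\<^sup>2"
      using norm_add_Pythagorean[of "x - z - v" z] by simp
    then have "(norm z)\<^sup>2 \<le> (norm (x - v))\<^sup>2" by simp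
    then show ?thesis by (simp add: dist_norm)
  qed
  then show "norm z \<le> infdist x V"
    using subspace_0[OF assms(1)] by (auto simp: infdist_def intro!: cINF_greatest)
qed

lemma orthogonal_component:
  fixes V :: "('a::euclidean_space) set"
  assumes "subspace V"
  obtains z where "z \<in> V\<^sup>\<bottom>" "x - z \<in> V"
proof -
  obtain y z where "y \<in> span V" "\<And>w. w \<in> span V \<Longrightarrow> orthogonal z w" "x = y + z"
    using orthogonal_subspace_decomp_exists[of V x] by blast
  then show ?thesis
    using that[of z] assms by (auto simp: orthogonal_comp_def orthogonal_commute span_eq_iff[THEN iffD2])
qed

lemma infdist_subspace_add:
  fixes V :: "('a::euclidean_space) set"
  assumes V: "subspace V"
  shows "infdist (x + y) V \<le> infdist x V + infdist y V"
proof -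
  obtain a b where a: "a \<in> V\<^sup>\<bottom>" "x - a \<in> V" and b: "b \<in> V\<^sup>\<bottom>" "y - b \<in> V"
    using orthogonal_component[OF V] by metis
  have "a + b \<in> V\<^sup>\<bottom>"
    using a b subspace_orthogonal_comp subspace_add by blast
  moreover have "x + y - (a + b) \<in> V"
    using subspace_add[OF V a(2) b(2)] by (simp add: algebra_simps)
  ultimately have "infdist (x + y) V = norm (a + b)" by (rule infdist_subspace_eq_norm[OF V])
  then show ?thesis
    using norm_triangle_ineq[of a b] infdist_subspace_eq_norm[OF V a] infdist_subspace_eq_norm[OF V b] by simp
qed

lemma infdist_subspace_le_norm:
  fixes V :: "('a::euclidean_space) set"
  assumes "subspace V"
  shows "infdist x V \<le> norm x"
  using infdist_le[OF subspace_0[OF assms], of x] by simp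

lemma inner_le_infdist:
  fixes V :: "('a::euclidean_space) set"
  assumes V: "subspace V" and v: "v \<in> V\<^sup>\<bottom>"
  shows "\<bar>x \<bullet> v\<bar> \<le> infdist x V * norm v"
proof -
  obtain z where z: "z \<in> V\<^sup>\<bottom>" "x - z \<in> V" using orthogonal_component[OF V] by metis
  have "(x - z) \<bullet> v = 0" using z v by (auto simp: orthogonal_comp_def orthogonal_def)
  then have "x \<bullet> v = z \<bullet> v" by (simp add: inner_diff_left)
  then show ?thesis
    using Cauchy_Schwarz_ineq2[of z v] infdist_subspace_eq_norm[OF V z] by simp
qed

text \<open>A strict inequality on a finite support is an open condition on \<open>v\<close>, which
  is what compactness of the sphere requires. Modulo \<open>P\<close> it makes 1 a combination of
  strictly descending monomials.\<close>

definition lower_unit_at :: "('d::finite) laurent set \<Rightarrow> real ^ 'd \<Rightarrow> bool" where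
  "lower_unit_at P v \<longleftrightarrow>
     (\<exists>g. 1 - g \<in> P \<and> (\<forall>k\<in>keys g. real_of_int_vec k \<bullet> v < 0))"

lemma lower_unit_at_neighborhood:
  fixes P :: "('d::finite) laurent set"
  assumes "lower_unit_at P v"
  obtains g e where "1 - g \<in> P" "e > 0"
    "\<And>w k. w \<in> ball v e \<Longrightarrow> k \<in> keys g \<Longrightarrow> real_of_int_vec k \<bullet> w \<le> - e"
proof -
  obtain g where g: "1 - g \<in> P" "\<And>k. k \<in> keys g \<Longrightarrow> real_of_int_vec k \<bullet> v < 0"
    using assms by (auto simp: lower_unit_at_def)
  have pos: "norm (real_of_int_vec k) + 1 > 0" for k :: "int ^ 'd"
    by (simp add: add_nonneg_pos)
  \<comment> \<open>The norm in the denominator pays for moving \<open>v\<close> by less than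
    \<open>e\<close>, the additional 1 for the margin \<open>- e\<close> in the conclusion.\<close>
  have "0 < - (real_of_int_vec k \<bullet> v) / (norm (real_of_int_vec k) + 1)" if "k \<in> keys g" for k
    using g(2)[OF that] pos[of k] by (simp add: divide_less_0_iff)
  then have "\<exists>e>0. \<forall>k\<in>keys g. e < - (real_of_int_vec k \<bullet> v) / (norm (real_of_int_vec k) + 1)"
    by (rule finite_positive_lower_bound[OF finite_keys])
  then obtain e where e: "e > 0" and
    e_less: "\<And>k. k \<in> keys g \<Longrightarrow> e < - (real_of_int_vec k \<bullet> v) / (norm (real_of_int_vec k) + 1)" by blast
  show ?thesis
  proof (rule that[OF g(1) e])
    fix w k assume w: "w \<in> ball v e" and k: "k \<in> keys g"
    have 1: "e * (norm (real_of_int_vec k) + 1) \<le> - (real_of_int_vec k \<bullet> v)"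
      using e_less[OF k] unfolding pos_less_divide_eq[OF pos] by (rule less_imp_le)
    have "real_of_int_vec k \<bullet> (w - v) \<le> norm (real_of_int_vec k) * norm (w - v)"
      by (rule norm_cauchy_schwarz)
    also have "\<dots> \<le> norm (real_of_int_vec k) * e"
      using w by (intro mult_left_mono) (auto simp: dist_norm norm_minus_commute)
    finally show "real_of_int_vec k \<bullet> w \<le> - e"
      using 1 by (simp add: inner_diff_right algebra_simps)
  qed
qed

text \<open>
  Compactness of the unit sphere in the orthogonal complement makes finitely many relations
  suffice to move an exponent that is far from \<open>V\<close> closer to \<open>V\<close>.
\<close>

lemma uniform_descent:
  fixes P :: "('d::finite) laurent set"
  assumes V: "subspace V" and P: "\<And>v. v \<in> V\<^sup>\<bottom> \<Longrightarrow> norm v = 1 \<Longrightarrow> lower_unit_at P v"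
  obtains G T c where "finite G" "T \<ge> 0" "c > 0"
    "\<And>m. infdist (real_of_int_vec m) V > T \<Longrightarrow> \<exists>g\<in>G. 1 - g \<in> P \<and>
       (\<forall>k\<in>keys g. infdist (real_of_int_vec (m + k)) V \<le> infdist (real_of_int_vec m) V - c)"
proof -
  define S where "S = sphere 0 1 \<inter> V\<^sup>\<bottom>"
  have S: "compact S"
    unfolding S_def by (intro compact_Int_closed compact_sphere closed_subspace subspace_orthogonal_comp)
  define Q where "Q v g e \<longleftrightarrow> 1 - g \<in> P \<and> e > 0 \<and>
      (\<forall>w k. w \<in> ball v e \<longrightarrow> k \<in> keys g \<longrightarrow> real_of_int_vec k \<bullet> w \<le> - e)"
    for v :: "real ^ 'd" and g :: "'d laurent" and e
  have "\<exists>g e. Q v g e" if "v \<in> S" for v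
  proof -
    have "lower_unit_at P v" using P[of v] that by (simp add: S_def)
    then show ?thesis
    proof (rule lower_unit_at_neighborhood)
      fix g e assume "1 - g \<in> P" "e > 0"
        "\<And>w k. w \<in> ball v e \<Longrightarrow> k \<in> keys g \<Longrightarrow> real_of_int_vec k \<bullet> w \<le> - e"
      then have "Q v g e" by (simp add: Q_def del: mem_ball)
      then show ?thesis by blast
    qed
  qed
  then obtain g e where "\<And>v. v \<in> S \<Longrightarrow> Q v (g v) (e v)" by metis
  then have ge: "\<And>v. v \<in> S \<Longrightarrow> 1 - g v \<in> P" "\<And>v. v \<in> S \<Longrightarrow> e v > 0"
    "\<And>v w k. v \<in> S \<Longrightarrow> w \<in> ball v (e v) \<Longrightarrow> k \<in> keys (g v) \<Longrightarrow> real_of_int_vec k \<bullet> w \<le> - e v"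
    unfolding Q_def by blast+
  have "S \<subseteq> (\<Union>v\<in>S. ball v (e v))" using ge(2) centre_in_ball by blast
  then obtain F where F: "F \<subseteq> S" "finite F" "S \<subseteq> (\<Union>v\<in>F. ball v (e v))"
    using compactE_image[OF S, of S "\<lambda>v. ball v (e v)"] open_ball by metis
  have "\<And>v. v \<in> F \<Longrightarrow> 0 < e v" using F(1) ge(2) by blast
  then have "\<exists>c>0. \<forall>v\<in>F. c < e v" by (rule finite_positive_lower_bound[OF F(2)])
  then obtain c where c: "c > 0" "\<And>v. v \<in> F \<Longrightarrow> c < e v" by blast
  obtain \<rho> where \<rho>: "\<And>v k. v \<in> F \<Longrightarrow> k \<in> keys (g v) \<Longrightarrow> norm (real_of_int_vec k) \<le> \<rho>"
    by (rule finite_upper_bound_keys[OF F(2), where f = "\<lambda>k. norm (real_of_int_vec k)"]) (rule that)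
  \<comment> \<open>Let \<open>z\<close> and \<open>y\<close> be the orthogonal components of
    \<open>m\<close> and \<open>k\<close>; then \<open>z \<bullet> y \<le> - (c * norm z)\<close>.
    Beyond \<open>T\<close> the term \<open>(norm y)\<^sup>2\<close> is at most
    \<open>c * norm z\<close>, half of what the mixed term gains, and the other half yields the drop
    \<open>c / 2\<close>. The summand \<open>c\<close> keeps \<open>norm z - c / 2\<close>
    nonnegative when square roots are taken.\<close>
  define T where "T = c + \<rho>\<^sup>2 / c"
  show ?thesis
  proof (rule that[of "g ` F" T "c / 2"])
    show "finite (g ` F)" "T \<ge> 0" "c / 2 > 0" using F c by (auto simp: T_def)
    fix m assume m: "infdist (real_of_int_vec m) V > T"
    obtain z where z: "z \<in> V\<^sup>\<bottom>" "real_of_int_vec m - z \<in> V" using orthogonal_component[OF V] by metis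
    have dz: "infdist (real_of_int_vec m) V = norm z" by (rule infdist_subspace_eq_norm[OF V z])
    have zT: "norm z > T" using m dz by simp
    have Tc: "c \<le> T" "\<rho>\<^sup>2 / c \<le> T" using c by (auto simp: T_def)
    then have z0: "norm z > 0" using c zT by linarith
    have "z /\<^sub>R norm z \<in> V\<^sup>\<bottom>" by (rule subspace_scale[OF subspace_orthogonal_comp z(1)])
    then have "z /\<^sub>R norm z \<in> S" using z0 by (simp add: S_def)
    then obtain v where v: "v \<in> F" "z /\<^sub>R norm z \<in> ball v (e v)" using F by auto
    have "infdist (real_of_int_vec (m + k)) V \<le> norm z - c / 2" if k: "k \<in> keys (g v)" for k
    proof -
      obtain y where y: "y \<in> V\<^sup>\<bottom>" "real_of_int_vec k - y \<in> V" using orthogonal_component[OF V] by metis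
      have "z + y \<in> V\<^sup>\<bottom>" using z y subspace_orthogonal_comp subspace_add by blast
      moreover have "real_of_int_vec (m + k) - (z + y) \<in> V"
        using subspace_add[OF V z(2) y(2)] by (simp add: real_of_int_vec_add algebra_simps)
      ultimately have eq: "infdist (real_of_int_vec (m + k)) V = norm (z + y)"
        by (rule infdist_subspace_eq_norm[OF V])
      have "(real_of_int_vec k - y) \<bullet> z = 0" using y z by (auto simp: orthogonal_comp_def orthogonal_def)
      then have "y \<bullet> z = real_of_int_vec k \<bullet> z" by (simp add: inner_diff_left)
      moreover have "real_of_int_vec k \<bullet> (z /\<^sub>R norm z) \<le> - c"
        using ge(3)[OF _ v(2) k] v(1) F(1) c(2)[OF v(1)] by force
      then have "(real_of_int_vec k \<bullet> z) / norm z \<le> - c"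
        by (simp add: divide_inverse mult.commute)
      then have "real_of_int_vec k \<bullet> z \<le> - (c * norm z)" by (simp add: pos_divide_le_eq[OF z0])
      ultimately have yz: "z \<bullet> y \<le> - (c * norm z)" by (simp only: inner_commute[of z y])
      have "norm y = infdist (real_of_int_vec k) V" by (rule infdist_subspace_eq_norm[OF V y, symmetric])
      also have "\<dots> \<le> \<rho>" using infdist_subspace_le_norm[OF V] \<rho>[OF v(1) k] by (rule order_trans)
      finally have "(norm y)\<^sup>2 \<le> \<rho>\<^sup>2" by (intro power_mono) auto
      moreover have "\<rho>\<^sup>2 \<le> c * norm z"
      proof -
        have "\<rho>\<^sup>2 \<le> c * T" using Tc(2) c(1) by (simp add: pos_divide_le_eq mult.commute)
        also have "\<dots> \<le> c * norm z" using zT c(1) by (intro mult_left_mono) auto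
        finally show ?thesis .
      qed
      moreover have "(norm (z + y))\<^sup>2 = (norm z)\<^sup>2 + 2 * (z \<bullet> y) + (norm y)\<^sup>2"
        by (simp add: power2_norm_eq_inner inner_add_left inner_add_right inner_commute[of y z])
      moreover have "(norm z - c / 2)\<^sup>2 = (norm z)\<^sup>2 - c * norm z + (c / 2)\<^sup>2"
        by (simp add: power2_eq_square algebra_simps)
      moreover have "A \<le> B" if "d \<le> r" "r \<le> e" "A = a + 2 * b + d" "B = a - e + f" "b \<le> - e" "0 \<le> f"
        for A B a b d e f r :: real using that by linarith
      ultimately have "(norm (z + y))\<^sup>2 \<le> (norm z - c / 2)\<^sup>2"
        using yz zero_le_power2[of "c / 2"] by blast
      then have "norm (z + y) \<le> norm z - c / 2"
        by (rule power2_le_imp_le) (use zT Tc(1) c(1) in linarith)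
      then show ?thesis using eq by simp
    qed
    then show "\<exists>g\<in>g ` F. 1 - g \<in> P \<and> (\<forall>k\<in>keys g.
        infdist (real_of_int_vec (m + k)) V \<le> infdist (real_of_int_vec m) V - c / 2)"
      using v(1) ge(1)[of v] F(1) dz by (intro bexI[of _ "g v"]) auto
  qed
qed

section \<open>From characters of the complexified ring to points of the variety\<close>

lemma exponential_eq_prod_powi:
  fixes \<psi> :: "int ^ ('d::finite) \<Rightarrow> complex"
  assumes "\<psi> 0 = 1" and add: "\<And>m n. \<psi> (m + n) = \<psi> m * \<psi> n"
  shows "\<psi> n = (\<Prod>i\<in>UNIV. \<psi> (axis i 1) powi (n $ i))"
proof -
  have nz: "\<psi> m \<noteq> 0" for m using add[of m "- m"] assms(1) by auto
  have prod: "\<psi> (\<Sum>i\<in>A. f i) = (\<Prod>i\<in>A. \<psi> (f i))" if "finite A" for A and f :: "'d \<Rightarrow> int ^ 'd"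
    using that by (induction A rule: finite_induct) (simp_all add: assms)
  have axis_add: "axis i (a + b) = axis i a + (axis i b :: int ^ 'd)" for i a b
    by (simp add: axis_def vec_eq_iff)
  have axis: "\<psi> (axis i a) = \<psi> (axis i 1) powi a" for i a
  proof (induction a rule: int_induct[where k = 0])
    case base
    have "axis i 0 = (0 :: int ^ 'd)" by (simp add: axis_def vec_eq_iff)
    then show ?case using assms(1) by (simp only: power_int_0_right)
  next
    case (step1 a)
    then show ?case by (simp add: axis_add add power_int_add nz)
  next
    case (step2 a)
    then have "\<psi> (axis i (a - 1)) * \<psi> (axis i 1) = \<psi> (axis i 1) powi (a - 1) * \<psi> (axis i 1)"
      by (simp add: add[symmetric] axis_add[symmetric] power_int_diff nz)
    then show ?case using nz by simp
  qed
  have "n = (\<Sum>i\<in>UNIV. axis i (n $ i))"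
    by (simp add: vec_eq_iff axis_def sum.delta)
  then show ?thesis using prod axis by (metis (no_types, lifting) finite_code prod.cong)
qed

lemma exists_near_integer_vector:
  fixes x :: "real ^ ('d::finite)"
  obtains n where "norm (x - real_of_int_vec n) \<le> CARD('d)"
proof
  let ?n = "\<chi> i. \<lfloor>x $ i\<rfloor>"
  have "norm (x - real_of_int_vec ?n) \<le> (\<Sum>i\<in>UNIV. \<bar>(x - real_of_int_vec ?n) $ i\<bar>)"
    by (rule norm_le_l1_cart)
  also have "\<dots> \<le> (\<Sum>i\<in>(UNIV :: 'd set). 1)"
    by (intro sum_mono) (auto simp: real_of_int_vec_def abs_le_iff, linarith+)
  finally show "norm (x - real_of_int_vec ?n) \<le> CARD('d)" by simp
qed

lemma norm_monomial_eq_exp: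
  fixes z :: "complex ^ ('d::finite)"
  assumes "\<And>i. z $ i \<noteq> 0"
  shows "cmod (\<Prod>i\<in>UNIV. z $ i powi (n $ i)) = exp (real_of_int_vec n \<bullet> (\<chi> i. ln (cmod (z $ i))))"
proof -
  have "cmod (z $ i powi (n $ i)) = exp (real_of_int (n $ i) * ln (cmod (z $ i)))" for i
    using assms[of i] powr_real_of_int'[of "cmod (z $ i)" "n $ i"] by (simp add: norm_power_int powr_def)
  then show ?thesis
    by (simp add: prod_norm[symmetric] exp_sum[symmetric] inner_vec_def real_of_int_vec_def)
qed

text \<open>Every vector of \<open>V\<close> lies within \<open>CARD('d)\<close> of an integer
  vector, by rounding. Hence the functional given by \<open>w\<close> is bounded above on all of
  \<open>V\<close>, and a linear functional bounded above on a subspace vanishes there.\<close>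

lemma orthogonal_if_bounded_near_subspace:
  fixes V :: "(real ^ ('d::finite)) set"
  assumes V: "subspace V"
    and bd: "\<And>n. infdist (real_of_int_vec n) V \<le> CARD('d) \<Longrightarrow> real_of_int_vec n \<bullet> w \<le> B"
  shows "w \<in> V\<^sup>\<bottom>"
proof -
  have le: "v \<bullet> w \<le> B + CARD('d) * norm w" if v: "v \<in> V" for v
  proof -
    obtain n where n: "norm (v - real_of_int_vec n) \<le> CARD('d)" using exists_near_integer_vector .
    have "infdist (real_of_int_vec n) V \<le> CARD('d)"
      using infdist_le[OF v, of "real_of_int_vec n"] n by (simp add: dist_norm norm_minus_commute)
    from bd[OF this] have "real_of_int_vec n \<bullet> w \<le> B" .
    moreover have "(v - real_of_int_vec n) \<bullet> w \<le> CARD('d) * norm w"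
      using norm_cauchy_schwarz[of "v - real_of_int_vec n" w] mult_right_mono[OF n norm_ge_zero[of w]] by linarith
    ultimately show ?thesis by (simp add: inner_diff_left)
  qed
  have "v \<bullet> w = 0" if v: "v \<in> V" for v
  proof (rule ccontr)
    assume "v \<bullet> w \<noteq> 0"
    define r where "r = (B + CARD('d) * norm w + 1) / (v \<bullet> w)"
    have "(r *\<^sub>R v) \<bullet> w = B + CARD('d) * norm w + 1" using \<open>v \<bullet> w \<noteq> 0\<close> by (simp add: r_def)
    then show False using le[of "r *\<^sub>R v"] v V by (simp add: subspace_scale)
  qed
  then show ?thesis by (auto simp: orthogonal_comp_def orthogonal_def)
qed

text \<open>The coordinates of the point are the values of the character at the variables.
  Boundedness of the character on a slab bounds the moduli of the monomials there, which forces the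
  logarithm of the point to be orthogonal to \<open>V\<close>.\<close>

lemma variety_point_of_character:
  fixes P :: "('d::finite) laurent set" and \<phi> :: "'d complex_laurent \<Rightarrow> complex"
  assumes V: "subspace V"
    and \<phi>: "\<And>a b. \<phi> (a + b) = \<phi> a + \<phi> b" "\<And>a b. \<phi> (a * b) = \<phi> a * \<phi> b"
      "\<And>c. \<phi> (single 0 c) = c" "\<And>f. f \<in> P \<Longrightarrow> \<phi> (to_complex f) = 0"
    and bd: "\<And>n s. infdist (real_of_int_vec n) V \<le> s \<Longrightarrow> cmod (\<phi> (single n 1)) \<le> K s"
  shows "V\<^sup>\<bottom> \<inter> log_variety P \<noteq> {}"
proof -
  define \<psi> where "\<psi> n = \<phi> (single n 1)" for n
  define z where "z = (\<chi> i. \<psi> (axis i 1))"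
  define w where "w = (\<chi> i. ln (cmod (z $ i)))"
  have \<psi>: "\<psi> 0 = 1" "\<psi> (m + n) = \<psi> m * \<psi> n" for m n
    using \<phi>(3)[of 1] by (simp_all add: \<psi>_def \<phi>(2)[symmetric] mult_single)
  have \<psi>_eq: "\<psi> n = (\<Prod>i\<in>UNIV. z $ i powi (n $ i))" for n
    using exponential_eq_prod_powi[of \<psi> n] \<psi> by (simp add: z_def)
  have nz: "\<psi> n \<noteq> 0" for n using \<psi>(2)[of n "- n"] \<psi>(1) by auto
  have z: "z $ i \<noteq> 0" for i using nz by (simp add: z_def)
  have eval: "laurent_eval f z = \<phi> (to_complex f)" for f
  proof -
    have \<phi>0: "\<phi> 0 = 0" using \<phi>(1)[of 0 0] by simp
    have sum: "\<phi> (\<Sum>k\<in>A. a k) = (\<Sum>k\<in>A. \<phi> (a k))" for a and A :: "(int ^ 'd) set"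
      by (induction A rule: infinite_finite_induct) (simp_all add: \<phi> \<phi>0)
    have "\<phi> (single k c) = c * \<psi> k" for k c
      using \<phi>(2)[of "single 0 c" "single k 1"] by (simp add: mult_single \<phi>(3) \<psi>_def)
    then show ?thesis
      by (subst poly_mapping_sum_single[of "to_complex f", symmetric])
        (simp add: sum laurent_eval_def \<psi>_eq)
  qed
  have "w \<in> V\<^sup>\<bottom>"
  proof (rule orthogonal_if_bounded_near_subspace[OF V])
    fix n assume "infdist (real_of_int_vec n) V \<le> CARD('d)"
    then have "exp (real_of_int_vec n \<bullet> w) \<le> K CARD('d)"
      using bd[of n "CARD('d)"] norm_monomial_eq_exp[OF z, of n] by (simp add: \<psi>_def[symmetric] \<psi>_eq w_def)
    then show "real_of_int_vec n \<bullet> w \<le> ln (K CARD('d))"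
      by (metis exp_gt_zero exp_le_cancel_iff exp_ln less_le_trans)
  qed
  moreover have "w \<in> log_variety P"
    unfolding log_variety_def variety_def w_def using z eval \<phi>(4) by auto
  ultimately show ?thesis by blast
qed

section \<open>Expansiveness for characters that vanish on an ideal\<close>

lemma integral_relations_exact:
  fixes P :: "('d::finite) laurent set"
  assumes P: "\<And>f n. f \<in> P \<Longrightarrow> u_pow n * f \<in> P" and F: "finite F" "F \<subseteq> complex_span P"
  obtains \<rho> \<eta> where "\<rho> \<ge> 0" "\<eta> > 0"
    "\<And>y m g. (\<And>f. f \<in> P \<Longrightarrow> pairing y (to_complex f) \<in> \<int>) \<Longrightarrow>
       (\<And>k. norm (real_of_int_vec k) \<le> \<rho> \<Longrightarrow> \<bar>y (m + k)\<bar> \<le> \<eta>) \<Longrightarrow> g \<in> F \<Longrightarrow>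
       pairing y (single m 1 * g) = 0"
proof -
  have "\<exists>\<rho> \<eta>. \<rho> \<ge> 0 \<and> \<eta> > 0 \<and> (\<forall>y m. (\<forall>f. f \<in> P \<longrightarrow> pairing y (to_complex f) \<in> \<int>) \<longrightarrow>
       (\<forall>k. norm (real_of_int_vec k) \<le> \<rho> \<longrightarrow> \<bar>y (m + k)\<bar> \<le> \<eta>) \<longrightarrow>
       pairing y (single m 1 * g) = 0)" if "g \<in> F" for g
  proof -
    have "g \<in> complex_span P" using that F(2) by blast
    from integral_relation_exact[OF P this] obtain \<rho> \<eta> where "\<rho> \<ge> 0" "\<eta> > 0"
      "\<And>y m. (\<And>f. f \<in> P \<Longrightarrow> pairing y (to_complex f) \<in> \<int>) \<Longrightarrow>
       (\<And>k. norm (real_of_int_vec k) \<le> \<rho> \<Longrightarrow> \<bar>y (m + k)\<bar> \<le> \<eta>) \<Longrightarrow>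
       pairing y (single m 1 * g) = 0" by blast
    then show ?thesis by (intro exI[of _ \<rho>] exI[of _ \<eta>]) simp
  qed
  then obtain \<rho> \<eta> where *: "\<And>g. g \<in> F \<Longrightarrow> \<rho> g \<ge> 0" "\<And>g. g \<in> F \<Longrightarrow> \<eta> g > 0"
    "\<And>g y m. g \<in> F \<Longrightarrow> (\<forall>f. f \<in> P \<longrightarrow> pairing y (to_complex f) \<in> \<int>) \<Longrightarrow>
       (\<forall>k. norm (real_of_int_vec k) \<le> \<rho> g \<longrightarrow> \<bar>y (m + k)\<bar> \<le> \<eta> g) \<Longrightarrow>
       pairing y (single m 1 * g) = 0"
    by metis
  obtain \<rho>0 where \<rho>0: "\<rho>0 \<ge> 0" "\<And>g. g \<in> F \<Longrightarrow> \<rho> g \<le> \<rho>0"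
    by (rule finite_upper_bound[OF F(1), where f = \<rho>]) (rule that)
  obtain \<eta>0 where \<eta>0: "\<eta>0 > 0" "\<And>g. g \<in> F \<Longrightarrow> \<eta>0 < \<eta> g"
    using finite_positive_lower_bound[of F \<eta>] F(1) *(2) by blast
  show ?thesis
  proof (rule that[OF \<rho>0(1) \<eta>0(1)])
    fix y m g
    assume int: "\<And>f. f \<in> P \<Longrightarrow> pairing y (to_complex f) \<in> \<int>" and g: "g \<in> F"
      and small: "\<And>k. norm (real_of_int_vec k) \<le> \<rho>0 \<Longrightarrow> \<bar>y (m + k)\<bar> \<le> \<eta>0"
    show "pairing y (single m 1 * g) = 0"
      using *(3)[OF g] int small \<rho>0(2)[OF g] \<eta>0(2)[OF g] by (meson less_imp_le order_trans)
  qed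
qed

lemma small_Arg:
  assumes "\<eta> > 0"
  obtains \<delta> where "\<delta> > 0" "\<And>w. cmod (w - 1) \<le> \<delta> \<Longrightarrow> \<bar>Arg w\<bar> \<le> \<eta>"
proof -
  have "continuous (at 1) Arg" by (rule continuous_at_Arg) (simp add: complex_nonpos_Reals_iff)
  then obtain d where d: "d > 0" "\<And>w. dist w 1 < d \<Longrightarrow> dist (Arg w) (Arg 1) < \<eta>"
    using assms unfolding continuous_at_eps_delta by blast
  show ?thesis
  proof (rule that[of "d / 2"])
    fix w assume "cmod (w - 1) \<le> d / 2"
    then show "\<bar>Arg w\<bar> \<le> \<eta>" using d(1) d(2)[of w] by (simp add: dist_norm)
  qed (use d in simp)
qed

text \<open>A character of the additive group is determined by its values at the monomials.
  Principal arguments of these values make the lift \<open>y\<close> small wherever the character is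
  close to 1.\<close>

lemma character_eq_exp_pairing:
  fixes x :: "('d::finite) laurent \<Rightarrow> complex"
  assumes x: "\<And>f g. x (f + g) = x f * x g" "\<And>f. cmod (x f) = 1"
  shows "x f = exp (2 * of_real pi * \<i> * pairing (\<lambda>n. Arg (x (u_pow n)) / (2 * pi)) (to_complex f))"
    (is "_ = exp (?c * pairing ?y _)")
proof -
  have "x 0 * x 0 = x 0 * 1" using x(1)[of 0 0] by simp
  moreover have "x f \<noteq> 0" for f using x(2)[of f] by auto
  ultimately have x0: "x 0 = 1" by (metis mult_cancel_left)
  have base: "x (u_pow k) = exp (?c * of_real (?y k))" for k
  proof -
    have "exp (?c * of_real (?y k)) = cis (Arg (x (u_pow k)))" by (simp add: cis_conv_exp mult_ac)
    also have "\<dots> = x (u_pow k)" using \<open>\<And>f. x f \<noteq> 0\<close> x(2) by (simp add: cis_Arg sgn_div_norm)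
    finally show ?thesis ..
  qed
  have single: "x (single k c) = exp (?c * (of_int c * of_real (?y k)))" for k c
  proof (induction c rule: int_induct[where k = 0])
    case base
    then show ?case by (simp add: x0)
  next
    case (step1 i)
    have "x (single k (i + 1)) = x (single k i) * x (u_pow k)"
      by (simp add: single_add u_pow_def x)
    also have "\<dots> = exp (?c * (of_int i * of_real (?y k)) + ?c * of_real (?y k))"
      by (simp only: exp_add step1(2)[symmetric] base[symmetric])
    finally show ?case by (simp add: algebra_simps)
  next
    case (step2 i)
    have "x (single k i) = x (single k (i - 1)) * x (u_pow k)"
      by (simp add: u_pow_def x(1)[symmetric] single_add[symmetric])
    then have "x (single k (i - 1)) = x (single k i) / x (u_pow k)"
      using \<open>\<And>f. x f \<noteq> 0\<close> by simp
    also have "\<dots> = exp (?c * (of_int i * of_real (?y k)) - ?c * of_real (?y k))"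
      by (simp only: exp_diff step2(2)[symmetric] base[symmetric])
    finally show ?case by (simp add: algebra_simps)
  qed
  show ?thesis
  proof (induction f rule: poly_mapping_single_induct)
    case (add k c f)
    then show ?case by (simp only: x single to_complex_add pairing_add exp_add distrib_left to_complex_single pairing_single)
  qed (simp add: x0)
qed

text \<open>Let \<open>M\<close> be the supremum of the lifted angles on the slab. A small
  representative \<open>h\<close> of 1 expresses each of them through angles up to twice the height,
  which the descent bounds by \<open>C ^ J * M\<close>; the smallness of \<open>h\<close> then gives
  \<open>M \<le> M / 2\<close>.\<close>

theorem ideal_expansive:
  fixes P :: "('d::finite) laurent set" and V :: "(real ^ 'd) set"
  assumes P: "0 \<in> P" "\<And>f g. f \<in> P \<Longrightarrow> g \<in> P \<Longrightarrow> f + g \<in> P" "\<And>f r. f \<in> P \<Longrightarrow> r * f \<in> P"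
    and V: "subspace V" and low: "\<And>v. v \<in> V\<^sup>\<bottom> \<Longrightarrow> norm v = 1 \<Longrightarrow> lower_unit_at P v"
    and disj: "V\<^sup>\<bottom> \<inter> log_variety P = {}"
  obtains \<delta> t where "\<delta> > 0" "t > 0"
    "\<And>x f. (\<And>f g. x (f + g) = x f * x g) \<Longrightarrow> (\<And>f. cmod (x f) = 1) \<Longrightarrow> (\<And>f. f \<in> P \<Longrightarrow> x f = 1) \<Longrightarrow>
       (\<And>n. infdist (real_of_int_vec n) V \<le> t \<Longrightarrow> cmod (x (u_pow n) - 1) \<le> \<delta>) \<Longrightarrow> x f = 1"
proof -
  obtain G T c where G: "finite G" "T \<ge> 0" "c > 0"
    "\<And>m. infdist (real_of_int_vec m) V > T \<Longrightarrow> \<exists>g\<in>G. 1 - g \<in> P \<and>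
       (\<forall>k\<in>keys g. infdist (real_of_int_vec (m + k)) V \<le> infdist (real_of_int_vec m) V - c)"
    using uniform_descent[OF V low] by blast
  obtain B where B: "B \<ge> 0" "\<And>g. g \<in> G \<Longrightarrow> l1_norm (to_complex g) \<le> B"
    by (rule finite_upper_bound[OF G(1), where f = "\<lambda>g. l1_norm (to_complex g)"]) (rule that)
  define C where "C = 1 + B"
  have C: "1 \<le> C" "g \<in> G \<Longrightarrow> l1_norm (to_complex g) \<le> C" for g
    using B(1) B(2)[of g] by (simp_all add: C_def)
  let ?D = "\<lambda>n. infdist (real_of_int_vec n) V"
  interpret bounded_descent P ?D T c G C
    by standard (use P G C in \<open>auto simp: real_of_int_vec_add infdist_subspace_add[OF V] subspace_0[OF V]\<close>)
  have "\<exists>h. keys h \<subseteq> {n. ?D n \<le> T} \<and> 1 - h \<in> complex_span P \<and> l1_norm h < \<epsilon>" if "\<epsilon> > 0" for \<epsilon>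
  proof (cases rule: small_or_character)
    case small
    then show ?thesis using that by blast
  next
    case (character \<phi> K)
    then show ?thesis using variety_point_of_character[OF V, of \<phi> P K] disj by blast
  qed
  \<comment> \<open>\<open>J\<close> descent steps lead from height \<open>2 * T\<close> back to
    \<open>T\<close>, at the cost \<open>C ^ J\<close>; the bound on \<open>h\<close> beats this
    cost by a factor of 2.\<close>
  moreover define J where "J = step_count (2 * T)"
  moreover have CJ: "C ^ J \<ge> 1" using C(1) by (rule one_le_power)
  ultimately obtain h where h: "keys h \<subseteq> {n. ?D n \<le> T}" "1 - h \<in> complex_span P"
    "l1_norm h < 1 / (2 * C ^ J)" by (metis divide_pos_pos mult_pos_pos zero_less_one zero_less_numeral order_less_le_trans)
  \<comment> \<open>These are the relations that have to hold exactly: that of \<open>h\<close>, and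
    those of the finitely many descent polynomials.\<close>
  define F where "F = insert (1 - h) ((\<lambda>g. to_complex (1 - g)) ` (G \<inter> {g. 1 - g \<in> P}))"
  have F: "finite F" "F \<subseteq> complex_span P"
    using G(1) h(2) to_complex_in_complex_span by (auto simp: F_def)
  obtain \<rho> \<eta> where \<rho>: "\<rho> \<ge> 0" and \<eta>: "\<eta> > 0" and exact:
    "\<And>y m g. (\<And>f. f \<in> P \<Longrightarrow> pairing y (to_complex f) \<in> \<int>) \<Longrightarrow>
       (\<And>k. norm (real_of_int_vec k) \<le> \<rho> \<Longrightarrow> \<bar>y (m + k)\<bar> \<le> \<eta>) \<Longrightarrow> g \<in> F \<Longrightarrow>
       pairing y (single m 1 * g) = 0"
    using integral_relations_exact[OF P_u_pow F] by blast
  \<comment> \<open>The relations in \<open>F\<close> are applied at exponents of height up to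
    \<open>s\<close>, and exactness of each depends on the angles within distance
    \<open>\<rho>\<close>; the final 1 in \<open>t\<close> keeps it positive.\<close>
  define s where "s = T + real J * c"
  define t where "t = s + \<rho> + 1"
  have s: "T \<le> s" "2 * T \<le> s" "s \<ge> 0"
    using G step_count[of "2 * T"] by (auto simp: s_def J_def)
  have t: "t > 0" using s \<rho> by (simp add: t_def)
  obtain \<delta> where \<delta>: "\<delta> > 0" "\<And>w. cmod (w - 1) \<le> \<delta> \<Longrightarrow> \<bar>Arg w\<bar> \<le> \<eta> * (2 * pi)"
    using small_Arg[of "\<eta> * (2 * pi)"] \<eta> by auto
  show ?thesis
  proof (rule that[OF \<delta>(1) t])
    fix x :: "'d laurent \<Rightarrow> complex" and f
    assume x: "\<And>f g. x (f + g) = x f * x g" "\<And>f. cmod (x f) = 1" "\<And>f. f \<in> P \<Longrightarrow> x f = 1"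
      and small: "\<And>n. ?D n \<le> t \<Longrightarrow> cmod (x (u_pow n) - 1) \<le> \<delta>"
    define y where "y n = Arg (x (u_pow n)) / (2 * pi)" for n
    have x_eq: "x f = exp (2 * of_real pi * \<i> * pairing y (to_complex f))" for f
      unfolding y_def by (rule character_eq_exp_pairing[OF x(1,2)])
    have int: "pairing y (to_complex f) \<in> \<int>" if "f \<in> P" for f
    proof -
      have "exp (2 * of_real pi * \<i> * pairing y (to_complex f)) = 1" using x_eq x(3)[OF that] by metis
      then obtain n :: int where "Im (pairing y (to_complex f)) = 0" "Re (pairing y (to_complex f)) = of_int n"
        by (auto simp: exp_eq_1)
      then have "pairing y (to_complex f) = of_int n" by (simp add: complex_eq_iff)
      then show ?thesis by simp
    qed
    have y_small: "\<bar>y n\<bar> \<le> \<eta>" if "?D n \<le> t" for n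
      using \<delta>(2)[OF small[OF that]] by (simp add: y_def abs_mult divide_le_eq)
    have rel: "pairing y (single m 1 * g) = 0" if "?D m \<le> s" "g \<in> F" for m g
    proof (rule exact[OF int _ that(2)])
      fix k :: "int ^ 'd" assume "norm (real_of_int_vec k) \<le> \<rho>"
      then have "?D (m + k) \<le> t"
        using ht_add[of m k] infdist_subspace_le_norm[OF V, of "real_of_int_vec k"] that(1) by (simp add: t_def)
      then show "\<bar>y (m + k)\<bar> \<le> \<eta>" by (rule y_small)
    qed
    define M where "M = (SUP m\<in>{m. ?D m \<le> T}. \<bar>y m\<bar>)"
    have M: "\<bar>y m\<bar> \<le> M" if "?D m \<le> T" for m
    proof -
      have "\<bar>y n\<bar> \<le> \<eta>" if "?D n \<le> T" for n
        using that s \<rho> by (intro y_small) (simp add: t_def)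
      then show ?thesis
        unfolding M_def using that by (intro cSUP_upper bdd_aboveI2[where M = \<eta>]) auto
    qed
    have M0: "0 \<le> M" using M[of 0] ht_zero T_nonneg by force
    \<comment> \<open>The induction stops at \<open>J\<close> because exactness of the relations is
      secured only up to height \<open>s\<close>.\<close>
    have grow: "\<bar>y m\<bar> \<le> C ^ j * M" if "j \<le> J" "?D m \<le> T + real j * c" for j m
      using that
    proof (induction j arbitrary: m)
      case 0
      then show ?case using M by simp
    next
      case (Suc j)
      show ?case
      proof (cases "?D m \<le> T")
        case True
        have "M \<le> C ^ Suc j * M" using C(1) M0 by (metis mult_left_mono mult.commute mult.right_neutral one_le_power)
        then show ?thesis using M[OF True] by simp
      next
        case False
        then obtain g where g: "g \<in> G" "1 - g \<in> P" "\<forall>k\<in>keys g. ?D (m + k) \<le> ?D m - c"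
          using descent[of m] by auto
        have "real (Suc j) * c \<le> real J * c" using Suc.prems(1) c_pos by (intro mult_right_mono) auto
        then have "?D m \<le> s" using Suc.prems(2) by (simp add: s_def)
        then have "pairing y (single m 1 * to_complex (1 - g)) = 0"
          using g by (intro rel) (auto simp: F_def)
        then have "of_real (y m) = pairing y (single m 1 * to_complex g)"
          by (simp add: to_complex_diff right_diff_distrib pairing_diff)
        then have "\<bar>y m\<bar> = cmod (pairing y (single m 1 * to_complex g))"
          by (metis norm_of_real)
        also have "\<dots> \<le> l1_norm (single m 1 * to_complex g) * (C ^ j * M)"
        proof (rule norm_pairing_le)
          fix k assume "k \<in> keys (single m 1 * to_complex g)"
          then obtain i where "i \<in> keys g" "k = m + i"
            using keys_single_times[of m 1 "to_complex g"] by auto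
          then show "\<bar>y k\<bar> \<le> C ^ j * M"
            using g(3) Suc.prems by (intro Suc.IH) (force simp: algebra_simps)+
        qed
        also have "\<dots> \<le> C * (C ^ j * M)"
          using l1_norm_mult[of "single m 1" "to_complex g"] C(2)[OF g(1)] C(1) M0
          by (intro mult_right_mono) auto
        finally show ?thesis by simp
      qed
    qed
    have half: "\<bar>y m\<bar> \<le> M / 2" if "?D m \<le> T" for m
    proof -
      have "pairing y (single m 1 * (1 - h)) = 0"
        using that s by (intro rel) (auto simp: F_def)
      then have "of_real (y m) = pairing y (single m 1 * h)"
        by (simp add: right_diff_distrib pairing_diff)
      then have "\<bar>y m\<bar> = cmod (pairing y (single m 1 * h))" by (metis norm_of_real)
      also have "\<dots> \<le> l1_norm (single m 1 * h) * (C ^ J * M)"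
      proof (rule norm_pairing_le)
        fix k assume "k \<in> keys (single m 1 * h)"
        then obtain i where "i \<in> keys h" "k = m + i"
          using keys_single_times[of m 1 h] by auto
        then have "?D k \<le> T + T" using ht_add[of m i] h(1) that by force
        then have "?D k \<le> T + real J * c" using s(2) by (simp add: s_def)
        then show "\<bar>y k\<bar> \<le> C ^ J * M" by (intro grow) simp_all
      qed
      also have "\<dots> \<le> 1 / (2 * C ^ J) * (C ^ J * M)"
        using l1_norm_mult[of "single m 1" h] h(3) CJ M0 by (intro mult_right_mono) auto
      also have "\<dots> = M / 2" using CJ C(1) by simp
      finally show ?thesis .
    qed
    have "M \<le> M / 2" unfolding M_def[of]
      using half ht_zero T_nonneg by (intro cSUP_least) (auto simp: M_def[symmetric] intro!: exI[of _ 0])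
    then have y0: "y m = 0" if "?D m \<le> T" for m using M[OF that] by simp
    show "x f = 1"
    proof -
      have nz: "x g \<noteq> 0" for g using x(2)[of g] by auto
      have "f \<in> {f. x f = 1}"
      proof (rule generated_by_low)
        show "P \<subseteq> {f. x f = 1}" using x(3) by auto
        show "f - g \<in> {f. x f = 1}" if "f \<in> {f. x f = 1}" "g \<in> {f. x f = 1}" for f g
          using x(1)[of "f - g" g] that by simp
        show "u_pow m \<in> {f. x f = 1}" if "?D m \<le> T" for m
          using x_eq[of "u_pow m"] y0[OF that] by simp
      qed
      then show ?thesis by simp
    qed
  qed
qed

section \<open>Characters separate subgroups\<close>

text \<open>Partial characters are encoded as graphs, so that extension is inclusion and a chain is
  bounded by its union.\<close>

definition (in comm_group) character_graph :: "('a \<times> complex) set \<Rightarrow> bool" where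
  "character_graph \<Gamma> \<longleftrightarrow> \<Gamma> \<subseteq> carrier G \<times> sphere 0 1 \<and> (\<one>, 1) \<in> \<Gamma> \<and>
     (\<forall>a z b w. (a, z) \<in> \<Gamma> \<longrightarrow> (b, w) \<in> \<Gamma> \<longrightarrow> (a \<otimes> b, z * w) \<in> \<Gamma>) \<and>
     (\<forall>a z. (a, z) \<in> \<Gamma> \<longrightarrow> (inv a, inverse z) \<in> \<Gamma>) \<and>
     (\<forall>a z w. (a, z) \<in> \<Gamma> \<longrightarrow> (a, w) \<in> \<Gamma> \<longrightarrow> z = w)"

context comm_group
begin

lemma character_graphD:
  assumes "character_graph \<Gamma>"
  shows "(a, z) \<in> \<Gamma> \<Longrightarrow> a \<in> carrier G" "(a, z) \<in> \<Gamma> \<Longrightarrow> cmod z = 1" "(a, z) \<in> \<Gamma> \<Longrightarrow> z \<noteq> 0" "(\<one>, 1) \<in> \<Gamma>"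
    "(a, z) \<in> \<Gamma> \<Longrightarrow> (b, w) \<in> \<Gamma> \<Longrightarrow> (a \<otimes> b, z * w) \<in> \<Gamma>"
    "(a, z) \<in> \<Gamma> \<Longrightarrow> (inv a, inverse z) \<in> \<Gamma>"
    "(a, z) \<in> \<Gamma> \<Longrightarrow> (a, w) \<in> \<Gamma> \<Longrightarrow> z = w"
  using assms unfolding character_graph_def by auto

lemma character_graph_pow:
  assumes "character_graph \<Gamma>" "(a, z) \<in> \<Gamma>"
  shows "(a [^] (k::int), z powi k) \<in> \<Gamma>"
proof -
  note D = character_graphD[OF assms(1)]
  have a: "a \<in> carrier G" using D(1) assms(2) .
  have nat: "(a [^] n, z ^ n) \<in> \<Gamma>" for n :: nat
  proof (induction n)
    case (Suc n)
    from D(5)[OF Suc assms(2)] show ?case by (simp add: mult.commute)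
  qed (simp add: D(4))
  show ?thesis
  proof (cases k rule: int_cases2)
    case (nonneg n)
    then show ?thesis using nat[of n] by (simp add: int_pow_int)
  next
    case (nonpos n)
    then show ?thesis using D(6)[OF nat[of n]] a by (simp add: int_pow_neg int_pow_int power_int_minus)
  qed
qed

text \<open>The value at \<open>c\<close> is constrained only by the powers of \<open>c\<close> in
  the domain. If the exponent 0 is the only one, every value is allowed; otherwise take an
  \<open>n\<close>-th root of the value at the least positive exponent \<open>n\<close>. For
  \<open>c\<close> outside the domain \<open>n \<ge> 2\<close>, so a root different from 1
  exists.\<close>

lemma character_graph_consistent_value:
  assumes \<Gamma>: "character_graph \<Gamma>" and c: "c \<in> carrier G"
  obtains \<zeta> where "cmod \<zeta> = 1" "\<And>k z. (c [^] (k::int), z) \<in> \<Gamma> \<Longrightarrow> z = \<zeta> powi k"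
    "c \<notin> fst ` \<Gamma> \<Longrightarrow> \<zeta> \<noteq> 1"
proof -
  note D = character_graphD[OF \<Gamma>]
  define I where "I = {k::int. c [^] k \<in> fst ` \<Gamma>}"
  show ?thesis
  proof (cases "\<exists>n::nat. n > 0 \<and> int n \<in> I")
    case False
    have I0: "k = 0" if k: "k \<in> I" for k
    proof (rule ccontr)
      assume "k \<noteq> 0"
      obtain z where "(c [^] k, z) \<in> \<Gamma>" using k by (auto simp: I_def)
      from D(6)[OF this] have "- k \<in> I" using c by (force simp: I_def int_pow_neg)
      then have "int (nat \<bar>k\<bar>) \<in> I" using k by (cases "k \<ge> 0") auto
      then show False using False \<open>k \<noteq> 0\<close> by (metis nat_0_iff abs_le_zero_iff gr0I)
    qed
    \<comment> \<open>No constraint beyond exponent 0 remains, so any value on the circle other than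
      1 serves.\<close>
    show ?thesis
    proof (rule that[of "- 1"])
      fix k z assume kz: "(c [^] (k::int), z) \<in> \<Gamma>"
      then have "k \<in> I" by (force simp: I_def)
      then have "k = 0" by (rule I0)
      then show "z = (- 1) powi k" using D(4,7) kz by simp
    qed auto
  next
    case True
    define n where "n = (LEAST n::nat. n > 0 \<and> int n \<in> I)"
    have n: "n > 0" "int n \<in> I" using LeastI_ex[OF True] by (auto simp: n_def)
    have least: "n \<le> m" if "m > 0" "int m \<in> I" for m
      unfolding n_def using that by (intro Least_le) auto
    obtain z0 where z0: "(c [^] int n, z0) \<in> \<Gamma>" using n by (auto simp: I_def)
    have z01: "cmod z0 = 1" using D(2)[OF z0] .
    have root: "\<exists>\<zeta>. cmod \<zeta> = 1 \<and> \<zeta> ^ n = z0 \<and> (n \<ge> 2 \<longrightarrow> \<zeta> \<noteq> 1)"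
    proof (cases "z0 = 1")
      case False
      have "cis (Arg z0 / n) ^ n = z0"
      proof -
        have "cis (Arg z0 / n) ^ n = cis (real n * (Arg z0 / n))" by (rule Complex.DeMoivre)
        also have "\<dots> = z0" using n z01 D(3)[OF z0] by (simp add: cis_Arg sgn_div_norm)
        finally show ?thesis .
      qed
      moreover from this have "cis (Arg z0 / n) \<noteq> 1" using False by auto
      ultimately show ?thesis by (intro exI[of _ "cis (Arg z0 / n)"]) simp
    next
      case True
      \<comment> \<open>Here 1 is itself an \<open>n\<close>-th root of \<open>z0\<close>; a
        primitive root of unity differs from it once \<open>n \<ge> 2\<close>.\<close>
      show ?thesis
      proof (intro exI[of _ "cis (2 * pi / n)"] conjI impI)
        have "cis (2 * pi / n) ^ n = cis (real n * (2 * pi / n))" by (rule Complex.DeMoivre)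
        then show "cis (2 * pi / n) ^ n = z0" using n True by simp
        assume "2 \<le> n"
        show "cis (2 * pi / n) \<noteq> 1"
        proof (cases "n = 2")
          case False
          then have "0 < 2 * pi / n" "2 * pi / n < pi" using \<open>2 \<le> n\<close> pi_gt_zero by (auto simp: field_simps)
          then have "sin (2 * pi / n) > 0" by (rule sin_gt_zero)
          then show ?thesis by (auto simp: complex_eq_iff)
        qed auto
      qed simp
    qed
    then obtain \<zeta> where \<zeta>: "cmod \<zeta> = 1" "\<zeta> ^ n = z0" "n \<ge> 2 \<Longrightarrow> \<zeta> \<noteq> 1" by blast
    have \<zeta>0: "\<zeta> \<noteq> 0" using \<zeta>(1) by auto
    show ?thesis
    proof (rule that[OF \<zeta>(1)])
      fix k z assume kz: "(c [^] (k::int), z) \<in> \<Gamma>"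
      \<comment> \<open>Division with remainder: the power \<open>c [^] r\<close> lies in the
        domain, and minimality of \<open>n\<close> forces \<open>r = 0\<close>.\<close>
      define q r where "q = k div int n" and "r = k mod int n"
      have k: "k = int n * q + r" by (simp add: q_def r_def)
      have q: "(c [^] (int n * q), z0 powi q) \<in> \<Gamma>"
        using character_graph_pow[OF \<Gamma> z0, of q] c by (simp add: int_pow_pow)
      have "(c [^] k \<otimes> inv (c [^] (int n * q)), z * inverse (z0 powi q)) \<in> \<Gamma>"
        using D(5)[OF kz D(6)[OF q]] .
      moreover have "c [^] k \<otimes> inv (c [^] (int n * q)) = c [^] r"
        using c by (simp add: k int_pow_diff[symmetric])
      ultimately have "r \<in> I" by (force simp: I_def)
      moreover have "0 \<le> r" "r < int n" using n by (simp_all add: r_def)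
      ultimately have "r = 0" using least[of "nat r"] by (cases "r = 0") auto
      then have "z = z0 powi q" using D(7)[OF kz] q k by simp
      also have "\<dots> = \<zeta> powi k" using \<open>r = 0\<close> \<zeta>0 by (simp add: k \<zeta>(2)[symmetric] power_int_mult)
      finally show "z = \<zeta> powi k" .
    next
      assume c': "c \<notin> fst ` \<Gamma>"
      have "n \<noteq> 1"
      proof
        assume "n = 1"
        then show False using n(2) c' c by (simp add: I_def)
      qed
      then show "\<zeta> \<noteq> 1" using n(1) by (intro \<zeta>(3)) simp
    qed
  qed
qed

text \<open>The new domain is generated by the old one and \<open>c\<close>. Two ways of writing an
  element of it differ by a power of \<open>c\<close> in the old domain, and there the chosen
  \<open>\<zeta>\<close> is consistent.\<close>

lemma character_graph_extend:
  assumes \<Gamma>: "character_graph \<Gamma>" and c: "c \<in> carrier G"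
  obtains \<Gamma>' \<zeta> where "character_graph \<Gamma>'" "\<Gamma> \<subseteq> \<Gamma>'" "(c, \<zeta>) \<in> \<Gamma>'" "c \<notin> fst ` \<Gamma> \<Longrightarrow> \<zeta> \<noteq> 1"
proof -
  note D = character_graphD[OF \<Gamma>]
  obtain \<zeta> where \<zeta>: "cmod \<zeta> = 1" "\<And>k z. (c [^] (k::int), z) \<in> \<Gamma> \<Longrightarrow> z = \<zeta> powi k"
    "c \<notin> fst ` \<Gamma> \<Longrightarrow> \<zeta> \<noteq> 1"
    using character_graph_consistent_value[OF \<Gamma> c] by blast
  have \<zeta>0: "\<zeta> \<noteq> 0" using \<zeta>(1) by auto
  define \<Gamma>' where "\<Gamma>' = {(a \<otimes> c [^] k, z * \<zeta> powi k) | a z (k::int). (a, z) \<in> \<Gamma>}"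
  have I: "(a \<otimes> c [^] k, z * \<zeta> powi k) \<in> \<Gamma>'" if "(a, z) \<in> \<Gamma>" for a z and k :: int
    using that unfolding \<Gamma>'_def by blast
  have sub: "\<Gamma> \<subseteq> \<Gamma>'"
  proof
    fix p assume "p \<in> \<Gamma>"
    then show "p \<in> \<Gamma>'" using I[of "fst p" "snd p" 0] D(1)[of "fst p" "snd p"] by simp
  qed
  have "character_graph \<Gamma>'"
    unfolding character_graph_def
  proof (intro conjI allI impI)
    show "\<Gamma>' \<subseteq> carrier G \<times> sphere 0 1"
      using D(1,2) c \<zeta>(1) by (auto simp: \<Gamma>'_def norm_mult norm_power_int)
    show "(\<one>, 1) \<in> \<Gamma>'" using D(4) sub by blast
    fix a z assume "(a, z) \<in> \<Gamma>'"
    then obtain a' z' and k :: int where a: "a = a' \<otimes> c [^] k" "z = z' * \<zeta> powi k" "(a', z') \<in> \<Gamma>"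
      by (auto simp: \<Gamma>'_def)
    have a'c: "a' \<in> carrier G" using D(1)[OF a(3)] .
    show "(inv a, inverse z) \<in> \<Gamma>'"
      using I[OF D(6)[OF a(3)], of "- k"] a'c c \<zeta>0
      by (simp add: a int_pow_neg inv_mult power_int_minus)
    fix b w assume "(b, w) \<in> \<Gamma>'"
    then obtain b' w' and l :: int where b: "b = b' \<otimes> c [^] l" "w = w' * \<zeta> powi l" "(b', w') \<in> \<Gamma>"
      by (auto simp: \<Gamma>'_def)
    have b'c: "b' \<in> carrier G" using D(1)[OF b(3)] .
    show "(a \<otimes> b, z * w) \<in> \<Gamma>'"
      using I[OF D(5)[OF a(3) b(3)], of "k + l"] a'c b'c c \<zeta>0
      by (simp add: a b int_pow_mult power_int_add m_ac mult_ac)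
  next
    fix a z w assume az: "(a, z) \<in> \<Gamma>'" and aw: "(a, w) \<in> \<Gamma>'"
    obtain a' z' and k :: int where a: "a = a' \<otimes> c [^] k" "z = z' * \<zeta> powi k" "(a', z') \<in> \<Gamma>"
      using az unfolding \<Gamma>'_def by blast
    obtain b' w' and l :: int where b: "a = b' \<otimes> c [^] l" "w = w' * \<zeta> powi l" "(b', w') \<in> \<Gamma>"
      using aw unfolding \<Gamma>'_def by blast
    have ab: "a' \<in> carrier G" "b' \<in> carrier G" using D(1) a(3) b(3) by auto
    have "c [^] (l - k) = inv (c [^] k) \<otimes> c [^] l"
      using c by (simp add: int_pow_diff m_comm)
    also have "\<dots> = inv (c [^] k) \<otimes> (inv b' \<otimes> (b' \<otimes> c [^] l))"
      using ab c by (simp add: m_assoc[symmetric])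
    also have "b' \<otimes> c [^] l = a' \<otimes> c [^] k" using a(1) b(1) by simp
    also have "inv (c [^] k) \<otimes> (inv b' \<otimes> (a' \<otimes> c [^] k)) = (inv (c [^] k) \<otimes> c [^] k) \<otimes> (a' \<otimes> inv b')"
      using ab c by (simp only: m_ac int_pow_closed inv_closed m_closed)
    also have "\<dots> = a' \<otimes> inv b'" using ab c by simp
    finally have "(c [^] (l - k), z' * inverse w') \<in> \<Gamma>"
      using D(5)[OF a(3) D(6)[OF b(3)]] by simp
    then have "z' * inverse w' = \<zeta> powi (l - k)" by (rule \<zeta>(2))
    then have "z' / w' = \<zeta> powi l / \<zeta> powi k" using \<zeta>0 by (simp add: power_int_diff divide_inverse)
    then show "z = w" using \<zeta>0 D(3)[OF b(3)] by (simp add: a b frac_eq_eq mult.commute)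
  qed
  moreover have "(c, \<zeta>) \<in> \<Gamma>'" using I[OF D(4), of 1] c by simp
  ultimately show ?thesis using that sub \<zeta>(3) by blast
qed

text \<open>The trivial character on \<open>H\<close> is first extended to \<open>b\<close> with a
  value other than 1 and only then, by Zorn's lemma above \<open>\<Gamma>1\<close>, to the whole
  group, which preserves that value.\<close>

theorem character_separates_subgroup:
  assumes H: "subgroup H G" and b: "b \<in> carrier G" "b \<notin> H"
  obtains x :: "'a \<Rightarrow> complex"
  where "\<And>a. a \<in> carrier G \<Longrightarrow> cmod (x a) = 1"
    "\<And>a c. a \<in> carrier G \<Longrightarrow> c \<in> carrier G \<Longrightarrow> x (a \<otimes> c) = x a * x c"
    "\<And>h. h \<in> H \<Longrightarrow> x h = 1" "x b \<noteq> 1"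
proof -
  have "character_graph (H \<times> {1})"
    using subgroup.one_closed[OF H] subgroup.m_closed[OF H] subgroup.m_inv_closed[OF H] subgroup.subset[OF H]
    by (auto simp: character_graph_def)
  moreover have "b \<notin> fst ` (H \<times> {1::complex})" using b by auto
  ultimately obtain \<Gamma>1 \<zeta> where \<Gamma>1: "character_graph \<Gamma>1" "H \<times> {1} \<subseteq> \<Gamma>1" "(b, \<zeta>) \<in> \<Gamma>1" "\<zeta> \<noteq> 1"
    using character_graph_extend[OF _ b(1)] by metis
  let ?A = "{\<Gamma>. character_graph \<Gamma> \<and> \<Gamma>1 \<subseteq> \<Gamma>}"
  have "\<exists>\<Gamma>\<in>?A. \<forall>W\<in>?A. \<Gamma> \<subseteq> W \<longrightarrow> W = \<Gamma>"
  proof (rule subset_Zorn_nonempty)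
    show "?A \<noteq> {}" using \<Gamma>1 by blast
    fix \<C> assume ne: "\<C> \<noteq> {}" and chain: "subset.chain ?A \<C>"
    then have C: "\<And>\<Gamma>. \<Gamma> \<in> \<C> \<Longrightarrow> character_graph \<Gamma> \<and> \<Gamma>1 \<subseteq> \<Gamma>"
      and tot: "\<And>W Y. W \<in> \<C> \<Longrightarrow> Y \<in> \<C> \<Longrightarrow> W \<subseteq> Y \<or> Y \<subseteq> W"
      by (auto simp: subset_chain_def)
    have two: "\<exists>W\<in>\<C>. p \<in> W \<and> q \<in> W" if pq: "p \<in> \<Union>\<C>" "q \<in> \<Union>\<C>" for p q
    proof -
      obtain Y1 Y2 where Y: "Y1 \<in> \<C>" "p \<in> Y1" "Y2 \<in> \<C>" "q \<in> Y2" using pq by blast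
      from tot[OF Y(1,3)] show ?thesis using Y by blast
    qed
    have "character_graph (\<Union>\<C>)"
      unfolding character_graph_def
    proof (intro conjI allI impI)
      show "\<Union>\<C> \<subseteq> carrier G \<times> sphere 0 1"
      proof (rule Union_least)
        fix Y assume "Y \<in> \<C>"
        then show "Y \<subseteq> carrier G \<times> sphere 0 1" using C[of Y] by (simp add: character_graph_def)
      qed
      show "(\<one>, 1) \<in> \<Union>\<C>" using C ne by (auto simp: character_graph_def)
      show "(inv a, inverse z) \<in> \<Union>\<C>" if "(a, z) \<in> \<Union>\<C>" for a z
        using that C character_graphD(6) by blast
      show "(a \<otimes> c, z * w) \<in> \<Union>\<C>" if "(a, z) \<in> \<Union>\<C>" "(c, w) \<in> \<Union>\<C>" for a z c w
        using two[OF that] C character_graphD(5) by blast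
      show "z = w" if "(a, z) \<in> \<Union>\<C>" "(a, w) \<in> \<Union>\<C>" for a z w
        using two[OF that] C character_graphD(7) by blast
    qed
    then show "\<Union>\<C> \<in> ?A" using C ne by auto
  qed
  then obtain \<Gamma> where \<Gamma>: "character_graph \<Gamma>" "\<Gamma>1 \<subseteq> \<Gamma>"
    and max: "\<And>W. character_graph W \<Longrightarrow> \<Gamma> \<subseteq> W \<Longrightarrow> W = \<Gamma>" by auto
  note D = character_graphD[OF \<Gamma>(1)]
  have dom: "\<exists>z. (a, z) \<in> \<Gamma>" if "a \<in> carrier G" for a
    using character_graph_extend[OF \<Gamma>(1) that] max by metis
  define x where "x a = (THE z. (a, z) \<in> \<Gamma>)" for a
  have x: "x a = z" if "(a, z) \<in> \<Gamma>" for a z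
    unfolding x_def using that D(7) by blast
  have x': "(a, x a) \<in> \<Gamma>" if "a \<in> carrier G" for a using dom[OF that] x by metis
  show ?thesis
  proof
    show "cmod (x a) = 1" if "a \<in> carrier G" for a using D(2)[OF x'[OF that]] .
    show "x (a \<otimes> c) = x a * x c" if "a \<in> carrier G" "c \<in> carrier G" for a c
      using D(5)[OF x'[OF that(1)] x'[OF that(2)]] by (rule x)
    show "x h = 1" if "h \<in> H" for h using \<Gamma>(2) \<Gamma>1(2) that by (intro x) auto
    show "x b \<noteq> 1" using x \<Gamma>(2) \<Gamma>1(3,4) by blast
  qed
qed

end

section \<open>Noetherian modules\<close>

context module
begin

abbreviation scale :: "'a \<Rightarrow> 'c \<Rightarrow> 'c" (infixl \<open>\<star>\<close> 70) where
  "r \<star> x \<equiv> r \<odot>\<^bsub>M\<^esub> x"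

definition colon :: "'c set \<Rightarrow> 'c \<Rightarrow> 'a set" where
  "colon N m = {r \<in> carrier R. r \<star> m \<in> N}"

definition add_cyclic :: "'c set \<Rightarrow> 'c \<Rightarrow> 'c set" where
  "add_cyclic N m = {n \<oplus>\<^bsub>M\<^esub> r \<star> m | n r. n \<in> N \<and> r \<in> carrier R}"

lemma submodule_zero_mem: "submodule N R M \<Longrightarrow> \<zero>\<^bsub>M\<^esub> \<in> N"
  using subgroup.one_closed[OF submodule.axioms(1)] by fastforce

lemma submodule_zero: "submodule {\<zero>\<^bsub>M\<^esub>} R M"
  by (rule submoduleI) auto

lemma submodule_carrier: "submodule (carrier M) R M"
  by (rule submoduleI) auto

lemma add_cyclic:
  assumes N: "submodule N R M" and m: "m \<in> carrier M"
  shows "submodule (add_cyclic N m) R M" "N \<subseteq> add_cyclic N m" "m \<in> add_cyclic N m"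
proof -
  note E = submoduleE[OF N] submodule_zero_mem[OF N]
  have NM: "n \<in> carrier M" if "n \<in> N" for n using E(1) that by blast
  show "N \<subseteq> add_cyclic N m"
  proof
    fix n assume n: "n \<in> N"
    then have "n = n \<oplus>\<^bsub>M\<^esub> \<zero> \<star> m" using m NM by simp
    then show "n \<in> add_cyclic N m" using n unfolding add_cyclic_def by blast
  qed
  have "m = \<zero>\<^bsub>M\<^esub> \<oplus>\<^bsub>M\<^esub> \<one> \<star> m" using m by simp
  then show "m \<in> add_cyclic N m" using E(7) unfolding add_cyclic_def by blast
  show "submodule (add_cyclic N m) R M"
  proof (rule submoduleI)
    show "add_cyclic N m \<subseteq> carrier M" using NM m by (auto simp: add_cyclic_def)
    show "\<zero>\<^bsub>M\<^esub> \<in> add_cyclic N m" using E(7) \<open>N \<subseteq> add_cyclic N m\<close> by blast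
    fix a assume "a \<in> add_cyclic N m"
    then obtain n r where a: "a = n \<oplus>\<^bsub>M\<^esub> r \<star> m" "n \<in> N" "r \<in> carrier R" by (auto simp: add_cyclic_def)
    have "\<ominus>\<^bsub>M\<^esub> a = \<ominus>\<^bsub>M\<^esub> n \<oplus>\<^bsub>M\<^esub> (\<ominus> r) \<star> m"
      using a NM m by (simp add: M.minus_add smult_l_minus)
    then show "\<ominus>\<^bsub>M\<^esub> a \<in> add_cyclic N m" using a E(3) unfolding add_cyclic_def by blast
    show "s \<star> a \<in> add_cyclic N m" if s: "s \<in> carrier R" for s
    proof -
      have "s \<star> a = s \<star> n \<oplus>\<^bsub>M\<^esub> (s \<otimes> r) \<star> m"
        using a NM m s by (simp add: smult_r_distr smult_assoc1)
      then show ?thesis using a s E(4) unfolding add_cyclic_def by blast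
    qed
    fix b assume "b \<in> add_cyclic N m"
    then obtain n' r' where b: "b = n' \<oplus>\<^bsub>M\<^esub> r' \<star> m" "n' \<in> N" "r' \<in> carrier R" by (auto simp: add_cyclic_def)
    have "a \<oplus>\<^bsub>M\<^esub> b = (n \<oplus>\<^bsub>M\<^esub> n') \<oplus>\<^bsub>M\<^esub> (r \<oplus> r') \<star> m"
      using a b NM m by (simp add: smult_l_distr M.a_ac)
    then show "a \<oplus>\<^bsub>M\<^esub> b \<in> add_cyclic N m" using a b E(5) R.a_closed unfolding add_cyclic_def by blast
  qed
qed

lemma submodule_preimage_smult:
  assumes N: "submodule N R M" and s: "s \<in> carrier R"
  shows "submodule {x \<in> carrier M. s \<star> x \<in> N} R M"
proof (rule submoduleI)
  note E = submoduleE[OF N] submodule_zero_mem[OF N]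
  show "\<zero>\<^bsub>M\<^esub> \<in> {x \<in> carrier M. s \<star> x \<in> N}" using E(7) s by simp
  show "\<ominus>\<^bsub>M\<^esub> a \<in> {x \<in> carrier M. s \<star> x \<in> N}" if "a \<in> {x \<in> carrier M. s \<star> x \<in> N}" for a
    using that E(3) s by (simp add: smult_r_minus)
  show "a \<oplus>\<^bsub>M\<^esub> b \<in> {x \<in> carrier M. s \<star> x \<in> N}"
    if "a \<in> {x \<in> carrier M. s \<star> x \<in> N}" "b \<in> {x \<in> carrier M. s \<star> x \<in> N}" for a b
    using that E(5) s by (simp add: smult_r_distr)
  show "r \<star> x \<in> {x \<in> carrier M. s \<star> x \<in> N}"
    if "r \<in> carrier R" "x \<in> {x \<in> carrier M. s \<star> x \<in> N}" for r x
    using that E(4)[of r "s \<star> x"] s by (simp add: smult_assoc1[symmetric] R.m_comm)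
qed auto

lemma noetherian_finitely_generated:
  assumes "noetherian_module R M" "submodule N R M"
  obtains A where "finite A" "A \<subseteq> N" "N = \<Inter>{N'. submodule N' R M \<and> A \<subseteq> N'}"
proof -
  have "\<forall>N. submodule N R M \<longrightarrow> (\<exists>A. finite A \<and> A \<subseteq> N \<and> N = \<Inter>{N'. submodule N' R M \<and> A \<subseteq> N'})"
    using assms(1) unfolding noetherian_module_def by (rule conjunct2)
  with assms(2) have "\<exists>A. finite A \<and> A \<subseteq> N \<and> N = \<Inter>{N'. submodule N' R M \<and> A \<subseteq> N'}" by simp
  then show ?thesis using that by (elim exE conjE)
qed

text \<open>Finite generation as a maximum condition: a finite generating set of the union of a
  chain lies in a single member.\<close>

lemma noetherian_maximal:
  assumes M: "noetherian_module R M" and \<N>: "\<N> \<noteq> {}" "\<And>N. N \<in> \<N> \<Longrightarrow> submodule N R M"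
  obtains N where "N \<in> \<N>" "\<And>W. W \<in> \<N> \<Longrightarrow> N \<subseteq> W \<Longrightarrow> W = N"
proof -
  have "\<exists>N\<in>\<N>. \<forall>W\<in>\<N>. N \<subseteq> W \<longrightarrow> W = N"
  proof (rule subset_Zorn_nonempty[OF \<N>(1)])
    fix \<C> assume ne: "\<C> \<noteq> {}" and chain: "subset.chain \<N> \<C>"
    then have C: "\<And>N. N \<in> \<C> \<Longrightarrow> N \<in> \<N>"
      and tot: "\<And>W Y. W \<in> \<C> \<Longrightarrow> Y \<in> \<C> \<Longrightarrow> W \<subseteq> Y \<or> Y \<subseteq> W"
      by (auto simp: subset_chain_def)
    note E = submoduleE[OF \<N>(2)[OF C]] submodule_zero_mem[OF \<N>(2)[OF C]]
    have "submodule (\<Union>\<C>) R M"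
    proof (rule submoduleI)
      show "\<Union>\<C> \<subseteq> carrier M" using E(1) by blast
      show "\<zero>\<^bsub>M\<^esub> \<in> \<Union>\<C>" using E(7) ne by blast
      show "\<ominus>\<^bsub>M\<^esub> a \<in> \<Union>\<C>" if "a \<in> \<Union>\<C>" for a using that E(3) by blast
      show "r \<star> a \<in> \<Union>\<C>" if "r \<in> carrier R" "a \<in> \<Union>\<C>" for r a using that E(4) by blast
      show "a \<oplus>\<^bsub>M\<^esub> b \<in> \<Union>\<C>" if ab: "a \<in> \<Union>\<C>" "b \<in> \<Union>\<C>" for a b
      proof -
        obtain N where "N \<in> \<C>" "a \<in> N" "b \<in> N" using ab tot by blast
        then show ?thesis using E(5) by blast
      qed
    qed
    then obtain A where A: "finite A" "A \<subseteq> \<Union>\<C>" "\<Union>\<C> = \<Inter>{N'. submodule N' R M \<and> A \<subseteq> N'}"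
      by (rule noetherian_finitely_generated[OF M])
    obtain N where N: "N \<in> \<C>" "A \<subseteq> N"
      using finite_subset_Union_chain[OF A(1,2) ne chain] by blast
    then have "\<Union>\<C> \<subseteq> N" using A(3) \<N>(2) C by blast
    then have "\<Union>\<C> = N" using N(1) by blast
    then show "\<Union>\<C> \<in> \<N>" using C N(1) by simp
  qed
  then show ?thesis using that by blast
qed

text \<open>
  Taking \<open>S = {1}\<close> gives an associated prime of \<open>M / N\<close>, and taking \<open>S\<close> to be the complement of
  a prime containing the colon ideal gives one that is contained in this prime.
\<close>

lemma exists_prime_colon:
  assumes M: "noetherian_module R M" and N: "submodule N R M" and m: "m \<in> carrier M"
    and S: "\<one> \<in> S" "S \<subseteq> carrier R" "\<And>a b. a \<in> S \<Longrightarrow> b \<in> S \<Longrightarrow> a \<otimes> b \<in> S"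
    and disj: "colon N m \<inter> S = {}"
  obtains s where "s \<in> carrier R" "primeideal (colon N (s \<star> m)) R" "colon N (s \<star> m) \<inter> S = {}"
proof -
  note E = submoduleE[OF N] submodule_zero_mem[OF N]
  have NM: "n \<in> carrier M" if "n \<in> N" for n using E(1) that by blast
  \<comment> \<open>No chain condition on \<open>R\<close> is assumed. The submodule
    \<open>K s\<close>, the colon ideal of \<open>s \<star> m\<close> applied to \<open>m\<close>,
    stands in for that ideal, and the chain condition on \<open>M\<close> provides a maximal
    one.\<close>
  define K where "K s = {r \<star> m | r. r \<in> carrier R \<and> r \<star> (s \<star> m) \<in> N}" for s
  define T where "T = {s \<in> carrier R. colon N (s \<star> m) \<inter> S = {}}"
  have K: "submodule (K s) R M" if s: "s \<in> carrier R" for s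
  proof (rule submoduleI)
    show "K s \<subseteq> carrier M" using m by (auto simp: K_def)
    show "\<zero>\<^bsub>M\<^esub> \<in> K s" using m s E(7) by (auto simp: K_def intro!: exI[of _ \<zero>])
    fix a assume "a \<in> K s"
    then obtain r where r: "a = r \<star> m" "r \<in> carrier R" "r \<star> (s \<star> m) \<in> N" by (auto simp: K_def)
    show "\<ominus>\<^bsub>M\<^esub> a \<in> K s" unfolding K_def
      using r m s E(3)[OF r(3)] by (auto intro!: exI[of _ "\<ominus> r"] simp: smult_l_minus)
    show "t \<star> a \<in> K s" if "t \<in> carrier R" for t unfolding K_def
      using r m s that E(4)[OF that r(3)] by (auto intro!: exI[of _ "t \<otimes> r"] simp: smult_assoc1)
    fix b assume "b \<in> K s"
    then obtain q where q: "b = q \<star> m" "q \<in> carrier R" "q \<star> (s \<star> m) \<in> N" by (auto simp: K_def)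
    show "a \<oplus>\<^bsub>M\<^esub> b \<in> K s" unfolding K_def
      using r q m s E(5)[OF r(3) q(3)] by (auto intro!: exI[of _ "r \<oplus> q"] simp: smult_l_distr)
  qed
  have "\<one> \<in> T" using disj m by (simp add: T_def)
  then have "K ` T \<noteq> {}" by blast
  moreover have "submodule W R M" if "W \<in> K ` T" for W using that K by (auto simp: T_def)
  ultimately obtain W where W: "W \<in> K ` T" "\<And>Y. Y \<in> K ` T \<Longrightarrow> W \<subseteq> Y \<Longrightarrow> Y = W"
    using noetherian_maximal[OF M, of "K ` T"] by metis
  then obtain s where s: "s \<in> T" "W = K s" by blast
  have sR: "s \<in> carrier R" and sS: "colon N (s \<star> m) \<inter> S = {}" using s by (auto simp: T_def)
  let ?P = "colon N (s \<star> m)"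
  \<comment> \<open>Maximality turns \<open>K s \<subseteq> K (t \<otimes> s)\<close> into equality,
    so \<open>b \<star> m\<close> equals \<open>r \<star> m\<close> with \<open>r\<close> in
    \<open>?P\<close>; multiplying by \<open>s\<close> puts \<open>b\<close> into
    \<open>?P\<close>.\<close>
  have enlarge: "b \<in> ?P" if t: "t \<in> carrier R" "t \<otimes> s \<in> T" and b: "b \<in> carrier R" "b \<star> ((t \<otimes> s) \<star> m) \<in> N"
    for t b
  proof -
    have "K s \<subseteq> K (t \<otimes> s)"
    proof
      fix x assume "x \<in> K s"
      then obtain r where r: "x = r \<star> m" "r \<in> carrier R" "r \<star> (s \<star> m) \<in> N" by (auto simp: K_def)
      have "r \<star> ((t \<otimes> s) \<star> m) = t \<star> (r \<star> (s \<star> m))"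
        using r t m sR by (simp add: smult_assoc1[symmetric] R.m_ac)
      then show "x \<in> K (t \<otimes> s)" using r t E(4) unfolding K_def by auto
    qed
    then have "K (t \<otimes> s) = K s" using W(2) s t by blast
    moreover have "b \<star> m \<in> K (t \<otimes> s)" using b unfolding K_def by blast
    ultimately obtain r where r: "b \<star> m = r \<star> m" "r \<in> carrier R" "r \<star> (s \<star> m) \<in> N"
      unfolding K_def by blast
    have "b \<star> (s \<star> m) = s \<star> (b \<star> m)"
      using b m sR by (simp add: smult_assoc1[symmetric] R.m_comm)
    also have "\<dots> = r \<star> (s \<star> m)"
      using r m sR by (simp add: smult_assoc1[symmetric] R.m_comm)
    finally show ?thesis using b r by (simp add: colon_def)
  qed
  have "ideal ?P R"
  proof (rule idealI)
    show "subgroup ?P (add_monoid R)"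
    proof (rule R.add.subgroupI)
      show "?P \<noteq> {}" using E(7) m sR by (auto simp: colon_def intro!: exI[of _ \<zero>])
    qed (use m sR E(3,5) in \<open>auto simp: colon_def smult_l_distr smult_l_minus a_inv_def[symmetric]\<close>)
    show "x \<otimes> a \<in> ?P" "a \<otimes> x \<in> ?P" if "a \<in> ?P" "x \<in> carrier R" for a x
    proof -
      have "x \<otimes> a \<in> ?P" using that m sR E(4) by (auto simp: colon_def smult_assoc1)
      then show "x \<otimes> a \<in> ?P" "a \<otimes> x \<in> ?P" using that by (simp_all add: colon_def R.m_comm)
    qed
  qed (rule R.ring_axioms)
  moreover have "carrier R \<noteq> ?P" using S(1,2) sS by blast
  moreover have "a \<in> ?P \<or> b \<in> ?P" if a: "a \<in> carrier R" and b: "b \<in> carrier R" and ab: "a \<otimes> b \<in> ?P" for a b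
  proof (cases "colon N ((a \<otimes> s) \<star> m) \<inter> S = {}")
    case True
    then have "a \<otimes> s \<in> T" using a sR by (simp add: T_def)
    moreover have "b \<star> ((a \<otimes> s) \<star> m) \<in> N"
      using ab a b m sR by (simp add: colon_def smult_assoc1[symmetric] R.m_ac)
    ultimately show ?thesis using enlarge[OF a _ b] by blast
  next
    case False
    \<comment> \<open>Some \<open>c\<close> in \<open>S\<close> sends
      \<open>(a \<otimes> s) \<star> m\<close> into \<open>N\<close>. Closure of \<open>S\<close>
      under products keeps \<open>c \<otimes> s\<close> in \<open>T\<close>, and now
      \<open>a\<close> plays the part of \<open>b\<close> in \<open>enlarge\<close>.\<close>
    then obtain c where c: "c \<in> S" "c \<star> ((a \<otimes> s) \<star> m) \<in> N" by (auto simp: colon_def)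
    have cR: "c \<in> carrier R" using c S by blast
    have "colon N ((c \<otimes> s) \<star> m) \<inter> S = {}"
    proof (rule ccontr)
      assume "colon N ((c \<otimes> s) \<star> m) \<inter> S \<noteq> {}"
      then obtain r where r: "r \<in> S" "r \<in> carrier R" "r \<star> ((c \<otimes> s) \<star> m) \<in> N" by (auto simp: colon_def)
      then have "r \<otimes> c \<in> ?P" using cR m sR by (simp add: colon_def smult_assoc1[symmetric] R.m_assoc)
      then show False using S(3)[OF r(1) c(1)] sS by blast
    qed
    then have "c \<otimes> s \<in> T" using cR sR by (simp add: T_def)
    moreover have "a \<star> ((c \<otimes> s) \<star> m) \<in> N"
      using c(2) a cR m sR by (simp add: smult_assoc1[symmetric] R.m_ac)
    ultimately show ?thesis using enlarge[OF cR _ a] by blast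
  qed
  ultimately have "primeideal ?P R"
    by (intro primeidealI) (auto simp: R.is_cring)
  then show ?thesis using that sR sS by blast
qed

text \<open>The product of elements that work for finitely many generators works for the whole
  module, since the elements that \<open>s\<close> sends into \<open>N\<close> form a
  submodule.\<close>

lemma annihilated_by_multiplicative_set:
  assumes M: "noetherian_module R M" and N: "submodule N R M"
    and S: "\<one> \<in> S" "S \<subseteq> carrier R" "\<And>a b. a \<in> S \<Longrightarrow> b \<in> S \<Longrightarrow> a \<otimes> b \<in> S"
    and ann: "\<And>a. a \<in> carrier M \<Longrightarrow> \<exists>s\<in>S. s \<star> a \<in> N"
  shows "\<exists>s\<in>S. \<forall>x\<in>carrier M. s \<star> x \<in> N"
proof -
  obtain A where A: "finite A" "A \<subseteq> carrier M" "carrier M = \<Inter>{N'. submodule N' R M \<and> A \<subseteq> N'}"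
    using noetherian_finitely_generated[OF M submodule_carrier] .
  have "\<exists>s\<in>S. \<forall>x\<in>A. s \<star> x \<in> N"
    using A(1,2)
  proof (induction A rule: finite_induct)
    case empty
    then show ?case using S(1) by blast
  next
    case (insert a A)
    then obtain s t where s: "s \<in> S" "\<forall>x\<in>A. s \<star> x \<in> N" and t: "t \<in> S" "t \<star> a \<in> N"
      using ann[of a] by auto
    have R: "s \<in> carrier R" "t \<in> carrier R" using s t S by auto
    have "(s \<otimes> t) \<star> x \<in> N" if "x \<in> insert a A" for x
    proof -
      have x: "x \<in> carrier M" using insert.prems that by blast
      have "(s \<otimes> t) \<star> x = s \<star> (t \<star> x)" "(s \<otimes> t) \<star> x = t \<star> (s \<star> x)"
        using x R by (simp_all add: smult_assoc1[symmetric] R.m_comm)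
      then show ?thesis using that s t R submoduleE(4)[OF N] by (metis insertE)
    qed
    then show ?case using S(3) s(1) t(1) by blast
  qed
  then obtain s where s: "s \<in> S" "\<forall>x\<in>A. s \<star> x \<in> N" by blast
  have "A \<subseteq> {x \<in> carrier M. s \<star> x \<in> N}" using s A(2) by blast
  moreover have "submodule {x \<in> carrier M. s \<star> x \<in> N} R M"
    using s S by (intro submodule_preimage_smult N) blast
  ultimately have "carrier M \<subseteq> {x \<in> carrier M. s \<star> x \<in> N}" using A(3) by blast
  then show ?thesis using s(1) by blast
qed

text \<open>
  Up to the multiplicative set \<open>S\<close>, the quotient \<open>M / N\<close> found here is cyclic and nonzero; this
  substitutes for localization and Nakayama's lemma.
\<close>

lemma cyclic_quotient_up_to_multiplicative_set:
  assumes M: "noetherian_module R M"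
    and S: "\<one> \<in> S" "S \<subseteq> carrier R" "\<And>a b. a \<in> S \<Longrightarrow> b \<in> S \<Longrightarrow> a \<otimes> b \<in> S"
    and ann: "\<And>s. s \<in> S \<Longrightarrow> \<exists>x\<in>carrier M. s \<star> x \<noteq> \<zero>\<^bsub>M\<^esub>"
  obtains N a D where "submodule N R M" "a \<in> carrier M" "D \<in> S"
    "\<And>x. x \<in> carrier M \<Longrightarrow> \<exists>n\<in>N. \<exists>r\<in>carrier R. D \<star> x = n \<oplus>\<^bsub>M\<^esub> r \<star> a"
    "\<And>s. s \<in> S \<Longrightarrow> s \<star> a \<notin> N"
proof -
  \<comment> \<open>A maximal \<open>N\<close> is sought such that no element of \<open>S\<close>
    annihilates \<open>M / N\<close>. Then some \<open>a\<close> survives all of \<open>S\<close>,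
    and enlarging \<open>N\<close> by \<open>a\<close> makes the quotient killed by a single
    \<open>D\<close>.\<close>
  define \<N> where "\<N> = {N. submodule N R M \<and> (\<forall>s\<in>S. \<exists>x\<in>carrier M. s \<star> x \<notin> N)}"
  have "{\<zero>\<^bsub>M\<^esub>} \<in> \<N>" using ann submodule_zero by (auto simp: \<N>_def)
  then obtain N where N: "N \<in> \<N>" "\<And>W. W \<in> \<N> \<Longrightarrow> N \<subseteq> W \<Longrightarrow> W = N"
    using noetherian_maximal[OF M, of \<N>] unfolding \<N>_def by blast
  have sub: "submodule N R M" using N by (simp add: \<N>_def)
  have "\<exists>a\<in>carrier M. \<forall>s\<in>S. s \<star> a \<notin> N"
    using annihilated_by_multiplicative_set[OF M sub S] N(1) unfolding \<N>_def by blast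
  then obtain a where a: "a \<in> carrier M" "\<And>s. s \<in> S \<Longrightarrow> s \<star> a \<notin> N" by blast
  have "a \<notin> N" using a S(1) by force
  then have "add_cyclic N a \<notin> \<N>" using N(2) add_cyclic[OF sub a(1)] by blast
  then obtain D where "D \<in> S" "\<And>x. x \<in> carrier M \<Longrightarrow> D \<star> x \<in> add_cyclic N a"
    using add_cyclic(1)[OF sub a(1)] by (auto simp: \<N>_def)
  then have "\<exists>n\<in>N. \<exists>r\<in>carrier R. D \<star> x = n \<oplus>\<^bsub>M\<^esub> r \<star> a" if "x \<in> carrier M" for x
    using that unfolding add_cyclic_def by blast
  then show ?thesis using that[OF sub a(1) \<open>D \<in> S\<close>] a(2) by simp
qed

lemma associated_prime_below:
  assumes M: "noetherian_module R M" and m: "m \<in> carrier M"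
    and Q: "primeideal Q R" "colon {\<zero>\<^bsub>M\<^esub>} m \<subseteq> Q"
  obtains P where "P \<in> associated_primes R M" "P \<subseteq> Q"
proof -
  interpret Q: primeideal Q R by (rule Q)
  have "\<one> \<notin> Q" using Q.one_imp_carrier Q.I_notcarr by blast
  then obtain s where s: "s \<in> carrier R" "primeideal (colon {\<zero>\<^bsub>M\<^esub>} (s \<star> m)) R"
    "colon {\<zero>\<^bsub>M\<^esub>} (s \<star> m) \<inter> (carrier R - Q) = {}"
    using exists_prime_colon[OF M submodule_zero m, of "carrier R - Q"] Q(2) Q.I_prime by blast
  then have "colon {\<zero>\<^bsub>M\<^esub>} (s \<star> m) \<in> associated_primes R M"
    using m by (auto simp: associated_primes_def colon_def)
  moreover have "colon {\<zero>\<^bsub>M\<^esub>} (s \<star> m) \<subseteq> Q" using s(3) by (auto simp: colon_def)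
  ultimately show ?thesis using that by blast
qed

end

section \<open>Laurent modules and their dual actions\<close>

lemma laurent_ring_simps [simp]:
  "carrier laurent_ring = UNIV" "monoid.mult laurent_ring = (*)" "monoid.one laurent_ring = 1"
  "add laurent_ring = (+)" "ring.zero laurent_ring = 0"
  by (simp_all add: laurent_ring_def ring_of_type_algebra_def)

lemma a_inv_laurent_ring [simp]: "\<ominus>\<^bsub>laurent_ring\<^esub> f = - f"
proof -
  interpret L: cring "laurent_ring :: 'a laurent ring" by (rule cring_laurent_ring)
  show ?thesis by (rule L.minus_equality) simp_all
qed

lemma countable_laurent: "countable (A :: ('d::finite) laurent set)"
proof -
  let ?g = "\<lambda>f :: 'd laurent. (\<lambda>k. (k, lookup f k)) ` keys f"
  have "inj_on ?g A"
  proof (rule inj_onI, rule poly_mapping_eqI)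
    fix f g :: "'d laurent" and k assume eq: "?g f = ?g g"
    have mem: "(k, c) \<in> ?g h \<longleftrightarrow> c = lookup h k \<and> c \<noteq> 0" for c and h :: "'d laurent"
      by (auto simp: in_keys_iff)
    show "lookup f k = lookup g k"
      using mem[of _ f] mem[of _ g] unfolding eq by metis
  qed
  moreover have "countable (?g ` A)"
    by (rule countable_subset[OF _ countable_Collect_finite]) auto
  ultimately show ?thesis by (rule countable_image_inj_on[rotated])
qed

text \<open>Nothing is required outside \<open>N\<close>, so a character of a module restricts to a
  submodule as the same function.\<close>

definition additive_character :: "('r, 'm, 't) module_scheme \<Rightarrow> 'm set \<Rightarrow> ('m \<Rightarrow> complex) \<Rightarrow> bool" where
  "additive_character M N x \<longleftrightarrow> (\<forall>a\<in>N. cmod (x a) = 1) \<and> (\<forall>a\<in>N. \<forall>b\<in>N. x (a \<oplus>\<^bsub>M\<^esub> b) = x a * x b)"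

abbreviation near_one_along ::
  "(('d::finite) laurent, 'm, 't) module_scheme \<Rightarrow> (real ^ 'd) set \<Rightarrow> real \<Rightarrow> real \<Rightarrow> 'm set \<Rightarrow> ('m \<Rightarrow> complex) \<Rightarrow> bool" where
  "near_one_along M V t \<delta> A x \<equiv>
     \<forall>a\<in>A. \<forall>n. infdist (real_of_int_vec n) V \<le> t \<longrightarrow> cmod (x (u_pow n \<odot>\<^bsub>M\<^esub> a) - 1) \<le> \<delta>"

text \<open>
  A quantitative form of expansiveness that refers to the characters of the submodule \<open>N\<close> instead
  of the topology of the dual group.
\<close>

definition rigid_along :: "(('d::finite) laurent, 'm, 't) module_scheme \<Rightarrow> 'm set \<Rightarrow> (real ^ 'd) set \<Rightarrow> bool" where
  "rigid_along M N V \<longleftrightarrow> (\<exists>A \<delta> t. finite A \<and> A \<subseteq> N \<and> \<delta> > 0 \<and> t > 0 \<and>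
     (\<forall>x. additive_character M N x \<longrightarrow>
        near_one_along M V t \<delta> A x \<longrightarrow> (\<forall>m\<in>N. x m = 1)))"

locale laurent_module = Module.module laurent_ring M for M :: "(('d::finite) laurent, 'm) module"
begin

text \<open>Countability makes the product over \<open>carrier M\<close>, and with it the dual,
  metrizable.\<close>

lemma countable_carrier:
  assumes "noetherian_module laurent_ring M"
  shows "countable (carrier M)"
proof -
  obtain A where A: "finite A" "A \<subseteq> carrier M" "carrier M = \<Inter>{N'. submodule N' laurent_ring M \<and> A \<subseteq> N'}"
    by (rule noetherian_finitely_generated[OF assms submodule_carrier])
  have "\<exists>N. submodule N laurent_ring M \<and> A \<subseteq> N \<and> countable N"
    using A(1,2)
  proof (induction A rule: finite_induct)
    case empty
    then show ?case using submodule_zero by (intro exI[of _ "{\<zero>\<^bsub>M\<^esub>}"]) simp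
  next
    case (insert a A)
    then obtain N where N: "submodule N laurent_ring M" "A \<subseteq> N" "countable N" by auto
    have a: "a \<in> carrier M" using insert.prems by simp
    have "add_cyclic N a = (\<lambda>(n, r). n \<oplus>\<^bsub>M\<^esub> r \<star> a) ` (N \<times> UNIV)"
      by (auto simp: add_cyclic_def)
    then have "countable (add_cyclic N a)" using N(3) by (auto intro!: countable_image countable_SIGMA countable_laurent)
    then show ?case using add_cyclic[OF N(1) a] N(2) by (intro exI[of _ "add_cyclic N a"]) auto
  qed
  then obtain N where N: "submodule N laurent_ring M" "A \<subseteq> N" "countable N" by blast
  then have "carrier M \<subseteq> N" using A(3) by blast
  then show ?thesis using N(3) countable_subset by blast
qed

lemma mem_dual_carrier_iff:
  "x \<in> dual_carrier M \<longleftrightarrow> additive_character M (carrier M) x \<and> x \<in> extensional (carrier M)"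
  by (auto simp: dual_carrier_def additive_character_def hom_def circle_group_def)

lemma restrict_in_dual_carrier:
  "additive_character M (carrier M) x \<Longrightarrow> restrict x (carrier M) \<in> dual_carrier M"
  by (auto simp: dual_carrier_def additive_character_def hom_def circle_group_def)

text \<open>A metric ball around the trivial character contains a basic neighbourhood of the product
  topology, which restricts only finitely many coordinates; these form \<open>A\<close>. The trivial
  character is fixed by the action, so expansiveness can be applied to it and
  \<open>x\<close>.\<close>

lemma rigid_if_expansive:
  assumes exp: "algebraic_action_expansive_along M V" and V: "V \<noteq> {}"
  shows "rigid_along M (carrier M) V"
proof -
  obtain \<rho> where \<rho>: "Metric_space (topspace (dual_space M)) \<rho>"
      "Metric_space.mtopology (topspace (dual_space M)) \<rho> = dual_space M"
    and mexp: "metric_expansive_along (topspace (dual_space M)) \<rho> (dual_action M) V"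
    using exp unfolding expansive_along_def by blast
  obtain \<epsilon> t where \<epsilon>: "\<epsilon> > 0" "t > 0"
    and E: "\<And>x y. x \<in> dual_carrier M \<Longrightarrow> y \<in> dual_carrier M \<Longrightarrow>
              dist_along \<rho> (dual_action M) (thickening V t) x y \<le> \<epsilon> \<Longrightarrow> x = y"
    using mexp unfolding metric_expansive_along_def topspace_dual_space by blast
  interpret m: Metric_space "dual_carrier M" \<rho> using \<rho>(1) by simp
  have top: "m.mtopology = dual_space M" using \<rho>(2) by simp
  define e where "e = (\<lambda>a\<in>carrier M. 1 :: complex)"
  have e: "e \<in> dual_carrier M"
    unfolding e_def by (rule restrict_in_dual_carrier) (simp add: additive_character_def)
  have "openin (dual_space M) (m.mball e \<epsilon>)" using m.openin_mball top by metis
  then obtain W where W: "openin (product_topology (\<lambda>_. euclidean) (carrier M)) W"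
    "m.mball e \<epsilon> = W \<inter> dual_carrier M"
    unfolding dual_space_def openin_subtopology by blast
  have "e \<in> W" using W(2) m.centre_in_mball_iff e \<epsilon>(1) by blast
  then obtain U where U: "finite {a \<in> carrier M. U a \<noteq> (UNIV :: complex set)}"
    "\<And>a. a \<in> carrier M \<Longrightarrow> open (U a)" "e \<in> PiE (carrier M) U" "PiE (carrier M) U \<subseteq> W"
    using W(1) unfolding openin_product_topology_alt by (force simp: openin_open_eq)
  define A where "A = {a \<in> carrier M. U a \<noteq> (UNIV :: complex set)}"
  have "\<exists>d>0. \<forall>w. dist w 1 < d \<longrightarrow> w \<in> U a" if "a \<in> A" for a
  proof -
    have "open (U a)" "1 \<in> U a" using that U(2,3) by (auto simp: A_def e_def PiE_iff)
    then show ?thesis unfolding open_dist by blast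
  qed
  then obtain d where d: "\<And>a. a \<in> A \<Longrightarrow> d a > 0" "\<And>a w. a \<in> A \<Longrightarrow> dist w 1 < d a \<Longrightarrow> w \<in> U a"
    by metis
  have finA: "finite A" using U(1) by (simp add: A_def)
  obtain \<delta> where \<delta>: "\<delta> > 0" "\<And>a. a \<in> A \<Longrightarrow> \<delta> < d a"
    using finite_positive_lower_bound[of A d] finA d(1) by blast
  show ?thesis
    unfolding rigid_along_def
  proof (intro exI conjI allI impI)
    show "finite A" "A \<subseteq> carrier M" "\<delta> > 0" "t > 0" using finA \<delta>(1) \<epsilon> by (auto simp: A_def)
    fix x assume x: "additive_character M (carrier M) x"
      and small: "near_one_along M V t \<delta> A x"
    define y where "y = restrict x (carrier M)"
    have y: "y \<in> dual_carrier M" unfolding y_def by (rule restrict_in_dual_carrier[OF x])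
    have act: "dual_action M n z \<in> dual_carrier M" if "z \<in> dual_carrier M" for n z
      by (rule dual_action_closed[OF module_axioms that])
    have act_e: "dual_action M n e = e" for n
      by (auto simp: dual_action_def e_def fun_eq_iff)
    have near: "\<rho> (dual_action M n y) (dual_action M n e) \<le> \<epsilon>" if n: "real_of_int_vec n \<in> thickening V t" for n
    proof -
      have "dual_action M n y \<in> PiE (carrier M) U"
      proof (rule PiE_I)
        fix a assume a: "a \<in> carrier M"
        show "dual_action M n y a \<in> U a"
        proof (cases "a \<in> A")
          case True
          have "infdist (real_of_int_vec n) V \<le> t" using n V by (simp add: thickening_def)
          then have "dist (x (u_pow n \<star> a)) 1 < d a"
            using small True \<delta>(2)[OF True] by (force simp: dist_norm)
          then show ?thesis using d(2)[OF True] a by (simp add: dual_action_def y_def)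
        qed (use a in \<open>simp add: A_def\<close>)
      qed (simp add: dual_action_def)
      then have "dual_action M n y \<in> m.mball e \<epsilon>" using U(4) W(2) act[OF y] by blast
      then have "\<rho> e (dual_action M n y) < \<epsilon>" by simp
      then show ?thesis using act_e m.commute[of e "dual_action M n y"] by simp
    qed
    have "dist_along \<rho> (dual_action M) (thickening V t) y e \<le> \<epsilon>"
      using near \<epsilon> by (auto simp: dist_along_def intro!: cSUP_least)
    then have "y = e" by (rule E[OF y e])
    then show "\<forall>m\<in>carrier M. x m = 1" by (auto simp: y_def e_def fun_eq_iff split: if_splits)
  qed
qed

text \<open>Compactness makes the finitely many evaluations at \<open>A\<close> uniformly
  continuous, which yields one \<open>\<epsilon>\<close>. Two characters that stay close have a
  quotient that stays near 1, and rigidity applies to this quotient.\<close>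

lemma expansive_if_rigid:
  assumes M: "noetherian_module laurent_ring M" and rig: "rigid_along M (carrier M) V" and V: "V \<noteq> {}"
  shows "algebraic_action_expansive_along M V"
proof -
  have "metrizable_space (product_topology (\<lambda>_. euclidean :: complex topology) (carrier M))"
    unfolding metrizable_space_product_topology
    using countable_carrier[OF M] by (auto simp: metrizable_space_euclidean intro: countable_subset)
  then have "metrizable_space (dual_space M)"
    unfolding dual_space_def by (rule metrizable_space_subtopology)
  then obtain S \<rho> where S: "Metric_space S \<rho>" "dual_space M = Metric_space.mtopology S \<rho>"
    unfolding metrizable_space_def by blast
  then have XM: "S = dual_carrier M"
    using Metric_space.topspace_mtopology topspace_dual_space by metis
  interpret m: Metric_space "dual_carrier M" \<rho> using S XM by simp
  have top: "m.mtopology = dual_space M" using S XM by simp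
  have comp: "compact_space (dual_space M)" by (rule compact_space_dual_space) (rule M.abelian_group_axioms)
  obtain A \<delta> t where A: "finite A" "A \<subseteq> carrier M" "\<delta> > 0" "t > 0"
    and rigid: "\<And>x. additive_character M (carrier M) x \<Longrightarrow>
        near_one_along M V t \<delta> A x \<Longrightarrow> (\<forall>m\<in>carrier M. x m = 1)"
    using rig unfolding rigid_along_def by blast
  have "\<exists>d>0. \<forall>x\<in>dual_carrier M. \<forall>y\<in>dual_carrier M. \<rho> y x < d \<longrightarrow> dist (y a) (x a) < \<delta>" if a: "a \<in> A" for a
  proof -
    have "continuous_map (dual_space M) euclidean (\<lambda>x. x a)"
      unfolding dual_space_def using a A(2)
      by (intro continuous_map_from_subtopology continuous_map_product_projection) auto
    then have "continuous_map (mtopology_of (metric (dual_carrier M, \<rho>))) (mtopology_of euclidean_metric) (\<lambda>x. x a)"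
      using top by (simp add: mtopology_of_def)
    then have "uniformly_continuous_map (metric (dual_carrier M, \<rho>)) euclidean_metric (\<lambda>x. x a)"
      using comp top by (intro continuous_imp_uniformly_continuous_map) (auto simp: mtopology_of_def)
    then show ?thesis
      using A(3) unfolding uniformly_continuous_map_def by auto
  qed
  then obtain d where d: "\<And>a. a \<in> A \<Longrightarrow> d a > 0"
    "\<And>a x y. a \<in> A \<Longrightarrow> x \<in> dual_carrier M \<Longrightarrow> y \<in> dual_carrier M \<Longrightarrow> \<rho> y x < d a \<Longrightarrow> dist (y a) (x a) < \<delta>"
    by metis
  obtain \<epsilon> where \<epsilon>: "\<epsilon> > 0" and \<epsilon>d: "\<And>a. a \<in> A \<Longrightarrow> \<epsilon> < d a"
    using finite_positive_lower_bound[of A d] A(1) d(1) by blast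
  have "compactin m.mtopology (dual_carrier M)"
    using comp top by (simp add: compact_space_def)
  then have "m.mbounded (dual_carrier M)"
    by (rule m.compactin_imp_mbounded)
  then obtain B where B: "\<And>x y. x \<in> dual_carrier M \<Longrightarrow> y \<in> dual_carrier M \<Longrightarrow> \<rho> x y \<le> B"
    unfolding m.mbounded_alt by blast
  have act: "dual_action M n z \<in> dual_carrier M" if "z \<in> dual_carrier M" for n z
    by (rule dual_action_closed[OF module_axioms that])
  have "x = y" if xy: "x \<in> dual_carrier M" "y \<in> dual_carrier M"
    and le: "dist_along \<rho> (dual_action M) (thickening V t) x y \<le> \<epsilon>" for x y
  proof -
    have xc: "additive_character M (carrier M) x" and yc: "additive_character M (carrier M) y"
      and ext: "x \<in> extensional (carrier M)" "y \<in> extensional (carrier M)"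
      using xy by (auto simp: mem_dual_carrier_iff)
    have y0: "y m \<noteq> 0" if "m \<in> carrier M" for m using yc that by (force simp: additive_character_def)
    have "\<forall>m\<in>carrier M. x m / y m = 1"
    proof (rule rigid)
      show "additive_character M (carrier M) (\<lambda>m. x m / y m)"
        using xc yc by (auto simp: additive_character_def norm_divide)
      show "near_one_along M V t \<delta> A (\<lambda>m. x m / y m)"
      proof (intro ballI allI impI)
        fix a n assume a: "a \<in> A" and n: "infdist (real_of_int_vec n) V \<le> t"
        have ac: "a \<in> carrier M" using a A(2) by blast
        let ?N = "{n. real_of_int_vec n \<in> thickening V t}"
        have nN: "n \<in> ?N" using n V by (simp add: thickening_def)
        have "\<rho> (dual_action M n x) (dual_action M n y) \<le> (SUP n\<in>?N. \<rho> (dual_action M n x) (dual_action M n y))"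
          using nN B act xy by (intro cSUP_upper bdd_aboveI2[where M = B]) auto
        also have "\<dots> \<le> \<epsilon>" using le nN by (auto simp: dist_along_def split: if_splits)
        finally have "\<rho> (dual_action M n x) (dual_action M n y) < d a" using \<epsilon>d[OF a] by simp
        then have "dist (dual_action M n x a) (dual_action M n y a) < \<delta>"
          using d(2)[OF a] act xy by blast
        then have less: "cmod (x (u_pow n \<star> a) - y (u_pow n \<star> a)) < \<delta>"
          using ac by (simp add: dual_action_def dist_norm)
        have uc: "u_pow n \<star> a \<in> carrier M" using ac by simp
        have "x (u_pow n \<star> a) / y (u_pow n \<star> a) - 1
          = (x (u_pow n \<star> a) - y (u_pow n \<star> a)) / y (u_pow n \<star> a)"
          using y0[OF uc] by (simp add: diff_divide_distrib)
        then show "cmod (x (u_pow n \<star> a) / y (u_pow n \<star> a) - 1) \<le> \<delta>"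
          using less yc uc by (simp add: norm_divide additive_character_def)
      qed
    qed
    then show ?thesis using y0 ext by (intro extensionalityI[of x "carrier M" y]) auto
  qed
  then have "metric_expansive_along (dual_carrier M) \<rho> (dual_action M) V"
    unfolding metric_expansive_along_def using \<epsilon> A(4) by blast
  then show ?thesis
    unfolding expansive_along_def topspace_dual_space using m.Metric_space_axioms top by blast
qed

end

section \<open>Expansiveness and associated primes\<close>

lemma monomial_add:
  fixes z :: "complex ^ ('d::finite)"
  assumes "\<And>i. z $ i \<noteq> 0"
  shows "(\<Prod>i\<in>UNIV. z $ i powi (m $ i + n $ i)) = (\<Prod>i\<in>UNIV. z $ i powi (m $ i)) * (\<Prod>i\<in>UNIV. z $ i powi (n $ i))"
  using assms by (simp add: power_int_add prod.distrib)

lemma laurent_eval_eq: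
  assumes "finite A" "keys f \<subseteq> A"
  shows "laurent_eval f z = (\<Sum>n\<in>A. of_int (lookup f n) * (\<Prod>i\<in>UNIV. z $ i powi (n $ i)))"
  unfolding laurent_eval_def using assms by (intro sum.mono_neutral_left) (auto simp: in_keys_iff)

lemma laurent_eval_single:
  "laurent_eval (single k c) z = of_int c * (\<Prod>i\<in>UNIV. z $ i powi (k $ i))"
  using laurent_eval_eq[of "{k}" "single k c" z] by simp

lemma laurent_eval_add: "laurent_eval (f + g) z = laurent_eval f z + laurent_eval g z"
proof -
  let ?A = "keys f \<union> keys g"
  have "laurent_eval (f + g) z = (\<Sum>n\<in>?A. of_int (lookup (f + g) n) * (\<Prod>i\<in>UNIV. z $ i powi (n $ i)))"
    by (rule laurent_eval_eq) (use keys_add[of f g] in auto)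
  then show ?thesis
    by (simp add: lookup_add distrib_right sum.distrib laurent_eval_eq[of ?A f] laurent_eval_eq[of ?A g])
qed

lemma laurent_eval_diff: "laurent_eval (f - g) z = laurent_eval f z - laurent_eval g z"
  using laurent_eval_add[of "f - g" g z] by simp

lemma laurent_eval_one [simp]: "laurent_eval 1 z = 1"
  using laurent_eval_single[of 0 1 z] by simp

lemma laurent_eval_mult:
  fixes z :: "complex ^ ('d::finite)"
  assumes z: "\<And>i. z $ i \<noteq> 0"
  shows "laurent_eval (f * g) z = laurent_eval f z * laurent_eval g z"
proof (induction f rule: poly_mapping_single_induct)
  case zero
  show ?case by (simp add: laurent_eval_def)
next
  case (add k c f)
  have "laurent_eval (single k c * g) z
    = laurent_eval (single k c) z * laurent_eval g z"
  proof (induction g rule: poly_mapping_single_induct)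
    case zero
    show ?case by (simp add: laurent_eval_def)
  next
    case (add l d g)
    then show ?case
      by (simp add: distrib_left laurent_eval_add mult_single laurent_eval_single monomial_add[OF z] mult_ac)
  qed
  then show ?case using add by (simp add: distrib_right laurent_eval_add)
qed

lemma exists_high_exponent:
  fixes v :: "real ^ ('d::finite)"
  assumes "norm v = 1"
  obtains k where "real_of_int_vec k \<bullet> v > c"
proof -
  let ?x = "(c + CARD('d) + 1) *\<^sub>R v"
  obtain k where k: "norm (?x - real_of_int_vec k) \<le> CARD('d)" using exists_near_integer_vector .
  have "v \<bullet> v = 1" using assms by (simp add: norm_eq_1)
  moreover have "(?x - real_of_int_vec k) \<bullet> v \<le> CARD('d)"
    using norm_cauchy_schwarz[of "?x - real_of_int_vec k" v] k assms by simp
  ultimately have "real_of_int_vec k \<bullet> v > c" by (simp add: inner_diff_left)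
  then show ?thesis by (rule that)
qed

definition good_prime_along :: "('d::finite) laurent set \<Rightarrow> (real ^ 'd) set \<Rightarrow> bool" where
  "good_prime_along P V \<longleftrightarrow>
     (\<forall>v\<in>V\<^sup>\<bottom>. norm v = 1 \<longrightarrow> lower_unit_at P v) \<and> V\<^sup>\<bottom> \<inter> log_variety P = {}"

lemma ideal_laurentD:
  assumes "ideal P laurent_ring"
  shows "0 \<in> P" "f \<in> P \<Longrightarrow> g \<in> P \<Longrightarrow> f + g \<in> P" "f \<in> P \<Longrightarrow> r * f \<in> P" "f \<in> P \<Longrightarrow> - f \<in> P"
    "f \<in> P \<Longrightarrow> g \<in> P \<Longrightarrow> f - g \<in> P"
proof -
  interpret ideal P laurent_ring by (rule assms)
  show "0 \<in> P" using additive_subgroup.zero_closed[OF is_additive_subgroup] by simp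
  show add: "f + g \<in> P" if "f \<in> P" "g \<in> P" for f g using additive_subgroup.a_closed[OF is_additive_subgroup that] by simp
  show mult: "r * f \<in> P" if "f \<in> P" for r f using I_l_closed[OF that, of r] by simp
  show minus: "- f \<in> P" if "f \<in> P" for f using mult[OF that, of "- 1"] by simp
  show "f - g \<in> P" if "f \<in> P" "g \<in> P" for f g using add[OF that(1) minus[OF that(2)]] by simp
qed

context laurent_module
begin

lemma smult_mult: "x \<in> carrier M \<Longrightarrow> (f * g) \<star> x = f \<star> (g \<star> x)"
  using smult_assoc1[of f g x] by simp

lemma smult_add_left: "x \<in> carrier M \<Longrightarrow> (f + g) \<star> x = f \<star> x \<oplus>\<^bsub>M\<^esub> g \<star> x"
  using smult_l_distr[of f g x] by simp

lemma smult_one_left [simp]: "x \<in> carrier M \<Longrightarrow> 1 \<star> x = x"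
  using smult_one[of x] by simp

lemma smult_minus_left: "x \<in> carrier M \<Longrightarrow> (- f) \<star> x = \<ominus>\<^bsub>M\<^esub> (f \<star> x)"
  using smult_l_minus[of f x] by simp

lemma additive_character_zero:
  assumes "additive_character M N x" "\<zero>\<^bsub>M\<^esub> \<in> N"
  shows "x \<zero>\<^bsub>M\<^esub> = 1"
proof -
  have "x (\<zero>\<^bsub>M\<^esub> \<oplus>\<^bsub>M\<^esub> \<zero>\<^bsub>M\<^esub>) = x \<zero>\<^bsub>M\<^esub> * x \<zero>\<^bsub>M\<^esub>" "cmod (x \<zero>\<^bsub>M\<^esub>) = 1"
    using assms unfolding additive_character_def by blast+
  then show ?thesis by auto
qed

lemma rigid_zero: "rigid_along M {\<zero>\<^bsub>M\<^esub>} V"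
  unfolding rigid_along_def using additive_character_zero[of "{\<zero>\<^bsub>M\<^esub>}"]
  by (intro exI[of _ "{}"] exI[of _ 1]) auto

text \<open>A character that is trivial on \<open>N\<close> induces through \<open>m\<close> a
  character of the ring that is trivial on \<open>P\<close>, to which \<open>ideal_expansive\<close>
  applies. \<open>P\<close> may be smaller than the colon ideal, which lets an associated prime of
  \<open>M\<close> control a cyclic quotient with larger annihilator.\<close>

lemma rigid_add_cyclic:
  assumes N: "submodule N laurent_ring M" "rigid_along M N V" and m: "m \<in> carrier M"
    and P: "P \<subseteq> colon N m" "ideal P laurent_ring" and V: "subspace V" and good: "good_prime_along P V"
  shows "rigid_along M (add_cyclic N m) V"
proof -
  obtain A \<delta> t where A: "finite A" "A \<subseteq> N" "\<delta> > 0" "t > 0"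
    and rigid: "\<And>x. additive_character M N x \<Longrightarrow>
        near_one_along M V t \<delta> A x \<Longrightarrow> (\<forall>m\<in>N. x m = 1)"
    using N(2) unfolding rigid_along_def by blast
  obtain \<delta>' t' where \<delta>': "\<delta>' > 0" "t' > 0"
    and exp: "\<And>x f. (\<And>f g. x (f + g) = x f * x g) \<Longrightarrow> (\<And>f. cmod (x f) = 1) \<Longrightarrow> (\<And>f. f \<in> P \<Longrightarrow> x f = 1) \<Longrightarrow>
       (\<And>n. infdist (real_of_int_vec n) V \<le> t' \<Longrightarrow> cmod (x (u_pow n) - 1) \<le> \<delta>') \<Longrightarrow> x f = 1"
    using ideal_expansive[OF ideal_laurentD(1-3)[OF P(2)] V] good unfolding good_prime_along_def by blast
  note C = add_cyclic[OF N(1) m]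
  note E = submoduleE[OF C(1)]
  show ?thesis
    unfolding rigid_along_def
  proof (intro exI conjI allI impI)
    show "finite (insert m A)" "insert m A \<subseteq> add_cyclic N m" "min \<delta> \<delta>' > 0" "max t t' > 0"
      using A \<delta>' C by auto
    fix x assume x: "additive_character M (add_cyclic N m) x"
      and small: "near_one_along M V (max t t') (min \<delta> \<delta>') (insert m A) x"
    have rm: "r \<star> m \<in> add_cyclic N m" for r using E(4) C(3) by simp
    have N1: "x n = 1" if "n \<in> N" for n
    proof -
      have "additive_character M N x" using x C(2) unfolding additive_character_def by blast
      moreover have "near_one_along M V t \<delta> A x"
        using small by auto
      ultimately show ?thesis using rigid that by blast
    qed
    have "x (r \<star> m) = 1" for r
    proof (rule exp[of "\<lambda>r. x (r \<star> m)"])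
      show "x ((f + g) \<star> m) = x (f \<star> m) * x (g \<star> m)" for f g
        using x rm m by (simp add: smult_add_left additive_character_def)
      show "cmod (x (f \<star> m)) = 1" for f using x rm by (simp add: additive_character_def)
      show "x (f \<star> m) = 1" if "f \<in> P" for f using N1 P(1) that by (auto simp: colon_def)
      show "cmod (x (u_pow n \<star> m) - 1) \<le> \<delta>'" if "infdist (real_of_int_vec n) V \<le> t'" for n
        using small that by auto
    qed
    then have "x (n \<oplus>\<^bsub>M\<^esub> r \<star> m) = 1" if "n \<in> N" for n r
      using x N1[OF that] rm[of r] C(2) that unfolding additive_character_def by (metis mult_1 subsetD)
    then show "\<forall>y\<in>add_cyclic N m. x y = 1" unfolding add_cyclic_def by blast
  qed
qed

text \<open>A maximal rigid submodule replaces an explicit filtration. If it were proper, some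
  \<open>s \<star> m\<close> outside it would have a prime colon ideal; this contains the
  annihilator of \<open>s \<star> m\<close>, hence an associated prime of \<open>M\<close>, whose
  goodness makes a larger submodule rigid.\<close>

theorem rigid_if_good_primes:
  assumes M: "noetherian_module laurent_ring M" and V: "subspace V"
    and good: "\<And>P. P \<in> associated_primes laurent_ring M \<Longrightarrow> good_prime_along P V"
  shows "rigid_along M (carrier M) V"
proof -
  define \<N> where "\<N> = {N. submodule N laurent_ring M \<and> rigid_along M N V}"
  have ne: "\<N> \<noteq> {}" using submodule_zero rigid_zero by (auto simp: \<N>_def)
  have sub: "submodule N laurent_ring M" if "N \<in> \<N>" for N using that by (simp add: \<N>_def)
  obtain N where "N \<in> \<N>" and max: "\<And>Y. Y \<in> \<N> \<Longrightarrow> N \<subseteq> Y \<Longrightarrow> Y = N"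
    by (rule noetherian_maximal[OF M ne sub]) (assumption, rule that)
  then have N: "submodule N laurent_ring M" "rigid_along M N V" by (simp_all add: \<N>_def)
  have "carrier M \<subseteq> N"
  proof
    fix m assume m: "m \<in> carrier M"
    show "m \<in> N"
    proof (rule ccontr)
      assume "m \<notin> N"
      then have "colon N m \<inter> {1} = {}" using m by (simp add: colon_def)
      from exists_prime_colon[OF M N(1) m _ _ _ this]
      obtain s where s: "primeideal (colon N (s \<star> m)) laurent_ring" "1 \<notin> colon N (s \<star> m)"
        by (simp add: Int_insert_right) (metis insert_not_empty)
      have sm: "s \<star> m \<in> carrier M" using m by simp
      then have smN: "s \<star> m \<notin> N" using s(2) by (simp add: colon_def)
      have "colon {\<zero>\<^bsub>M\<^esub>} (s \<star> m) \<subseteq> colon N (s \<star> m)"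
        using submodule_zero_mem[OF N(1)] by (auto simp: colon_def)
      then obtain P where P: "P \<in> associated_primes laurent_ring M" "P \<subseteq> colon N (s \<star> m)"
        using associated_prime_below[OF M sm s(1)] by blast
      then have "ideal P laurent_ring" by (auto simp: associated_primes_def primeideal_def)
      then have "rigid_along M (add_cyclic N (s \<star> m)) V"
        using rigid_add_cyclic[OF N sm P(2) _ V] good[OF P(1)] by blast
      then have "add_cyclic N (s \<star> m) = N"
        using add_cyclic(1,2)[OF N(1) sm] by (intro max) (simp_all add: \<N>_def)
      then show False using add_cyclic(3)[OF N(1) sm] smN by blast
    qed
  qed
  then have "N = carrier M" using submoduleE(1)[OF N(1)] by blast
  then show ?thesis using N(2) by simp
qed

text \<open>The polynomials \<open>1 - g\<close> with strictly descending \<open>g\<close> form a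
  multiplicative set. If it misses \<open>P\<close>, some quotient of \<open>M\<close> is cyclic up
  to \<open>D\<close>, with generator \<open>a\<close>. The elements whose multiple by
  \<open>D\<close> admits a coefficient of \<open>a\<close> of height below \<open>c\<close> form a
  subgroup containing the slab multiples of \<open>A\<close>, hence all of \<open>M\<close>; a high
  monomial multiple of \<open>a\<close> contradicts this.\<close>

lemma lower_unit_if_rigid:
  assumes M: "noetherian_module laurent_ring M" and rig: "rigid_along M (carrier M) V"
    and P: "P \<in> associated_primes laurent_ring M" and V: "subspace V" and v: "v \<in> V\<^sup>\<bottom>" "norm v = 1"
  shows "lower_unit_at P v"
proof (rule ccontr)
  assume neg: "\<not> lower_unit_at P v"
  define low where "low c = {f :: 'd laurent. \<forall>k\<in>keys f. real_of_int_vec k \<bullet> v < c}" for c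
  have low_add: "f + g \<in> low c" if "f \<in> low c" "g \<in> low c" for f g c
    using that keys_add[of f g] by (auto simp: low_def)
  have low_minus: "- f \<in> low c" if "f \<in> low c" for f c
    using that by (auto simp: low_def in_keys_iff)
  have low_mult: "f * g \<in> low (c + d)" if "f \<in> low c" "g \<in> low d" for f g c d
  proof -
    have "real_of_int_vec k \<bullet> v < c + d" if "k \<in> keys (f * g)" for k
    proof -
      obtain a b where "a \<in> keys f" "b \<in> keys g" "k = a + b"
        using keys_mult[of f g] \<open>k \<in> keys (f * g)\<close> by blast
      then show ?thesis using \<open>f \<in> low c\<close> \<open>g \<in> low d\<close>
        by (auto simp: low_def real_of_int_vec_add inner_add_left intro: add_strict_mono)
    qed
    then show ?thesis by (simp add: low_def)
  qed
  define S where "S = (\<lambda>g. 1 - g) ` low 0"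
  obtain m where m: "m \<in> carrier M" "P = {f \<in> carrier laurent_ring. f \<star> m = \<zero>\<^bsub>M\<^esub>}"
    using P by (auto simp: associated_primes_def)
  have disj: "s \<notin> P" if "s \<in> S" for s
    using that neg by (auto simp: S_def low_def lower_unit_at_def)
  have S1: "1 \<in> S" by (auto simp: S_def low_def image_iff intro!: bexI[of _ 0])
  have Smult: "a * b \<in> S" if ab: "a \<in> S" "b \<in> S" for a b
  proof -
    obtain g h where gh: "a = 1 - g" "b = 1 - h" "g \<in> low 0" "h \<in> low 0" using ab by (auto simp: S_def)
    have "g + (h + - (g * h)) \<in> low 0"
      using gh low_mult[of g 0 h 0] by (intro low_add low_minus) auto
    moreover have "a * b = 1 - (g + (h + - (g * h)))" by (simp add: gh algebra_simps)
    ultimately show ?thesis unfolding S_def by blast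
  qed
  obtain N a D where N: "submodule N laurent_ring M" and a: "a \<in> carrier M" and D: "D \<in> S"
    and DM: "\<And>x. x \<in> carrier M \<Longrightarrow> \<exists>n\<in>N. \<exists>r\<in>carrier laurent_ring. D \<star> x = n \<oplus>\<^bsub>M\<^esub> r \<star> a"
    and aN: "\<And>s. s \<in> S \<Longrightarrow> s \<star> a \<notin> N"
  proof (rule cyclic_quotient_up_to_multiplicative_set[OF M])
    show "\<exists>x\<in>carrier M. s \<star> x \<noteq> \<zero>\<^bsub>M\<^esub>" if "s \<in> S" for s using disj[OF that] m by auto
  qed (use S1 Smult in auto)
  note E = submoduleE[OF N] submodule_zero_mem[OF N]
  have NM: "n \<in> carrier M" if "n \<in> N" for n using E(1) that by blast
  obtain A \<delta> t where A: "finite A" "A \<subseteq> carrier M" "\<delta> > 0" "t > 0"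
    and rigid: "\<And>x. additive_character M (carrier M) x \<Longrightarrow>
        near_one_along M V t \<delta> A x \<Longrightarrow> (\<forall>m\<in>carrier M. x m = 1)"
    using rig unfolding rigid_along_def by blast
  have "\<forall>b\<in>A. \<exists>n r. n \<in> N \<and> D \<star> b = n \<oplus>\<^bsub>M\<^esub> r \<star> a" using DM A(2) by blast
  then obtain n r where nr: "\<And>b. b \<in> A \<Longrightarrow> n b \<in> N" "\<And>b. b \<in> A \<Longrightarrow> D \<star> b = n b \<oplus>\<^bsub>M\<^esub> r b \<star> a"
    by metis
  obtain B where "\<And>b k. b \<in> A \<Longrightarrow> k \<in> keys (r b) \<Longrightarrow> real_of_int_vec k \<bullet> v \<le> B"
    by (rule finite_upper_bound_keys[OF A(1), where f = "\<lambda>k. real_of_int_vec k \<bullet> v"]) (rule that)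
  then have \<rho>: "r b \<in> low (B + 1)" if "b \<in> A" for b
    using that by (force simp: low_def)
  \<comment> \<open>Slab monomials have height at most \<open>t\<close>, the coefficients
    \<open>r b\<close> at most \<open>B\<close>; as \<open>low\<close> is strict, each bound is
    raised by 1.\<close>
  define c where "c = t + 1 + (B + 1)"
  define H where "H = {x \<in> carrier M. \<exists>n\<in>N. \<exists>r\<in>low c. D \<star> x = n \<oplus>\<^bsub>M\<^esub> r \<star> a}"
  have HI: "x \<in> H" if "x \<in> carrier M" "n \<in> N" "r \<in> low c" "D \<star> x = n \<oplus>\<^bsub>M\<^esub> r \<star> a" for x n r
    using that by (auto simp: H_def)
  have H: "subgroup H (add_monoid M)"
  proof (rule M.add.subgroupI)
    show "H \<subseteq> carrier M" by (auto simp: H_def)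
    have "\<zero>\<^bsub>M\<^esub> \<in> H" using E(7) a by (intro HI[of _ "\<zero>\<^bsub>M\<^esub>" 0]) (auto simp: low_def smult_l_null[simplified])
    then show "H \<noteq> {}" by blast
    fix x assume "x \<in> H"
    then obtain n r where x: "x \<in> carrier M" "n \<in> N" "r \<in> low c" "D \<star> x = n \<oplus>\<^bsub>M\<^esub> r \<star> a"
      by (auto simp: H_def)
    have "D \<star> (\<ominus>\<^bsub>M\<^esub> x) = \<ominus>\<^bsub>M\<^esub> n \<oplus>\<^bsub>M\<^esub> (- r) \<star> a"
      using x a NM by (simp add: smult_r_minus smult_minus_left M.minus_add)
    then show "\<ominus>\<^bsub>M\<^esub> x \<in> H"
      using x E(3) low_minus by (intro HI[of _ "\<ominus>\<^bsub>M\<^esub> n" "- r"]) auto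
    fix y assume "y \<in> H"
    then obtain n' r' where y: "y \<in> carrier M" "n' \<in> N" "r' \<in> low c" "D \<star> y = n' \<oplus>\<^bsub>M\<^esub> r' \<star> a"
      by (auto simp: H_def)
    have "D \<star> (x \<oplus>\<^bsub>M\<^esub> y) = (n \<oplus>\<^bsub>M\<^esub> n') \<oplus>\<^bsub>M\<^esub> (r + r') \<star> a"
      using x y a NM by (simp add: smult_r_distr smult_add_left M.a_ac)
    then show "x \<oplus>\<^bsub>M\<^esub> y \<in> H"
      using x y E(5) low_add by (auto intro!: HI[of _ "n \<oplus>\<^bsub>M\<^esub> n'" "r + r'"])
  qed
  have gen: "u_pow k \<star> b \<in> H" if b: "b \<in> A" and k: "infdist (real_of_int_vec k) V \<le> t" for b k
  proof (rule HI)
    have bM: "b \<in> carrier M" using b A(2) by blast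
    show "u_pow k \<star> b \<in> carrier M" using bM by simp
    show "u_pow k \<star> n b \<in> N" using E(4) nr(1)[OF b] by simp
    have "real_of_int_vec k \<bullet> v \<le> t" using inner_le_infdist[OF V v(1), of "real_of_int_vec k"] k v(2) by simp
    then have "u_pow k \<in> low (t + 1)" by (auto simp: low_def u_pow_def)
    then show "u_pow k * r b \<in> low c" unfolding c_def using low_mult \<rho>[OF b] by blast
    have "D \<star> (u_pow k \<star> b) = u_pow k \<star> (D \<star> b)"
      using bM by (simp add: smult_mult[symmetric] mult.commute)
    then show "D \<star> (u_pow k \<star> b) = u_pow k \<star> n b \<oplus>\<^bsub>M\<^esub> (u_pow k * r b) \<star> a"
      using nr[OF b] a NM by (simp add: smult_r_distr smult_mult)
  qed
  \<comment> \<open>\<open>H\<close> is in general a subgroup and not a submodule, so group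
    characters are used to separate it.\<close>
  have all: "x \<in> H" if x: "x \<in> carrier M" for x
  proof (rule ccontr)
    assume "x \<notin> H"
    then obtain \<chi>' where \<chi>': "\<And>a. a \<in> carrier M \<Longrightarrow> cmod (\<chi>' a) = 1"
      "\<And>a c. a \<in> carrier M \<Longrightarrow> c \<in> carrier M \<Longrightarrow> \<chi>' (a \<oplus>\<^bsub>M\<^esub> c) = \<chi>' a * \<chi>' c"
      "\<And>h. h \<in> H \<Longrightarrow> \<chi>' h = 1" "\<chi>' x \<noteq> 1"
      using comm_group.character_separates_subgroup[OF M.a_comm_group H, of x] x
      by (simp add: a_inv_def) metis
    have "\<forall>m\<in>carrier M. \<chi>' m = 1"
      using gen \<chi>'(1-3) A(3) by (intro rigid) (auto simp: additive_character_def)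
    then show False using \<chi>'(4) x by blast
  qed
  \<comment> \<open>Dividing the relation for \<open>u_pow k \<star> a\<close> by this high monomial
    pushes \<open>q\<close> below height 0, so \<open>D - u_pow (- k) * q\<close> is again in
    \<open>S\<close> although it sends \<open>a\<close> into \<open>N\<close>.\<close>
  obtain k where k: "real_of_int_vec k \<bullet> v > c" using exists_high_exponent[OF v(2)] .
  have uk: "u_pow k \<star> a \<in> carrier M" using a by simp
  obtain p q where pq: "p \<in> N" "q \<in> low c" "D \<star> (u_pow k \<star> a) = p \<oplus>\<^bsub>M\<^esub> q \<star> a"
    using all[OF uk] by (auto simp: H_def)
  obtain g where g: "D = 1 - g" "g \<in> low 0" using D by (auto simp: S_def)
  have "u_pow (- k) \<in> low (- c)"
    using k by (simp add: low_def u_pow_def real_of_int_vec_minus inner_minus_left)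
  from low_mult[OF this pq(2)] have "u_pow (- k) * q \<in> low 0" by simp
  then have "D - u_pow (- k) * q \<in> S"
    using low_add[OF g(2)] by (auto simp: S_def g(1) image_iff diff_diff_eq intro!: bexI[of _ "g + u_pow (- k) * q"])
  moreover have "(D - u_pow (- k) * q) \<star> a \<in> N"
  proof -
    have "D = u_pow (- k) * (D * u_pow k)" by (simp add: mult.left_commute)
    then have "D \<star> a = u_pow (- k) \<star> (D \<star> (u_pow k \<star> a))"
      using a by (metis smult_mult uk smult_closed)
    then have "D \<star> a = u_pow (- k) \<star> p \<oplus>\<^bsub>M\<^esub> (u_pow (- k) * q) \<star> a"
      using pq a NM by (simp add: smult_r_distr smult_mult)
    moreover have "(D - u_pow (- k) * q) \<star> a = D \<star> a \<oplus>\<^bsub>M\<^esub> \<ominus>\<^bsub>M\<^esub> ((u_pow (- k) * q) \<star> a)"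
      using smult_add_left[OF a, of D "- (u_pow (- k) * q)"] a by (simp add: smult_minus_left)
    ultimately have "(D - u_pow (- k) * q) \<star> a = u_pow (- k) \<star> p"
      using a pq(1) NM by (simp add: M.a_assoc M.r_neg)
    then show ?thesis using E(4)[OF _ pq(1)] by simp
  qed
  ultimately show False using aN by blast
qed

text \<open>The multiplicative set consists of the polynomials that do not vanish at
  \<open>z\<close>. Coefficients of \<open>a\<close> modulo \<open>N\<close> are then determined up
  to polynomials vanishing at \<open>z\<close>, so evaluating them at \<open>z\<close> gives an
  additive map on \<open>M\<close>.\<close>

lemma log_variety_disjoint_if_rigid:
  assumes M: "noetherian_module laurent_ring M" and rig: "rigid_along M (carrier M) V"
    and P: "P \<in> associated_primes laurent_ring M" and V: "subspace V"
  shows "V\<^sup>\<bottom> \<inter> log_variety P = {}"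
proof (rule ccontr)
  assume "V\<^sup>\<bottom> \<inter> log_variety P \<noteq> {}"
  then obtain z :: "complex ^ 'd" where z: "\<And>i. z $ i \<noteq> 0" "\<And>f. f \<in> P \<Longrightarrow> laurent_eval f z = 0"
    and wV: "(\<chi> i. ln (cmod (z $ i))) \<in> V\<^sup>\<bottom>" by (auto simp: log_variety_def variety_def)
  define w where "w = (\<chi> i. ln (cmod (z $ i)))"
  define e where "e f = laurent_eval f z" for f
  have e: "e (f + g) = e f + e g" "e (f - g) = e f - e g" "e (f * g) = e f * e g" "e 1 = 1" for f g
    by (simp_all add: e_def laurent_eval_add laurent_eval_diff laurent_eval_mult[OF z(1)])
  define S where "S = {f. e f \<noteq> 0}"
  obtain m where m: "m \<in> carrier M" "P = {f \<in> carrier laurent_ring. f \<star> m = \<zero>\<^bsub>M\<^esub>}"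
    using P by (auto simp: associated_primes_def)
  obtain N a D where N: "submodule N laurent_ring M" and a: "a \<in> carrier M" and D: "D \<in> S"
    and DM: "\<And>x. x \<in> carrier M \<Longrightarrow> \<exists>n\<in>N. \<exists>r\<in>carrier laurent_ring. D \<star> x = n \<oplus>\<^bsub>M\<^esub> r \<star> a"
    and aN: "\<And>s. s \<in> S \<Longrightarrow> s \<star> a \<notin> N"
  proof (rule cyclic_quotient_up_to_multiplicative_set[OF M])
    show "\<exists>x\<in>carrier M. s \<star> x \<noteq> \<zero>\<^bsub>M\<^esub>" if "s \<in> S" for s using that m z(2) by (auto simp: S_def e_def)
  qed (auto simp: S_def e)
  note E = submoduleE[OF N] submodule_zero_mem[OF N]
  have NM: "n \<in> carrier M" if "n \<in> N" for n using E(1) that by blast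
  \<comment> \<open>The choice of coefficient does not matter: two of them differ by a polynomial
    that sends \<open>a\<close> into \<open>N\<close>, hence by one outside
    \<open>S\<close>.\<close>
  define \<psi> where "\<psi> x = e (SOME r. \<exists>n\<in>N. D \<star> x = n \<oplus>\<^bsub>M\<^esub> r \<star> a)" for x
  have \<psi>: "\<psi> x = e r" if "n \<in> N" "D \<star> x = n \<oplus>\<^bsub>M\<^esub> r \<star> a" for x n r
  proof -
    define r' where "r' = (SOME r. \<exists>n\<in>N. D \<star> x = n \<oplus>\<^bsub>M\<^esub> r \<star> a)"
    have "\<exists>n\<in>N. D \<star> x = n \<oplus>\<^bsub>M\<^esub> r' \<star> a" unfolding r'_def by (rule someI[of _ r]) (use that in blast)
    then obtain n' where n': "n' \<in> N" "D \<star> x = n' \<oplus>\<^bsub>M\<^esub> r' \<star> a" by blast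
    have "(r' - r) \<star> a = r' \<star> a \<oplus>\<^bsub>M\<^esub> \<ominus>\<^bsub>M\<^esub> (r \<star> a)"
      using smult_add_left[OF a, of r' "- r"] a by (simp add: smult_minus_left)
    also have "\<dots> = \<ominus>\<^bsub>M\<^esub> n' \<oplus>\<^bsub>M\<^esub> (n' \<oplus>\<^bsub>M\<^esub> r' \<star> a) \<oplus>\<^bsub>M\<^esub> \<ominus>\<^bsub>M\<^esub> (r \<star> a)"
      using a NM n'(1) by (simp add: M.a_assoc[symmetric] M.l_neg)
    also have "n' \<oplus>\<^bsub>M\<^esub> r' \<star> a = n \<oplus>\<^bsub>M\<^esub> r \<star> a" using n' that by simp
    also have "\<ominus>\<^bsub>M\<^esub> n' \<oplus>\<^bsub>M\<^esub> (n \<oplus>\<^bsub>M\<^esub> r \<star> a) \<oplus>\<^bsub>M\<^esub> \<ominus>\<^bsub>M\<^esub> (r \<star> a) = \<ominus>\<^bsub>M\<^esub> n' \<oplus>\<^bsub>M\<^esub> n"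
      using a NM n'(1) that(1) by (simp add: M.a_assoc M.r_neg)
    finally have "(r' - r) \<star> a \<in> N" using E(3,5) n'(1) that(1) by simp
    then have "r' - r \<notin> S" using aN by blast
    then show ?thesis by (simp add: S_def e \<psi>_def r'_def[symmetric])
  qed
  have rep: "\<exists>n r. n \<in> N \<and> D \<star> x = n \<oplus>\<^bsub>M\<^esub> r \<star> a \<and> \<psi> x = e r" if "x \<in> carrier M" for x
    using DM[OF that] \<psi> by blast
  have \<psi>_add: "\<psi> (x \<oplus>\<^bsub>M\<^esub> y) = \<psi> x + \<psi> y" if xy: "x \<in> carrier M" "y \<in> carrier M" for x y
  proof -
    obtain n r where x: "n \<in> N" "D \<star> x = n \<oplus>\<^bsub>M\<^esub> r \<star> a" "\<psi> x = e r" using rep[OF xy(1)] by blast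
    obtain n' r' where y: "n' \<in> N" "D \<star> y = n' \<oplus>\<^bsub>M\<^esub> r' \<star> a" "\<psi> y = e r'" using rep[OF xy(2)] by blast
    have "D \<star> (x \<oplus>\<^bsub>M\<^esub> y) = (n \<oplus>\<^bsub>M\<^esub> n') \<oplus>\<^bsub>M\<^esub> (r + r') \<star> a"
      using x y xy a NM by (simp add: smult_r_distr smult_add_left M.a_ac)
    from \<psi>[OF _ this] show ?thesis using x y E(5) by (simp add: e)
  qed
  have \<psi>_smult: "\<psi> (f \<star> x) = e f * \<psi> x" if x: "x \<in> carrier M" for f x
  proof -
    obtain n r where nr: "n \<in> N" "D \<star> x = n \<oplus>\<^bsub>M\<^esub> r \<star> a" "\<psi> x = e r" using rep[OF x] by blast
    have "D \<star> (f \<star> x) = f \<star> (D \<star> x)"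
      using x by (simp add: smult_mult[symmetric] mult.commute)
    also have "\<dots> = f \<star> n \<oplus>\<^bsub>M\<^esub> (f * r) \<star> a" using nr a NM by (simp add: smult_r_distr smult_mult)
    finally show ?thesis using \<psi>[of "f \<star> n" "f \<star> x" "f * r"] nr E(4)[OF _ nr(1)] by (simp add: e)
  qed
  have "\<psi> a = e D" using \<psi>[of "\<zero>\<^bsub>M\<^esub>" a D] E(7) a by simp
  then have \<psi>a: "\<psi> a \<noteq> 0" using D by (simp add: S_def)
  obtain A \<delta> t where A: "finite A" "A \<subseteq> carrier M" "\<delta> > 0" "t > 0"
    and rigid: "\<And>x. additive_character M (carrier M) x \<Longrightarrow>
        near_one_along M V t \<delta> A x \<Longrightarrow> (\<forall>m\<in>carrier M. x m = 1)"
    using rig unfolding rigid_along_def by blast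
  obtain B where B: "B \<ge> 0" "\<And>b. b \<in> A \<Longrightarrow> exp (t * norm w) * cmod (\<psi> b / \<psi> a) \<le> B"
    by (rule finite_upper_bound[OF A(1), where f = "\<lambda>b. exp (t * norm w) * cmod (\<psi> b / \<psi> a)"]) (rule that)
  define K where "K = 1 + B"
  have "1 \<le> K" using B(1) by (simp add: K_def)
  \<comment> \<open>\<open>s * K \<le> \<delta>\<close> keeps the character near 1 on the slab,
    where monomials have modulus at most \<open>exp (t * norm w)\<close>. Division by
    \<open>\<psi> a\<close> makes the phase at \<open>a\<close> equal to \<open>s\<close>, and
    \<open>0 < s \<le> 1\<close> makes the value there differ from 1.\<close>
  define s where "s = min 1 (\<delta> / K)"
  have s: "0 < s" "s \<le> 1" "s * K \<le> \<delta>"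
    using \<open>1 \<le> K\<close> A(3) by (auto simp: s_def min_def field_simps)
  define x where "x m = exp (\<i> * of_real (s * Re (\<psi> m / \<psi> a)))" for m
  have "\<forall>m\<in>carrier M. x m = 1"
  proof (rule rigid)
    show "additive_character M (carrier M) x"
      by (auto simp: additive_character_def x_def \<psi>_add add_divide_distrib distrib_left exp_add)
    show "near_one_along M V t \<delta> A x"
    proof (intro ballI allI impI)
      fix b n assume b: "b \<in> A" and n: "infdist (real_of_int_vec n) V \<le> t"
      have bM: "b \<in> carrier M" using b A(2) by blast
      let ?\<theta> = "s * Re (\<psi> (u_pow n \<star> b) / \<psi> a)"
      have "cmod (e (u_pow n)) = exp (real_of_int_vec n \<bullet> w)"
        using norm_monomial_eq_exp[OF z(1), of n] by (simp add: e_def u_pow_def laurent_eval_single w_def)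
      also have "\<dots> \<le> exp (t * norm w)"
        using inner_le_infdist[OF V, of w "real_of_int_vec n"] wV mult_right_mono[OF n norm_ge_zero[of w]]
        by (simp add: w_def[symmetric])
      finally have en: "cmod (e (u_pow n)) \<le> exp (t * norm w)" .
      have "cmod (x (u_pow n \<star> b) - 1) = 2 * \<bar>sin (?\<theta> / 2)\<bar>"
        unfolding x_def by (rule dist_exp_i_1)
      also have "\<dots> \<le> \<bar>?\<theta>\<bar>" using abs_sin_x_le_abs_x[of "?\<theta> / 2"] by simp
      also have "\<dots> \<le> s * cmod (\<psi> (u_pow n \<star> b) / \<psi> a)"
        using s(1) abs_Re_le_cmod[of "\<psi> (u_pow n \<star> b) / \<psi> a"] by (simp add: abs_mult mult_left_mono)
      also have "\<psi> (u_pow n \<star> b) / \<psi> a = e (u_pow n) * (\<psi> b / \<psi> a)" by (simp add: \<psi>_smult[OF bM])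
      also have "s * cmod (e (u_pow n) * (\<psi> b / \<psi> a)) \<le> s * (exp (t * norm w) * cmod (\<psi> b / \<psi> a))"
        unfolding norm_mult using s(1) en by (intro mult_left_mono mult_right_mono) auto
      also have "\<dots> \<le> s * K" using s(1) B(2)[OF b] by (intro mult_left_mono) (auto simp: K_def)
      finally show "cmod (x (u_pow n \<star> b) - 1) \<le> \<delta>" using s(3) by simp
    qed
  qed
  then have "x a = 1" using a by blast
  then have "exp (\<i> * of_real s) = 1" using \<psi>a by (simp add: x_def)
  then have "sin (s / 2) = 0" using dist_exp_i_1[of s] by simp
  moreover have "sin (s / 2) > 0" using s pi_gt3 by (intro sin_gt_zero) auto
  ultimately show False by simp
qed

theorem expansive_iff_good_primes:
  assumes M: "noetherian_module laurent_ring M" and V: "subspace V"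
  shows "algebraic_action_expansive_along M V \<longleftrightarrow>
    (\<forall>P\<in>associated_primes laurent_ring M. good_prime_along P V)"
proof
  have ne: "V \<noteq> {}" using subspace_0[OF V] by blast
  show "\<forall>P\<in>associated_primes laurent_ring M. good_prime_along P V"
    if "algebraic_action_expansive_along M V"
    using rigid_if_expansive[OF that ne] lower_unit_if_rigid[OF M _ _ V] log_variety_disjoint_if_rigid[OF M _ _ V]
    by (simp add: good_prime_along_def)
  show "algebraic_action_expansive_along M V"
    if "\<forall>P\<in>associated_primes laurent_ring M. good_prime_along P V"
    using expansive_if_rigid[OF M rigid_if_good_primes[OF M V] ne] that by blast
qed

end

section \<open>Cyclic modules\<close>

locale laurent_ideal =
  fixes P :: "('d::finite) laurent set"
  assumes ideal: "ideal P laurent_ring"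
begin

abbreviation Q :: "('d laurent, 'd laurent set) module" where
  "Q \<equiv> quotient_module laurent_ring P"

abbreviation coset :: "'d laurent \<Rightarrow> 'd laurent set" where
  "coset f \<equiv> P +>\<^bsub>laurent_ring\<^esub> f"

lemma coset_eq_iff: "coset f = coset g \<longleftrightarrow> f - g \<in> P"
proof -
  interpret L: cring "laurent_ring :: 'd laurent ring" by (rule cring_laurent_ring)
  show ?thesis using L.quotient_eq_iff_same_a_r_cos[OF ideal, of f g] by (simp add: a_minus_def)
qed

lemma quotient_module_ops:
  "carrier Q = range coset" "coset f \<oplus>\<^bsub>Q\<^esub> coset g = coset (f + g)"
  "r \<odot>\<^bsub>Q\<^esub> coset f = coset (r * f)" "\<zero>\<^bsub>Q\<^esub> = coset 0"
proof -
  interpret ideal P laurent_ring by (rule ideal)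
  show "carrier Q = range coset"
    by (auto simp: quotient_module_def ring.extend_def FactRing_def A_RCOSETS_defs a_r_coset_def)
  show "coset f \<oplus>\<^bsub>Q\<^esub> coset g = coset (f + g)"
    using a_rcos_sum[of f g] by (simp add: quotient_module_def ring.extend_def FactRing_def)
  show "r \<odot>\<^bsub>Q\<^esub> coset f = coset (r * f)"
    using rcoset_mult_add[of r f] by (simp add: quotient_module_def ring.extend_def FactRing_def)
  have "\<zero>\<^bsub>Q\<^esub> = P" by (simp add: quotient_module_def ring.extend_def FactRing_def)
  also have "P = coset 0"
    by (auto simp: a_r_coset_def r_coset_def)
  finally show "\<zero>\<^bsub>Q\<^esub> = coset 0" .
qed

lemma laurent_module_quotient: "laurent_module Q"
  unfolding laurent_module_def by (rule module_quotient_module[OF cring_laurent_ring ideal])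

lemma quotient_inv: "\<ominus>\<^bsub>Q\<^esub> coset f = coset (- f)"
proof -
  interpret Q: laurent_module Q by (rule laurent_module_quotient)
  show ?thesis
    by (rule Q.M.minus_equality) (auto simp: quotient_module_ops)
qed

text \<open>The quotient by a prime is a domain, so every nonzero coset has annihilator
  \<open>P\<close>.\<close>

lemma associated_primes_quotient:
  assumes "primeideal P laurent_ring"
  shows "associated_primes laurent_ring Q = {P}"
proof -
  interpret primeideal P laurent_ring by (rule assms)
  note D = ideal_laurentD[OF ideal]
  have ann: "{f \<in> carrier laurent_ring. f \<odot>\<^bsub>Q\<^esub> coset r = \<zero>\<^bsub>Q\<^esub>} = {f. f * r \<in> P}" for r
    by (auto simp: quotient_module_ops coset_eq_iff)
  have one: "1 \<notin> P"
  proof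
    assume "1 \<in> P"
    then have "f \<in> P" for f using D(3)[of 1 f] by simp
    then show False using I_notcarr by auto
  qed
  have prime: "{f. f * r \<in> P} = P" if "r \<notin> P" for r
    using I_prime D(3) that by (auto simp: mult.commute)
  show ?thesis
  proof (intro equalityI subsetI)
    fix P' assume "P' \<in> associated_primes laurent_ring Q"
    then obtain r where r: "primeideal P' laurent_ring" "P' = {f. f * r \<in> P}"
      unfolding associated_primes_def using ann by (auto simp: quotient_module_ops(1))
    have "r \<notin> P"
    proof
      assume "r \<in> P"
      then have "P' = carrier laurent_ring" using D(3) r(2) by auto
      then show False using primeideal.I_notcarr[OF r(1)] by simp
    qed
    then show "P' \<in> {P}" using prime r(2) by simp
  next
    fix P' assume "P' \<in> {P}"
    then have "P' = {f \<in> carrier laurent_ring. f \<odot>\<^bsub>Q\<^esub> coset 1 = \<zero>\<^bsub>Q\<^esub>}" using prime[OF one] ann[of 1] by simp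
    then show "P' \<in> associated_primes laurent_ring Q"
      using assms \<open>P' \<in> {P}\<close> by (auto simp: associated_primes_def quotient_module_ops(1))
  qed
qed

text \<open>As \<open>P\<close> is the annihilator of \<open>m\<close>, the cyclic module is
  isomorphic to the submodule of \<open>M\<close> generated by \<open>m\<close> and inherits the
  Noetherian property, so Hilbert's basis theorem is not invoked. The map \<open>L\<close>
  transports submodules along this isomorphism.\<close>

lemma noetherian_quotient:
  fixes M :: "('d laurent, 'm) module"
  assumes M: "noetherian_module laurent_ring M" and m: "m \<in> carrier M"
    and P: "P = {f \<in> carrier laurent_ring. f \<odot>\<^bsub>M\<^esub> m = \<zero>\<^bsub>M\<^esub>}"
  shows "noetherian_module laurent_ring Q"
proof -
  interpret M: laurent_module M
    using M by (simp add: laurent_module_def noetherian_module_def)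
  interpret Q: laurent_module Q by (rule laurent_module_quotient)
  have eq: "coset r = coset r'" if "r \<odot>\<^bsub>M\<^esub> m = r' \<odot>\<^bsub>M\<^esub> m" for r r'
  proof -
    have "(r - r') \<odot>\<^bsub>M\<^esub> m = r \<odot>\<^bsub>M\<^esub> m \<oplus>\<^bsub>M\<^esub> \<ominus>\<^bsub>M\<^esub> (r' \<odot>\<^bsub>M\<^esub> m)"
      using M.smult_add_left[OF m, of r "- r'"] m by (simp add: M.smult_minus_left)
    then have "r - r' \<in> P" using that m by (simp add: P M.M.r_neg)
    then show ?thesis by (simp add: coset_eq_iff)
  qed
  define L where "L N = {r \<odot>\<^bsub>M\<^esub> m | r. coset r \<in> N}" for N
  have L_mem: "r \<odot>\<^bsub>M\<^esub> m \<in> L N \<longleftrightarrow> coset r \<in> N" for r N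
  proof
    assume "r \<odot>\<^bsub>M\<^esub> m \<in> L N"
    then obtain r' where "r \<odot>\<^bsub>M\<^esub> m = r' \<odot>\<^bsub>M\<^esub> m" "coset r' \<in> N" unfolding L_def by blast
    then show "coset r \<in> N" using eq[of r r'] by simp
  qed (unfold L_def, blast)
  have L_sub: "submodule (L N) laurent_ring M" if N: "submodule N laurent_ring Q" for N
  proof -
    note E = Q.submoduleE[OF N] Q.submodule_zero_mem[OF N]
    show ?thesis
    proof (rule M.submoduleI)
      show "L N \<subseteq> carrier M" using m by (auto simp: L_def)
      show "\<zero>\<^bsub>M\<^esub> \<in> L N"
        using L_mem[of 0 N] E(7) m M.smult_l_null[of m] by (simp add: quotient_module_ops)
      fix a assume "a \<in> L N"
      then obtain r where r: "a = r \<odot>\<^bsub>M\<^esub> m" "coset r \<in> N" by (auto simp: L_def)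
      show "\<ominus>\<^bsub>M\<^esub> a \<in> L N"
        using L_mem[of "- r" N] E(3)[OF r(2)] m by (simp add: quotient_inv r(1) M.smult_minus_left)
      show "f \<odot>\<^bsub>M\<^esub> a \<in> L N" for f
        using L_mem[of "f * r" N] E(4)[OF _ r(2), of f] m by (simp add: quotient_module_ops r(1) M.smult_mult)
      fix b assume "b \<in> L N"
      then obtain s where s: "b = s \<odot>\<^bsub>M\<^esub> m" "coset s \<in> N" by (auto simp: L_def)
      show "a \<oplus>\<^bsub>M\<^esub> b \<in> L N"
        using L_mem[of "r + s" N] E(5)[OF r(2) s(2)] m
        by (simp add: quotient_module_ops r(1) s(1) M.smult_add_left)
    qed
  qed
  have "\<exists>A. finite A \<and> A \<subseteq> N \<and> N = \<Inter>{N'. submodule N' laurent_ring Q \<and> A \<subseteq> N'}"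
    if N: "submodule N laurent_ring Q" for N
  proof -
    obtain A where A: "finite A" "A \<subseteq> L N" "L N = \<Inter>{N'. submodule N' laurent_ring M \<and> A \<subseteq> N'}"
      by (rule M.noetherian_finitely_generated[OF M L_sub[OF N]])
    have "\<forall>a\<in>A. \<exists>r. a = r \<odot>\<^bsub>M\<^esub> m \<and> coset r \<in> N" using A(2) by (auto simp: L_def)
    then obtain r where r: "\<And>a. a \<in> A \<Longrightarrow> a = r a \<odot>\<^bsub>M\<^esub> m" "\<And>a. a \<in> A \<Longrightarrow> coset (r a) \<in> N" by metis
    let ?B = "(\<lambda>a. coset (r a)) ` A"
    have "N \<subseteq> N'" if N': "submodule N' laurent_ring Q" "?B \<subseteq> N'" for N'
    proof
      have "A \<subseteq> L N'"
      proof
        fix a assume a: "a \<in> A"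
        then have "coset (r a) \<in> N'" using N'(2) by blast
        then show "a \<in> L N'" using L_mem r(1)[OF a] by metis
      qed
      then have sub: "L N \<subseteq> L N'" using A(3) L_sub[OF N'(1)] by blast
      fix c assume c: "c \<in> N"
      then obtain f where f: "c = coset f" using Q.submoduleE(1)[OF N] by (auto simp: quotient_module_ops(1))
      then show "c \<in> N'" using sub c L_mem by blast
    qed
    then have "N = \<Inter>{N'. submodule N' laurent_ring Q \<and> ?B \<subseteq> N'}" using N r(2) by blast
    then show ?thesis using A(1) r(2) by (intro exI[of _ ?B]) auto
  qed
  then show ?thesis
    using Q.module_axioms unfolding noetherian_module_def by simp
qed

end

section \<open>Half-space rings\<close>

lemma half_space_ring_simps [simp]:
  "monoid.mult (half_space_ring H) = (*)" "monoid.one (half_space_ring H) = 1"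
  "add (half_space_ring H) = (+)" "ring.zero (half_space_ring H) = 0"
  by (simp_all add: half_space_ring_def)

lemma cring_half_space_ring: "cring (half_space_ring H :: ('d::finite) laurent ring)"
proof -
  interpret L: cring "laurent_ring :: 'd laurent ring" by (rule cring_laurent_ring)
  interpret K: ring "half_space_ring H :: 'd laurent ring"
    unfolding half_space_ring_def by (rule L.generate_ring_is_ring) simp
  show ?thesis
    by (intro cring.intro comm_monoid.intro comm_monoid_axioms.intro K.ring_axioms K.monoid_axioms)
      (simp add: mult.commute)
qed

lemma carrier_half_space_ring:
  fixes v :: "real ^ ('d::finite)"
  shows "carrier (half_space_ring {x. x \<bullet> v \<le> 0}) = {f. \<forall>k\<in>keys f. real_of_int_vec k \<bullet> v \<le> 0}"
    (is "?A = ?B")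
proof (intro equalityI subsetI)
  let ?U = "{u_pow n | n. real_of_int_vec n \<in> {x. x \<bullet> v \<le> 0}}"
  have A: "?A = generate_ring laurent_ring ?U" by (simp add: half_space_ring_def)
  show "f \<in> ?B" if "f \<in> ?A" for f
    using that unfolding A
  proof (induction rule: generate_ring.induct)
    case one
    then show ?case by simp
  next
    case (incl h)
    then show ?case by (auto simp: u_pow_def)
  next
    case (a_inv h)
    then show ?case by (auto simp: in_keys_iff)
  next
    case (eng_add f g)
    then show ?case using keys_add[of f g] by auto
  next
    case (eng_mult f g)
    show ?case
    proof (intro CollectI ballI)
      fix k assume "k \<in> keys (f \<otimes>\<^bsub>laurent_ring\<^esub> g)"
      then obtain a b where "a \<in> keys f" "b \<in> keys g" "k = a + b"
        using keys_mult[of f g] by auto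
      then show "real_of_int_vec k \<bullet> v \<le> 0"
        using eng_mult.IH by (auto simp: real_of_int_vec_add inner_add_left intro: add_nonpos_nonpos)
    qed
  qed
  have zero: "0 \<in> ?A"
    unfolding A using ring.zero_in_generate[OF cring.axioms(1)[OF cring_laurent_ring], of ?U] by simp
  have add: "f + g \<in> ?A" if "f \<in> ?A" "g \<in> ?A" for f g
    using generate_ring.eng_add[of f laurent_ring ?U g] that unfolding A by simp
  have minus: "- f \<in> ?A" if "f \<in> ?A" for f
    using generate_ring.a_inv[of f laurent_ring ?U] that unfolding A by simp
  have single: "single k c \<in> ?A" if k: "real_of_int_vec k \<bullet> v \<le> 0" for k and c :: int
  proof (induction c rule: int_induct[where k = 0])
    case base
    then show ?case by (simp add: zero)
  next
    have u: "u_pow k \<in> ?A" unfolding A using k by (intro generate_ring.incl) auto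
    case (step1 i)
    then show ?case using add u by (simp add: single_add u_pow_def)
  next
    have u: "u_pow k \<in> ?A" unfolding A using k by (intro generate_ring.incl) auto
    case (step2 i)
    then show ?case using add[OF step2(2) minus[OF u]] by (simp add: single_diff u_pow_def)
  qed
  fix f assume f: "f \<in> ?B"
  have "(\<Sum>k\<in>K. single k (lookup f k)) \<in> ?A"
    if "finite K" "K \<subseteq> keys f" for K
    using that
  proof (induction K rule: finite_induct)
    case (insert k K)
    then show ?case using f by (auto intro!: add single)
  qed (simp add: zero)
  from this[of "keys f"] show "f \<in> ?A" by (simp add: poly_mapping_sum_single)
qed

context laurent_ideal
begin

text \<open>Multiplication by the half-space ring does not raise heights, so every coset has a
  representative no higher than the bound \<open>c\<close> for the generators. For a monomial above
  \<open>c\<close>, dividing by it turns this representative into a polynomial with strictly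
  negative heights.\<close>

lemma lower_unit_if_noetherian:
  fixes v :: "real ^ 'd"
  assumes v: "norm v = 1" and noeth: "noetherian_module (half_space_ring {x. x \<bullet> v \<le> 0}) Q"
  shows "lower_unit_at P v"
proof -
  let ?K = "half_space_ring {x. x \<bullet> v \<le> 0} :: 'd laurent ring"
  note D = ideal_laurentD[OF ideal]
  interpret K: Module.module ?K Q using noeth by (simp add: noetherian_module_def)
  obtain A where A: "finite A" "A \<subseteq> carrier Q" "carrier Q = \<Inter>{N'. submodule N' ?K Q \<and> A \<subseteq> N'}"
    by (rule K.noetherian_finitely_generated[OF noeth K.submodule_carrier])
  have "\<forall>a\<in>A. \<exists>f. a = coset f" using A(2) by (auto simp: quotient_module_ops(1))
  then obtain f where f: "\<And>a. a \<in> A \<Longrightarrow> a = coset (f a)" by metis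
  obtain c where c: "\<And>a k. a \<in> A \<Longrightarrow> k \<in> keys (f a) \<Longrightarrow> real_of_int_vec k \<bullet> v \<le> c"
    by (rule finite_upper_bound_keys[OF A(1), where f = "\<lambda>k. real_of_int_vec k \<bullet> v"]) (rule that)
  define F where "F = {f :: 'd laurent. \<forall>k\<in>keys f. real_of_int_vec k \<bullet> v \<le> c}"
  have "submodule (coset ` F) ?K Q"
  proof (rule K.submoduleI)
    show "coset ` F \<subseteq> carrier Q" by (auto simp: quotient_module_ops(1))
    show "\<zero>\<^bsub>Q\<^esub> \<in> coset ` F" by (auto simp: quotient_module_ops F_def intro!: image_eqI[of _ _ 0])
    fix a assume "a \<in> coset ` F"
    then obtain g where g: "a = coset g" "g \<in> F" by blast
    have "- g \<in> F" using g by (auto simp: F_def in_keys_iff)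
    then show "\<ominus>\<^bsub>Q\<^esub> a \<in> coset ` F" using g by (simp add: quotient_inv)
    show "r \<odot>\<^bsub>Q\<^esub> a \<in> coset ` F" if r: "r \<in> carrier ?K" for r
    proof -
      have "r * g \<in> F"
        unfolding F_def
      proof (intro CollectI ballI)
        fix k assume "k \<in> keys (r * g)"
        then obtain i j where "i \<in> keys r" "j \<in> keys g" "k = i + j"
          using keys_mult[of r g] by blast
        then show "real_of_int_vec k \<bullet> v \<le> c"
          using r g(2) by (force simp: carrier_half_space_ring F_def real_of_int_vec_add inner_add_left)
      qed
      then show ?thesis using g by (simp add: quotient_module_ops)
    qed
    fix b assume "b \<in> coset ` F"
    then obtain h where h: "b = coset h" "h \<in> F" by blast
    have "g + h \<in> F" using g h keys_add[of g h] by (auto simp: F_def)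
    then show "a \<oplus>\<^bsub>Q\<^esub> b \<in> coset ` F" using g h by (simp add: quotient_module_ops)
  qed
  moreover have "A \<subseteq> coset ` F" using f c by (force simp: F_def)
  ultimately have "carrier Q \<subseteq> coset ` F" using A(3) by blast
  obtain k where k: "real_of_int_vec k \<bullet> v > c" using exists_high_exponent[OF v] .
  have "coset (u_pow k) \<in> coset ` F" using \<open>carrier Q \<subseteq> coset ` F\<close> by (auto simp: quotient_module_ops(1))
  then obtain g where g: "coset (u_pow k) = coset g" "g \<in> F" by blast
  then have "u_pow k - g \<in> P" by (simp add: coset_eq_iff)
  then have "u_pow (- k) * (u_pow k - g) \<in> P" by (rule D(3))
  then have "1 - u_pow (- k) * g \<in> P" by (simp add: right_diff_distrib)
  moreover have "real_of_int_vec j \<bullet> v < 0" if j: "j \<in> keys (u_pow (- k) * g)" for j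
  proof -
    obtain i where i: "i \<in> keys g" "j = - k + i"
      using j keys_single_times[of "- k" 1 g] by (auto simp: u_pow_def)
    then have "real_of_int_vec i \<bullet> v \<le> c" using g(2) by (simp add: F_def)
    moreover have "real_of_int_vec j \<bullet> v = real_of_int_vec i \<bullet> v - real_of_int_vec k \<bullet> v"
      unfolding i(2) real_of_int_vec_add real_of_int_vec_minus by (simp add: inner_diff_left)
    ultimately show ?thesis using k by simp
  qed
  ultimately show ?thesis unfolding lower_unit_at_def by blast
qed

text \<open>Descent with the linear height given by \<open>v\<close>: passing to a term of
  \<open>g\<close> lowers it by at least \<open>e\<close>, and monomials of height at most 0 lie in
  the half-space ring.\<close>

lemma representative_in_half_space_ring:
  fixes v :: "real ^ 'd"
  assumes "lower_unit_at P v"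
  obtains h where "h \<in> carrier (half_space_ring {x. x \<bullet> v \<le> 0})" "f - h \<in> P"
proof -
  note D = ideal_laurentD[OF ideal]
  let ?B = "carrier (half_space_ring {x. x \<bullet> v \<le> 0}) :: 'd laurent set"
  obtain g e where g: "1 - g \<in> P" "e > 0"
    "\<And>w k. w \<in> ball v e \<Longrightarrow> k \<in> keys g \<Longrightarrow> real_of_int_vec k \<bullet> w \<le> - e"
    by (rule lower_unit_at_neighborhood[OF assms]) (rule that)
  have low: "real_of_int_vec k \<bullet> v \<le> - e" if "k \<in> keys g" for k
    using g(3)[of v k] g(2) that by simp
  interpret laurent_descent P "\<lambda>m. real_of_int_vec m \<bullet> v" 0 e "{g}"
    by standard (use D g(1,2) low in \<open>auto simp: real_of_int_vec_add inner_add_left\<close>)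
  have "f \<in> {f. \<exists>h\<in>?B. f - h \<in> P}"
  proof (rule generated_by_low)
    show "P \<subseteq> {f. \<exists>h\<in>?B. f - h \<in> P}" by (auto simp: carrier_half_space_ring intro!: bexI[of _ 0])
    show "f1 - f2 \<in> {f. \<exists>h\<in>?B. f - h \<in> P}"
      if f12: "f1 \<in> {f. \<exists>h\<in>?B. f - h \<in> P}" "f2 \<in> {f. \<exists>h\<in>?B. f - h \<in> P}" for f1 f2
    proof -
      obtain h1 h2 where h: "h1 \<in> ?B" "f1 - h1 \<in> P" "h2 \<in> ?B" "f2 - h2 \<in> P" using f12 by blast
      have "h1 - h2 \<in> ?B" using h(1,3) keys_diff[of h1 h2] by (auto simp: carrier_half_space_ring)
      moreover have "(f1 - f2) - (h1 - h2) \<in> P" using D(5)[OF h(2,4)] by (simp add: algebra_simps)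
      ultimately show ?thesis by blast
    qed
    show "u_pow m \<in> {f. \<exists>h\<in>?B. f - h \<in> P}" if "real_of_int_vec m \<bullet> v \<le> 0" for m
    proof -
      have "u_pow m \<in> ?B" using that by (simp add: carrier_half_space_ring u_pow_def)
      then show ?thesis using D(1) by (auto intro!: bexI[of _ "u_pow m"])
    qed
  qed
  then show ?thesis using that by blast
qed

text \<open>The half-space ring already maps onto the quotient by \<open>P\<close>, so both rings
  have the same submodules there.\<close>

lemma noetherian_if_lower_unit:
  fixes v :: "real ^ 'd"
  assumes noeth: "noetherian_module laurent_ring Q" and low: "lower_unit_at P v"
  shows "noetherian_module (half_space_ring {x. x \<bullet> v \<le> 0}) Q"
proof -
  let ?K = "half_space_ring {x. x \<bullet> v \<le> 0} :: 'd laurent ring"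
  interpret Q: laurent_module Q by (rule laurent_module_quotient)
  have K: "Module.module ?K Q"
  proof (rule moduleI)
    show "cring ?K" by (rule cring_half_space_ring)
    show "abelian_group Q" by (rule Q.M.abelian_group_axioms)
  qed (auto simp: Q.smult_add_left Q.smult_mult Q.smult_r_distr)
  interpret K: Module.module ?K Q by (rule K)
  have sub: "submodule N ?K Q \<longleftrightarrow> submodule N laurent_ring Q" for N
  proof
    assume N: "submodule N ?K Q"
    note E = K.submoduleE[OF N] K.submodule_zero_mem[OF N]
    show "submodule N laurent_ring Q"
    proof (rule Q.submoduleI)
      fix r x assume x: "x \<in> N"
      then obtain f where f: "x = coset f" using E(1) by (auto simp: quotient_module_ops(1))
      obtain h where h: "h \<in> carrier ?K" "r - h \<in> P" using representative_in_half_space_ring[OF low] .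
      have "r * f - h * f \<in> P"
        using ideal_laurentD(3)[OF ideal h(2), of f] by (simp add: algebra_simps)
      then have "r \<odot>\<^bsub>Q\<^esub> x = h \<odot>\<^bsub>Q\<^esub> x" by (simp add: f quotient_module_ops coset_eq_iff)
      then show "r \<odot>\<^bsub>Q\<^esub> x \<in> N" using E(4)[OF h(1) x] by simp
    qed (use E in auto)
  next
    assume N: "submodule N laurent_ring Q"
    note E = Q.submoduleE[OF N] Q.submodule_zero_mem[OF N]
    show "submodule N ?K Q" by (rule K.submoduleI) (use E in auto)
  qed
  show ?thesis
    using noeth K by (simp add: noetherian_module_def sub)
qed

lemma noetherian_along_iff_lower_unit:
  assumes noeth: "noetherian_module laurent_ring Q" and V: "subspace V"
  shows "noetherian_along Q V \<longleftrightarrow> (\<forall>v\<in>V\<^sup>\<bottom>. norm v = 1 \<longrightarrow> lower_unit_at P v)"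
proof -
  \<comment> \<open>A subspace contains the negatives of its vectors, so lying in the half-space
    forces orthogonality to \<open>v\<close>.\<close>
  have half: "V \<subseteq> {x. x \<bullet> v \<le> 0} \<longleftrightarrow> v \<in> V\<^sup>\<bottom>" for v
  proof
    assume le: "V \<subseteq> {x. x \<bullet> v \<le> 0}"
    have "x \<bullet> v = 0" if x: "x \<in> V" for x
    proof -
      have "- x \<in> V" using V x by (simp add: subspace_neg)
      then have "x \<bullet> v \<le> 0" "(- x) \<bullet> v \<le> 0" using le x by blast+
      then show ?thesis by simp
    qed
    then show "v \<in> V\<^sup>\<bottom>" by (auto simp: orthogonal_comp_def orthogonal_def)
  qed (auto simp: orthogonal_comp_def orthogonal_def)
  have "noetherian_along Q V \<longleftrightarrow>
    (\<forall>v. norm v = 1 \<longrightarrow> v \<in> V\<^sup>\<bottom> \<longrightarrow> noetherian_module (half_space_ring {x. x \<bullet> v \<le> 0}) Q)"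
    unfolding noetherian_along_def half_spaces_def half[symmetric] using noeth by blast
  then show ?thesis
    using lower_unit_if_noetherian noetherian_if_lower_unit[OF noeth] by blast
qed

end

theorem theorem8p4:
  fixes M :: "(('d::finite) laurent, 'm) module"
    and V :: "(real ^ 'd) set"
  assumes "noetherian_module laurent_ring M"
    and "subspace V"
  shows "(algebraic_action_expansive_along M V \<longleftrightarrow>
            (\<forall>P\<in>associated_primes laurent_ring M.
               algebraic_action_expansive_along (quotient_module laurent_ring P) V))
       \<and> ((\<forall>P\<in>associated_primes laurent_ring M.
               algebraic_action_expansive_along (quotient_module laurent_ring P) V) \<longleftrightarrow>
            (\<forall>P\<in>associated_primes laurent_ring M.
               noetherian_along (quotient_module laurent_ring P) V \<and>
               V\<^sup>\<bottom> \<inter> log_variety P = {}))"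
proof -
  interpret M: laurent_module M
    using assms(1) by (simp add: laurent_module_def noetherian_module_def)
  have quotient: "(algebraic_action_expansive_along (quotient_module laurent_ring P) V \<longleftrightarrow> good_prime_along P V) \<and>
      (noetherian_along (quotient_module laurent_ring P) V \<and> V\<^sup>\<bottom> \<inter> log_variety P = {} \<longleftrightarrow> good_prime_along P V)"
    if P: "P \<in> associated_primes laurent_ring M" for P
  proof -
    obtain m where m: "primeideal P laurent_ring" "m \<in> carrier M"
      "P = {f \<in> carrier laurent_ring. f \<odot>\<^bsub>M\<^esub> m = \<zero>\<^bsub>M\<^esub>}"
      using P unfolding associated_primes_def by blast
    interpret laurent_ideal P
      using m(1) by (simp add: laurent_ideal_def primeideal_def)
    interpret Q: laurent_module Q by (rule laurent_module_quotient)
    have noeth: "noetherian_module laurent_ring Q" by (rule noetherian_quotient[OF assms(1) m(2,3)])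
    show ?thesis
      using Q.expansive_iff_good_primes[OF noeth assms(2)] associated_primes_quotient[OF m(1)]
        noetherian_along_iff_lower_unit[OF noeth assms(2)]
      by (simp add: good_prime_along_def)
  qed
  show ?thesis
    using M.expansive_iff_good_primes[OF assms] quotient by blast
qed

end
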